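(* Let $L$ be a link in $S^3$ with more than two components. If $L$ has a connected almost alternating diagram, then $L$ is non-trivial.
   Context: Links are in $S^3$ and link diagrams lie on $S^2$. A link diagram is connected if its underlying projection (as a subset of $S^2$) is connected. A link diagram is almost alternating if changing one crossing makes it alternating. A link with $n$ components is trivial if it is the $n$-component unlink, i.e. if it has a diagram with no crossings; otherwise it is non-trivial. *)

theory Defs
  imports "HOL-Analysis.Analysis"
begin

section \<open>Links in the 3-sphere\<close>

text \<open>The 3-sphere is the unit sphere of \<open>\<real>\<^sup>3 \<times> \<real> = \<real>\<^sup>4\<close>; the last coordinate serves as the height
  over the 2-sphere.\<close>

abbreviation S2 :: "(real^3) set" where
  "S2 \<equiv> sphere 0 1"

abbreviation S3 :: "((real^3) \<times> real) set" where
  "S3 \<equiv> sphere 0 1"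

text \<open>No tameness is imposed: a link that has a diagram, in the sense below, is automatically tame.\<close>

definition link :: "((real^3) \<times> real) set \<Rightarrow> bool" where
  "link L \<longleftrightarrow> L \<subseteq> S3 \<and> finite (components L) \<and>
     (\<forall>C \<in> components L. C homeomorphic sphere (0::complex) 1)"

definition ambient_isotopic :: "((real^3) \<times> real) set \<Rightarrow> ((real^3) \<times> real) set \<Rightarrow> bool" where
  "ambient_isotopic A B \<longleftrightarrow>
     (\<exists>H :: real \<Rightarrow> (real^3) \<times> real \<Rightarrow> (real^3) \<times> real.
        continuous_on ({0..1} \<times> S3) (\<lambda>(t, x). H t x) \<and>
        (\<forall>t \<in> {0..1}. \<exists>g. homeomorphism S3 S3 (H t) g) \<and>
        (\<forall>x \<in> S3. H 0 x = x) \<and>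
        H 1 ` A = B)"


section \<open>Link diagrams on the 2-sphere\<close>

text \<open>A diagram is a finite family of closed curves \<open>strand D i\<close>, \<open>i < ncomps D\<close>, on the 2-sphere,
  each given as a function on the line of period 1, with over/under information:
  \<open>over D i s\<close> says that curve \<open>i\<close> is the overpass when it goes through a crossing at
  parameter \<open>s\<close>. The value of \<open>over\<close> at other parameters is irrelevant.\<close>

record link_diagram =
  ncomps :: nat
  strand :: "nat \<Rightarrow> real \<Rightarrow> real^3"
  over :: "nat \<Rightarrow> real \<Rightarrow> bool"

text \<open>Two different points \<open>(i, s)\<close> and \<open>(j, t)\<close> of the disjoint union of circles have the same
  image. Parameters are read modulo 1.\<close>

definition meet :: "link_diagram \<Rightarrow> nat \<Rightarrow> real \<Rightarrow> nat \<Rightarrow> real \<Rightarrow> bool" where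
  "meet D i s j t \<longleftrightarrow> i < ncomps D \<and> j < ncomps D \<and> \<not> (i = j \<and> s - t \<in> \<int>) \<and>
     strand D i s = strand D j t"

definition crossings :: "link_diagram \<Rightarrow> (real^3) set" where
  "crossings D = {p. \<exists>i s j t. meet D i s j t \<and> p = strand D i s}"

definition projection :: "link_diagram \<Rightarrow> (real^3) set" where
  "projection D = (\<Union>i<ncomps D. range (strand D i))"

text \<open>The curves are generic: regular of class C1, with finitely many multiple points, all of
  which are transverse double points.\<close>

definition is_diagram :: "link_diagram \<Rightarrow> bool" where
  "is_diagram D \<longleftrightarrow>
     (\<forall>i<ncomps D.
        range (strand D i) \<subseteq> S2 \<and>
        (\<forall>s. strand D i (s + 1) = strand D i s) \<and>
        (\<forall>s. over D i (s + 1) = over D i s) \<and>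
        strand D i C1_differentiable_on UNIV \<and>
        (\<forall>s. vector_derivative (strand D i) (at s) \<noteq> 0)) \<and>
     finite (crossings D) \<and>
     (\<forall>i s j t k u. meet D i s j t \<and> meet D i s k u \<longrightarrow> j = k \<and> t - u \<in> \<int>) \<and>
     (\<forall>i s j t. meet D i s j t \<longrightarrow>
        \<not> collinear {0, vector_derivative (strand D i) (at s), vector_derivative (strand D j) (at t)} \<and>
        over D i s \<noteq> over D j t)"

definition connected_diagram :: "link_diagram \<Rightarrow> bool" where
  "connected_diagram D \<longleftrightarrow> connected (projection D)"

text \<open>Consecutive passages through crossings are taken on the real line, so the last and the first
  passage in a period are consecutive, too.\<close>

definition alternating :: "link_diagram \<Rightarrow> bool" where
  "alternating D \<longleftrightarrow>
     (\<forall>i<ncomps D. \<forall>s t. s < t \<and>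
        strand D i s \<in> crossings D \<and> strand D i t \<in> crossings D \<and>
        (\<forall>u. s < u \<and> u < t \<longrightarrow> strand D i u \<notin> crossings D) \<longrightarrow>
        over D i s \<noteq> over D i t)"

definition change_crossing :: "link_diagram \<Rightarrow> real^3 \<Rightarrow> link_diagram" where
  "change_crossing D p =
     D\<lparr>over := (\<lambda>i s. if strand D i s = p then \<not> over D i s else over D i s)\<rparr>"

definition almost_alternating :: "link_diagram \<Rightarrow> bool" where
  "almost_alternating D \<longleftrightarrow> (\<exists>p \<in> crossings D. alternating (change_crossing D p))"


section \<open>The link of a diagram\<close>

text \<open>The point at height \<open>h\<close> over \<open>x\<close>, under the identification of the 3-sphere without its
  poles \<open>(0, 1)\<close> and \<open>(0, -1)\<close> with the product of the 2-sphere and the interval from -1 to 1.\<close>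

definition at_height :: "real^3 \<Rightarrow> real \<Rightarrow> (real^3) \<times> real" where
  "at_height x h = (sqrt (1 - h\<^sup>2) *\<^sub>R x, h)"

text \<open>\<open>K\<close> lies over the curves of \<open>D\<close>, with the overpass at each crossing above the underpass.\<close>

definition projects_to :: "((real^3) \<times> real) set \<Rightarrow> link_diagram \<Rightarrow> bool" where
  "projects_to K D \<longleftrightarrow>
     (\<exists>h :: nat \<Rightarrow> real \<Rightarrow> real.
        (\<forall>i<ncomps D. continuous_on UNIV (h i) \<and> (\<forall>s. h i (s + 1) = h i s) \<and>
           (\<forall>s. -1 < h i s \<and> h i s < 1)) \<and>
        (\<forall>i s j t. meet D i s j t \<and> over D i s \<longrightarrow> h j t < h i s) \<and>
        K = (\<Union>i<ncomps D. range (\<lambda>s. at_height (strand D i s) (h i s))))"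

definition has_diagram :: "((real^3) \<times> real) set \<Rightarrow> link_diagram \<Rightarrow> bool" where
  "has_diagram L D \<longleftrightarrow> is_diagram D \<and> (\<exists>K. projects_to K D \<and> ambient_isotopic L K)"

definition trivial_link :: "((real^3) \<times> real) set \<Rightarrow> bool" where
  "trivial_link L \<longleftrightarrow> (\<exists>D. has_diagram L D \<and> crossings D = {})"

end

theory Submission imports Defs "HOL-Library.Z2" begin

text \<open>
  The obstruction is the size of the first cohomology of the link complement with coefficients in
  the isometries \<open>x \<mapsto> \<plusminus>x + v\<close> of a vector space, where every meridian acts by a point reflection. For a
  diagram, a class is a colouring of the faces: a loop runs from above the diagram to below it through
  a face and back through another one. At a crossing the translation parts of the four faces satisfy
  \<open>w\<^sub>A + w\<^sub>B = w\<^sub>C + w\<^sub>D\<close>.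

  If the link is trivial with \<open>n\<close> components, then a crossingless diagram has \<open>n + 1\<close> faces and no
  crossing relations. For \<open>n > 2\<close> this leaves room for a class with complex translation parts and
  reflecting meridians such that no nonzero real functional makes it equivalent to its sign part.

  In the almost alternating diagram, choose the functional so that \<open>w\<^sub>A = w\<^sub>C\<close> at the exceptional
  crossing. With real weights, the sum over all passages of \<open>\<plusminus>\<close> the products of the weights on the two
  sides of a strand, before and after the passage, telescopes to 0 because the diagram alternates once
  the exceptional crossing is changed. On the other hand, up to sign it equals \<open>\<Sum> (w\<^sub>A - w\<^sub>C)\<^sup>2\<close>,
  taken over the other crossings. So \<open>w\<^sub>A = w\<^sub>C\<close> at every crossing, the colouring of a connected
  diagram takes only two values, and the class is equivalent to its sign part, a contradiction.
\<close>

section \<open>Local cocycles\<close>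

text \<open>The translation parts are complex for a dimension reason. Real weights on the
  \<open>n + 1\<close> faces of a crossingless diagram, modulo those constant on each of the two
  sign classes, form a space of dimension at least \<open>n - 1\<close>, hence at least 2 for
  \<open>n > 2\<close>. The exceptional crossing enters the energy identity with the wrong sign, and
  one real linear condition, \<open>w_A = w_C\<close> there, makes its term vanish; a complex class
  followed by a suitable functional meets this condition and stays nontrivial. That every meridian
  acts as a reflection cannot simply be imposed, because the homeomorphism between the two
  complements comes with no control of meridians. It is obtained by counting: a class modulo 2 is
  determined by the strands of the almost alternating diagram across which it changes sign, and the
  crossingless diagram supplies \<open>2^n\<close> classes. So all \<open>2^n\<close> sets of
  strands occur, the full set among them.\<close>

text \<open>Alexander--Spanier 1-cocycles with nonabelian coefficients. They replace homomorphisms from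
  the fundamental group and are transported along homeomorphisms without any choice of paths.\<close>

definition loc_const :: "'a::topological_space set \<Rightarrow> ('a \<Rightarrow> 'b) \<Rightarrow> bool" where
  "loc_const X f \<longleftrightarrow> (\<forall>x\<in>X. \<exists>W. open W \<and> x \<in> W \<and> (\<forall>y\<in>W \<inter> X. f y = f x))"

definition cocycle_on :: "'a set \<Rightarrow> ('a \<Rightarrow> 'a \<Rightarrow> 'g::group_add) \<Rightarrow> bool" where
  "cocycle_on W t \<longleftrightarrow> (\<forall>a\<in>W. \<forall>b\<in>W. \<forall>c\<in>W. t a b + t b c = t a c)"

definition local_cocycle :: "'a::topological_space set \<Rightarrow> ('a \<Rightarrow> 'a \<Rightarrow> 'g::group_add) \<Rightarrow> bool" where
  "local_cocycle X t \<longleftrightarrow> (\<forall>x\<in>X. \<exists>W. open W \<and> x \<in> W \<and> cocycle_on (W \<inter> X) t)"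

text \<open>Only the local increments of \<open>f\<close> are prescribed, so \<open>f\<close> itself
  need not be continuous. Replacing \<open>f\<close> by \<open>g + f\<close> changes nothing; the
  constant stands on the left because the coefficients need not commute.\<close>

definition primitive :: "'a::topological_space set \<Rightarrow> ('a \<Rightarrow> 'a \<Rightarrow> 'g::group_add) \<Rightarrow> ('a \<Rightarrow> 'g) \<Rightarrow> bool" where
  "primitive X t f \<longleftrightarrow> (\<forall>x\<in>X. \<exists>W. open W \<and> x \<in> W \<and> (\<forall>a\<in>W \<inter> X. \<forall>b\<in>W \<inter> X. t a b = - f a + f b))"

text \<open>Cohomologous cocycles, with an arbitrary 0-cochain \<open>F\<close>. A primitive of
  \<open>t\<close> is a gauge from \<open>t\<close> to the zero cocycle.\<close>

definition gauge_equiv :: "'a::topological_space set \<Rightarrow> ('a \<Rightarrow> 'a \<Rightarrow> 'g::group_add) \<Rightarrow> ('a \<Rightarrow> 'a \<Rightarrow> 'g) \<Rightarrow> bool" where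
  "gauge_equiv X t t' \<longleftrightarrow> (\<exists>F. \<forall>x\<in>X. \<exists>W. open W \<and> x \<in> W \<and>
     (\<forall>a\<in>W \<inter> X. \<forall>b\<in>W \<inter> X. F a + t a b = t' a b + F b))"

lemma loc_const_connected:
  assumes "connected X" "loc_const X f" "x \<in> X" "y \<in> X"
  shows "f x = f y"
proof -
  have "f constant_on X"
  proof (rule locally_constant_imp_constant[OF assms(1)])
    fix a assume "a \<in> X"
    with assms(2) obtain W where "open W" "a \<in> W" "\<forall>y\<in>W \<inter> X. f y = f a"
      unfolding loc_const_def by blast
    then show "\<exists>T. openin (top_of_set X) T \<and> a \<in> T \<and> (\<forall>x\<in>T. f x = f a)"
      using \<open>a \<in> X\<close> by (intro exI[of _ "X \<inter> W"] conjI openin_open_Int) blast+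
  qed
  then show ?thesis using assms(3,4) by (auto simp: constant_on_def)
qed

lemma loc_constD:
  assumes "loc_const X f" "x \<in> X"
  obtains W where "open W" "x \<in> W" "\<forall>y. y \<in> W \<longrightarrow> y \<in> X \<longrightarrow> f y = f x"
proof -
  have "\<exists>W. open W \<and> x \<in> W \<and> (\<forall>y\<in>W \<inter> X. f y = f x)"
    using assms unfolding loc_const_def by (rule bspec)
  then obtain W where "open W" "x \<in> W" "\<forall>y\<in>W \<inter> X. f y = f x" by (elim exE conjE)
  then show thesis by (intro that[of W]) blast+
qed

lemma loc_const_subset:
  assumes "loc_const X f" "Y \<subseteq> X" shows "loc_const Y f"
  unfolding loc_const_def
proof
  fix x assume "x \<in> Y"
  with assms obtain W where "open W" "x \<in> W" "\<forall>y. y \<in> W \<longrightarrow> y \<in> X \<longrightarrow> f y = f x"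
    using loc_constD[of X f x] by blast
  then show "\<exists>W. open W \<and> x \<in> W \<and> (\<forall>y\<in>W \<inter> Y. f y = f x)"
    using assms(2) by blast
qed

lemma loc_const_combine:
  assumes "loc_const X f" "loc_const X g"
  shows "loc_const X (\<lambda>x. q (f x) (g x))"
  unfolding loc_const_def
proof
  fix x assume "x \<in> X"
  obtain W where "open W" "x \<in> W" "\<forall>y\<in>W \<inter> X. f y = f x"
    using assms(1) \<open>x \<in> X\<close> unfolding loc_const_def by blast
  moreover obtain W' where "open W'" "x \<in> W'" "\<forall>y\<in>W' \<inter> X. g y = g x"
    using assms(2) \<open>x \<in> X\<close> unfolding loc_const_def by blast
  ultimately show "\<exists>W. open W \<and> x \<in> W \<and> (\<forall>y\<in>W \<inter> X. q (f y) (g y) = q (f x) (g x))"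
    by (intro exI[of _ "W \<inter> W'"] conjI ballI arg_cong2[where f=q] open_Int IntI) blast+
qed

lemma continuous_on_open_preimage:
  assumes "continuous_on Y h" "h ` Y \<subseteq> X" "open W" "h y \<in> W" "y \<in> Y"
  obtains A where "open A" "y \<in> A" "\<forall>z. z \<in> A \<inter> Y \<longrightarrow> h z \<in> W \<inter> X"
proof -
  obtain A where A[rule_format]: "open A" "A \<inter> Y = h -` W \<inter> Y"
    using assms(1,3) by (metis continuous_on_open_invariant)
  have "h z \<in> W \<inter> X" if "z \<in> A \<inter> Y" for z using that A(2) assms(2) by auto
  moreover have "y \<in> A" using assms(4,5) A(2) by auto
  ultimately show thesis using that A(1) by simp
qed

lemma loc_const_compose:
  assumes "loc_const X f" "continuous_on Y h" "h ` Y \<subseteq> X"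
  shows "loc_const Y (\<lambda>y. f (h y))"
  unfolding loc_const_def
proof
  fix y assume y: "y \<in> Y"
  then have "h y \<in> X" using assms(3) by blast
  obtain W where W[rule_format]: "open W" "h y \<in> W" "\<forall>z. z \<in> W \<longrightarrow> z \<in> X \<longrightarrow> f z = f (h y)"
    by (rule loc_constD[OF assms(1) \<open>h y \<in> X\<close>])
  obtain A where A[rule_format]: "open A" "y \<in> A" "\<forall>z. z \<in> A \<inter> Y \<longrightarrow> h z \<in> W \<inter> X"
    by (rule continuous_on_open_preimage[OF assms(2,3) W(1,2) y])
  show "\<exists>W. open W \<and> y \<in> W \<and> (\<forall>z\<in>W \<inter> Y. f (h z) = f (h y))"
    using A(3) by (intro exI[of _ A] conjI A(1,2) ballI W(3)) blast+
qed

lemma cocycle_onD: "cocycle_on W t \<Longrightarrow> a \<in> W \<Longrightarrow> b \<in> W \<Longrightarrow> c \<in> W \<Longrightarrow> t a b + t b c = t a c"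
  unfolding cocycle_on_def by blast

lemma cocycle_on_refl: "cocycle_on W t \<Longrightarrow> a \<in> W \<Longrightarrow> t a a = 0"
  using cocycle_onD[of W t a a a] add_left_imp_eq[of "t a a" "t a a" 0] by simp

lemma cocycle_on_swap:
  assumes "cocycle_on W t" "a \<in> W" "b \<in> W" shows "t b a = - t a b"
proof -
  have "t a b + t b a = 0" using cocycle_onD[of W t a b a] cocycle_on_refl[of W t a] assms by simp
  then show ?thesis by (rule minus_unique[symmetric])
qed

lemma cocycle_on_subset: "cocycle_on W t \<Longrightarrow> V \<subseteq> W \<Longrightarrow> cocycle_on V t"
  unfolding cocycle_on_def by blast

lemma local_cocycleE:
  assumes "local_cocycle X t" "x \<in> X"
  obtains W where "open W" "x \<in> W" "cocycle_on (W \<inter> X) t"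
proof -
  have "\<exists>W. open W \<and> x \<in> W \<and> cocycle_on (W \<inter> X) t"
    using assms unfolding local_cocycle_def by (rule bspec)
  then show thesis by (elim exE conjE) (rule that)
qed

lemma local_cocycle_subset:
  assumes "local_cocycle X t" "Y \<subseteq> X" shows "local_cocycle Y t"
  unfolding local_cocycle_def
proof
  fix x assume "x \<in> Y"
  then have "x \<in> X" using assms(2) by blast
  obtain W where "open W" "x \<in> W" "cocycle_on (W \<inter> X) t"
    by (rule local_cocycleE[OF assms(1) \<open>x \<in> X\<close>])
  moreover have "W \<inter> Y \<subseteq> W \<inter> X" using assms by blast
  ultimately show "\<exists>W. open W \<and> x \<in> W \<and> cocycle_on (W \<inter> Y) t"
    using cocycle_on_subset by blast
qed

lemma local_cocycle_compose:
  assumes "local_cocycle X t" "continuous_on Y h" "h ` Y \<subseteq> X"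
  shows "local_cocycle Y (\<lambda>a b. t (h a) (h b))"
  unfolding local_cocycle_def
proof
  fix y assume y: "y \<in> Y"
  then have "h y \<in> X" using assms(3) by blast
  obtain W where W[rule_format]: "open W" "h y \<in> W" "cocycle_on (W \<inter> X) t"
    by (rule local_cocycleE[OF assms(1) \<open>h y \<in> X\<close>])
  obtain A where A[rule_format]: "open A" "y \<in> A" "\<forall>z. z \<in> A \<inter> Y \<longrightarrow> h z \<in> W \<inter> X"
    by (rule continuous_on_open_preimage[OF assms(2,3) W(1,2) y])
  have "cocycle_on (A \<inter> Y) (\<lambda>a b. t (h a) (h b))"
    using cocycle_onD[OF W(3)] A(3) unfolding cocycle_on_def by simp
  then show "\<exists>W. open W \<and> y \<in> W \<and> cocycle_on (W \<inter> Y) (\<lambda>a b. t (h a) (h b))"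
    using A(1,2) by blast
qed

lemma gauge_equiv_compose:
  assumes "gauge_equiv X t t'" "continuous_on Y h" "h ` Y \<subseteq> X"
  shows "gauge_equiv Y (\<lambda>a b. t (h a) (h b)) (\<lambda>a b. t' (h a) (h b))"
proof -
  obtain F where F[rule_format]: "\<And>x. x \<in> X \<Longrightarrow> \<exists>W. open W \<and> x \<in> W \<and>
     (\<forall>a\<in>W \<inter> X. \<forall>b\<in>W \<inter> X. F a + t a b = t' a b + F b)"
    using assms(1) unfolding gauge_equiv_def by blast
  show ?thesis
    unfolding gauge_equiv_def
  proof (intro exI[of _ "\<lambda>a. F (h a)"] ballI)
    fix y assume y: "y \<in> Y"
    then have "h y \<in> X" using assms(3) by blast
    then obtain W where W[rule_format]: "open W" "h y \<in> W" "\<forall>a\<in>W \<inter> X. \<forall>b\<in>W \<inter> X. F a + t a b = t' a b + F b"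
      using F[of "h y"] by blast
    obtain A where A[rule_format]: "open A" "y \<in> A" "\<forall>z. z \<in> A \<inter> Y \<longrightarrow> h z \<in> W \<inter> X"
      by (rule continuous_on_open_preimage[OF assms(2,3) W(1,2) y])
    show "\<exists>W. open W \<and> y \<in> W \<and> (\<forall>a\<in>W \<inter> Y. \<forall>b\<in>W \<inter> Y. F (h a) + t (h a) (h b) = t' (h a) (h b) + F (h b))"
      by (intro exI[of _ A] conjI A(1,2) ballI W(3) A(3))
  qed
qed

lemma primitiveE:
  assumes "primitive X t f" "x \<in> X"
  obtains W where "open W" "x \<in> W" "\<forall>a b. a \<in> W \<longrightarrow> a \<in> X \<longrightarrow> b \<in> W \<longrightarrow> b \<in> X \<longrightarrow> t a b = - f a + f b"
proof -
  have "\<exists>W. open W \<and> x \<in> W \<and> (\<forall>a\<in>W \<inter> X. \<forall>b\<in>W \<inter> X. t a b = - f a + f b)"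
    using assms unfolding primitive_def by (rule bspec)
  then obtain W where W[rule_format]: "open W" "x \<in> W" "\<forall>a\<in>W \<inter> X. \<forall>b\<in>W \<inter> X. t a b = - f a + f b"
    by (elim exE conjE)
  show thesis by (rule that[OF W(1,2)]) (simp add: W(3))
qed

lemma primitiveI:
  assumes "\<And>x. x \<in> X \<Longrightarrow> \<exists>W. open W \<and> x \<in> W \<and> (\<forall>a b. a \<in> W \<longrightarrow> a \<in> X \<longrightarrow> b \<in> W \<longrightarrow> b \<in> X \<longrightarrow> t a b = - f a + f b)"
  shows "primitive X t f"
  unfolding primitive_def
proof
  fix x assume "x \<in> X"
  from assms[OF this] obtain W where W[rule_format]: "open W" "x \<in> W"
    "\<forall>a b. a \<in> W \<longrightarrow> a \<in> X \<longrightarrow> b \<in> W \<longrightarrow> b \<in> X \<longrightarrow> t a b = - f a + f b" by (elim exE conjE)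
  show "\<exists>W. open W \<and> x \<in> W \<and> (\<forall>a\<in>W \<inter> X. \<forall>b\<in>W \<inter> X. t a b = - f a + f b)"
    by (intro exI[of _ W] conjI W(1,2) ballI) (simp add: W(3))
qed

lemma primitive_subset:
  assumes "primitive X t f" "Y \<subseteq> X" shows "primitive Y t f"
proof (rule primitiveI)
  fix x assume "x \<in> Y"
  then have "x \<in> X" using assms(2) by blast
  obtain W where W[rule_format]: "open W" "x \<in> W" "\<forall>a b. a \<in> W \<longrightarrow> a \<in> X \<longrightarrow> b \<in> W \<longrightarrow> b \<in> X \<longrightarrow> t a b = - f a + f b"
    by (rule primitiveE[OF assms(1) \<open>x \<in> X\<close>])
  show "\<exists>W. open W \<and> x \<in> W \<and> (\<forall>a b. a \<in> W \<longrightarrow> a \<in> Y \<longrightarrow> b \<in> W \<longrightarrow> b \<in> Y \<longrightarrow> t a b = - f a + f b)"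
    using assms(2) by (intro exI[of _ W] conjI W(1,2) allI impI W(3)) blast+
qed

lemma minus_add_left_cancel: "- (k + p) + (k + q) = - p + (q :: 'g::group_add)"
  by (simp only: minus_add add.assoc minus_add_cancel)

lemma primitive_add_const: "primitive X t f \<Longrightarrow> primitive X t (\<lambda>x. g + f x)"
  unfolding primitive_def by (simp only: minus_add_left_cancel)

lemma primitive_hom:
  assumes "primitive X t f" and hom: "\<And>a b. \<phi> (a + b) = \<phi> a + \<phi> (b::'g::group_add)"
  shows "primitive X (\<lambda>a b. \<phi> (t a b)) (\<lambda>a. \<phi> (f a) :: 'h::group_add)"
proof -
  have "\<phi> 0 + \<phi> 0 = \<phi> 0 + 0" using hom[of 0 0] by simp
  then have "\<phi> 0 = 0" by (rule add_left_imp_eq)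
  then have "\<phi> (- a) = - \<phi> a" for a
    using hom[of a "- a"] by (metis add.right_inverse minus_unique)
  then have "\<phi> (- a + b) = - \<phi> a + \<phi> b" for a b using hom by simp
  note hom2 = this
  show ?thesis
  proof (rule primitiveI)
    fix x assume "x \<in> X"
    obtain W where W[rule_format]: "open W" "x \<in> W" "\<forall>a b. a \<in> W \<longrightarrow> a \<in> X \<longrightarrow> b \<in> W \<longrightarrow> b \<in> X \<longrightarrow> t a b = - f a + f b"
      by (rule primitiveE[OF assms(1) \<open>x \<in> X\<close>])
    show "\<exists>W. open W \<and> x \<in> W \<and> (\<forall>a b. a \<in> W \<longrightarrow> a \<in> X \<longrightarrow> b \<in> W \<longrightarrow> b \<in> X \<longrightarrow> \<phi> (t a b) = - \<phi> (f a) + \<phi> (f b))"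
      by (intro exI[of _ W] conjI W(1,2) allI impI) (simp only: W(3) hom2)
  qed
qed

lemma local_cocycle_hom:
  assumes "local_cocycle X t" and hom: "\<And>a b. \<phi> (a + b) = \<phi> a + \<phi> (b::'g::group_add)"
  shows "local_cocycle X (\<lambda>a b. \<phi> (t a b) :: 'h::group_add)"
proof -
  have "cocycle_on W (\<lambda>a b. \<phi> (t a b))" if "cocycle_on W t" for W
    unfolding cocycle_on_def using cocycle_onD[OF that] by (simp flip: hom)
  then show ?thesis using assms(1) unfolding local_cocycle_def by meson
qed

section \<open>Uniqueness and existence of primitives\<close>

lemma primitive_diff_loc_const:
  assumes "primitive X t f" "primitive X t f'"
  shows "loc_const X (\<lambda>x. f x - f' x)"
  unfolding loc_const_def
proof
  fix x assume x: "x \<in> X"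
  obtain W where W[rule_format]: "open W" "x \<in> W" "\<forall>a b. a \<in> W \<longrightarrow> a \<in> X \<longrightarrow> b \<in> W \<longrightarrow> b \<in> X \<longrightarrow> t a b = - f a + f b"
    by (rule primitiveE[OF assms(1) x])
  obtain W' where W'[rule_format]: "open W'" "x \<in> W'" "\<forall>a b. a \<in> W' \<longrightarrow> a \<in> X \<longrightarrow> b \<in> W' \<longrightarrow> b \<in> X \<longrightarrow> t a b = - f' a + f' b"
    by (rule primitiveE[OF assms(2) x])
  have "f y - f' y = f x - f' x" if "y \<in> (W \<inter> W') \<inter> X" for y
  proof -
    have "- f y + f x = - f' y + f' x" using W(3)[of y x] W'(3)[of y x] W(2) W'(2) x that by auto
    then have "f y + (- f y + f x) = f y + (- f' y + f' x)" by simp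
    then have "f x = (f y + - f' y) + f' x" by (simp only: add.assoc add_minus_cancel)
    then show ?thesis by (simp add: eq_diff_eq)
  qed
  then show "\<exists>W. open W \<and> x \<in> W \<and> (\<forall>y\<in>W \<inter> X. f y - f' y = f x - f' x)"
    using W(1,2) W'(1,2) by (intro exI[of _ "W \<inter> W'"] conjI open_Int IntI ballI) blast+
qed

lemma primitive_unique:
  assumes "connected X" "primitive X t f" "primitive X t f'"
  shows "\<exists>g. \<forall>x\<in>X. f x = g + f' x"
proof (cases "X = {}")
  case False
  then obtain z where z[rule_format]: "z \<in> X" by blast
  have "f x = (f z - f' z) + f' x" if "x \<in> X" for x
    using loc_const_connected[OF assms(1) primitive_diff_loc_const[OF assms(2,3)] z that]
    by (metis diff_add_cancel)
  then show ?thesis by blast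
qed auto

text \<open>The second primitive is translated on the left until both agree at \<open>b\<close>. The
  only new pairs are those on opposite sides of \<open>b\<close>; near \<open>b\<close> the cocycle
  identity splits them at \<open>b\<close> itself.\<close>

lemma primitive_join:
  fixes t :: "real \<Rightarrow> real \<Rightarrow> 'g::group_add"
  assumes "a \<le> b" "b \<le> c" "local_cocycle {a..c} t" "primitive {a..b} t f" "primitive {b..c} t g"
  shows "\<exists>h. primitive {a..c} t h"
proof -
  define h where "h x = (if x \<le> b then f x else (f b - g b) + g x)" for x
  have "primitive {a..c} t h"
  proof (rule primitiveI)
    fix x assume x: "x \<in> {a..c}"
    have hg: "h u = (f b - g b) + g u" if "b \<le> u" for u
      using that by (cases "u = b") (simp_all add: h_def)
    have gh: "- g u + g v = - h u + h v" if "b \<le> u" "b \<le> v" for u v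
      using that by (simp only: hg minus_add_left_cancel)
    consider "x < b" | "x = b" | "x > b" by linarith
    then show "\<exists>W. open W \<and> x \<in> W \<and> (\<forall>u v. u \<in> W \<longrightarrow> u \<in> {a..c} \<longrightarrow> v \<in> W \<longrightarrow> v \<in> {a..c} \<longrightarrow> t u v = - h u + h v)"
    proof cases
      case 1
      with x have x': "x \<in> {a..b}" by auto
      obtain W where W[rule_format]: "open W" "x \<in> W" "\<forall>u v. u \<in> W \<longrightarrow> u \<in> {a..b} \<longrightarrow> v \<in> W \<longrightarrow> v \<in> {a..b} \<longrightarrow> t u v = - f u + f v"
        by (rule primitiveE[OF assms(4) x'])
      show ?thesis
        by (rule exI[of _ "W \<inter> {..<b}"]) (use W(1,2) 1 in \<open>auto simp: h_def intro!: W(3)\<close>)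
    next
      case 3
      with x have x': "x \<in> {b..c}" by auto
      obtain W where W[rule_format]: "open W" "x \<in> W" "\<forall>u v. u \<in> W \<longrightarrow> u \<in> {b..c} \<longrightarrow> v \<in> W \<longrightarrow> v \<in> {b..c} \<longrightarrow> t u v = - g u + g v"
        by (rule primitiveE[OF assms(5) x'])
      show ?thesis
        by (rule exI[of _ "W \<inter> {b<..}"]) (use W(1,2) 3 in \<open>auto simp flip: gh intro!: W(3)\<close>)
    next
      case 2
      with assms(1,2) have x': "x \<in> {a..b}" "x \<in> {b..c}" by auto
      obtain W where W[rule_format]: "open W" "x \<in> W" "\<forall>u v. u \<in> W \<longrightarrow> u \<in> {a..b} \<longrightarrow> v \<in> W \<longrightarrow> v \<in> {a..b} \<longrightarrow> t u v = - f u + f v"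
        by (rule primitiveE[OF assms(4) x'(1)])
      obtain W' where W'[rule_format]: "open W'" "x \<in> W'" "\<forall>u v. u \<in> W' \<longrightarrow> u \<in> {b..c} \<longrightarrow> v \<in> W' \<longrightarrow> v \<in> {b..c} \<longrightarrow> t u v = - g u + g v"
        by (rule primitiveE[OF assms(5) x'(2)])
      obtain W'' where W''[rule_format]: "open W''" "x \<in> W''" "cocycle_on (W'' \<inter> {a..c}) t"
        by (rule local_cocycleE[OF assms(3) x])
      have tx: "t u x = - h u + h x \<and> t x u = - h x + h u" if "u \<in> W \<inter> W' \<inter> W''" "u \<in> {a..c}" for u
      proof (cases "u \<le> b")
        case True
        then show ?thesis using W(2) W(3)[of u x] W(3)[of x u] 2 that x' by (simp add: h_def)
      next
        case False
        then show ?thesis using W'(2) W'(3)[of u x] W'(3)[of x u] gh[of u x] gh[of x u] 2 that x' by simp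
      qed
      have "t u v = - h u + h v" if "u \<in> W \<inter> W' \<inter> W''" "u \<in> {a..c}" "v \<in> W \<inter> W' \<inter> W''" "v \<in> {a..c}" for u v
      proof -
        have "t u v = t u x + t x v" using cocycle_onD[OF W''(3), of u x v] that x W''(2) by simp
        then show ?thesis using tx[OF that(1,2)] tx[OF that(3,4)] by (simp add: add.assoc)
      qed
      then show ?thesis
        by (intro exI[of _ "W \<inter> W' \<inter> W''"]) (use W(1,2) W'(1,2) W''(1,2) in auto)
    qed
  qed
  then show ?thesis by blast
qed

lemma primitive_if_cocycle_on:
  assumes "cocycle_on X t"
  shows "\<exists>f. primitive X t f"
proof (cases "X = {}")
  case False
  then obtain z where z[rule_format]: "z \<in> X" by blast
  have "t a b = - t z a + t z b" if "a \<in> X" "b \<in> X" for a b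
    using cocycle_onD[OF assms that(1) z that(2)] cocycle_on_swap[OF assms z that(1)] by simp
  then have "primitive X t (t z)" by (intro primitiveI exI[of _ UNIV]) auto
  then show ?thesis by blast
qed (auto simp: primitive_def)

text \<open>Short intervals lie in a set where the cocycle identity holds, and there
  \<open>t z\<close> is a primitive for any base point \<open>z\<close>. Bisection glues the
  pieces.\<close>

lemma interval_primitive:
  fixes t :: "real \<Rightarrow> real \<Rightarrow> 'g::group_add"
  assumes "a \<le> b" and t: "local_cocycle {a..b} t"
  shows "\<exists>f. primitive {a..b} t f"
proof -
  have "{a..b} \<subseteq> {a..b} \<longrightarrow> (\<exists>f. primitive {a..b} t f)"
    using assms(1)
  proof (induction rule: Bolzano[where P = "\<lambda>u v. {u..v} \<subseteq> {a..b} \<longrightarrow> (\<exists>f. primitive {u..v} t f)"])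
    case (trans u v w)
    show ?case
    proof
      assume sub: "{u..w} \<subseteq> {a..b}"
      then have "{u..v} \<subseteq> {a..b}" "{v..w} \<subseteq> {a..b}" using trans by auto
      then show "\<exists>f. primitive {u..w} t f"
        using trans primitive_join local_cocycle_subset[OF t sub] by blast
    qed
  next
    case (local x)
    then have x: "x \<in> {a..b}" by auto
    obtain W where W[rule_format]: "open W" "x \<in> W" "cocycle_on (W \<inter> {a..b}) t"
      by (rule local_cocycleE[OF t x])
    then obtain d where d[rule_format]: "d > 0" "ball x d \<subseteq> W" by (metis open_contains_ball)
    have "\<exists>f. primitive {u..v} t f" if "u \<le> x" "x \<le> v" "v - u < d" "{u..v} \<subseteq> {a..b}" for u v
    proof (rule primitive_if_cocycle_on, rule cocycle_on_subset[OF W(3)])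
      have "{u..v} \<subseteq> ball x d" using that by (auto simp: dist_real_def)
      then show "{u..v} \<subseteq> W \<inter> {a..b}" using that(4) d by blast
    qed
    then show ?case using d(1) by blast
  qed
  then show ?thesis by blast
qed

text \<open>The value at \<open>x\<close> is the total increment of \<open>t\<close> along the
  contraction path from \<open>z\<close> to \<open>x\<close>. Neighbouring paths are compared
  through a thin strip between them in which \<open>t\<close> satisfies the cocycle identity locally
  in time.\<close>

lemma contractible_primitive:
  fixes t :: "'a::metric_space \<Rightarrow> 'a \<Rightarrow> 'g::group_add"
  assumes t: "local_cocycle X t"
    and cont: "continuous_on (X \<times> {0..1}) (\<lambda>(x, s). \<Phi> x s)"
    and im: "\<And>x s. x \<in> X \<Longrightarrow> s \<in> {0..1::real} \<Longrightarrow> \<Phi> x s \<in> X"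
    and ends: "\<And>x. x \<in> X \<Longrightarrow> \<Phi> x 0 = z" "\<And>x. x \<in> X \<Longrightarrow> \<Phi> x 1 = x"
  shows "\<exists>f. primitive X t f"
proof -
  define T where "T x = (\<lambda>s s'. t (\<Phi> x s) (\<Phi> x s'))" for x
  have contp: "continuous_on {0..1} (\<Phi> x)" if "x \<in> X" for x
  proof -
    have "continuous_on {0..1} (\<lambda>s. (x, s))" by (intro continuous_intros)
    then have "continuous_on {0..1} ((\<lambda>(x, s). \<Phi> x s) \<circ> (\<lambda>s. (x, s)))"
      using that by (intro continuous_on_compose continuous_on_subset[OF cont]) auto
    then show ?thesis by (simp add: o_def)
  qed
  have coT: "local_cocycle {0..1} (T x)" if "x \<in> X" for x
    unfolding T_def using im that by (intro local_cocycle_compose[OF t contp[OF that]]) auto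
  have "\<exists>g. primitive {0..1} (T x) g \<and> g 0 = 0" if x: "x \<in> X" for x
  proof -
    obtain g where "primitive {0..1} (T x) g" using interval_primitive[OF _ coT[OF x]] by auto
    then have "primitive {0..1} (T x) (\<lambda>s. - g 0 + g s)" by (rule primitive_add_const)
    then show ?thesis by (intro exI[of _ "\<lambda>s. - g 0 + g s"]) auto
  qed
  then obtain g where g[rule_format]: "\<And>x. x \<in> X \<Longrightarrow> primitive {0..1} (T x) (g x)" "\<And>x. x \<in> X \<Longrightarrow> g x 0 = 0"
    by metis
  have "primitive X t (\<lambda>x. g x 1)"
  proof (rule primitiveI)
    fix a assume a: "a \<in> X"
    define strip where "strip A I = (\<lambda>(x, s). \<Phi> x s) ` ((A \<inter> X) \<times> (I \<inter> {0..1}))" for A I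
    have strip_mono: "strip A' I \<subseteq> strip A I" if "A' \<subseteq> A" for A A' I
      unfolding strip_def using that by (intro image_mono) blast
    have stripI: "\<Phi> x s \<in> strip A I" if "x \<in> A" "x \<in> X" "s \<in> I" "s \<in> {0..1}" for x s A I
      unfolding strip_def using that by (intro image_eqI[of _ _ "(x, s)"]) auto
    \<comment> \<open>A neighbourhood \<open>A\<close> of \<open>a\<close> is good at time
      \<open>s\<close> if the pieces near that time of all paths from \<open>A\<close> fit into one
      cocycle set. Compactness of the time interval, in the form of Bolzano's principle, gives one
      \<open>A\<close> for all times.\<close>
    define good where "good A s \<longleftrightarrow> (\<exists>I. open I \<and> s \<in> I \<and> cocycle_on (strip A I) t)" for A s
    have "(0::real) \<le> 0 \<and> (1::real) \<le> 1 \<longrightarrow> (\<exists>A. open A \<and> a \<in> A \<and> (\<forall>s\<in>{0..1}. good A s))"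
    proof (rule Bolzano[where P = "\<lambda>u v. 0 \<le> u \<and> v \<le> 1 \<longrightarrow> (\<exists>A. open A \<and> a \<in> A \<and> (\<forall>s\<in>{u..v}. good A s))"], simp)
      have mono: "good A' s" if gs: "good A s" and sub: "A' \<subseteq> A" for A A' s
      proof -
        obtain I where I: "open I" "s \<in> I" "cocycle_on (strip A I) t"
          using gs unfolding good_def by (elim exE conjE)
        have "cocycle_on (strip A' I) t" by (rule cocycle_on_subset[OF I(3) strip_mono[OF sub]])
        then show ?thesis using I(1,2) unfolding good_def by (intro exI[of _ I] conjI)
      qed
      fix u v w :: real
      assume 1: "0 \<le> u \<and> v \<le> 1 \<longrightarrow> (\<exists>A. open A \<and> a \<in> A \<and> (\<forall>s\<in>{u..v}. good A s))"
        "0 \<le> v \<and> w \<le> 1 \<longrightarrow> (\<exists>A. open A \<and> a \<in> A \<and> (\<forall>s\<in>{v..w}. good A s))"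
        and le: "u \<le> v" "v \<le> w"
      show "0 \<le> u \<and> w \<le> 1 \<longrightarrow> (\<exists>A. open A \<and> a \<in> A \<and> (\<forall>s\<in>{u..w}. good A s))"
      proof
        assume "0 \<le> u \<and> w \<le> 1"
        then obtain A A' where A[rule_format]: "open A" "a \<in> A" "\<forall>s\<in>{u..v}. good A s" "open A'" "a \<in> A'" "\<forall>s\<in>{v..w}. good A' s"
          using 1 le by force
        have "good (A \<inter> A') s" if "s \<in> {u..w}" for s
          using A mono[of A s "A \<inter> A'"] mono[of A' s "A \<inter> A'"] that by (cases "s \<le> v") auto
        then show "\<exists>A. open A \<and> a \<in> A \<and> (\<forall>s\<in>{u..w}. good A s)"
          using A by (intro exI[of _ "A \<inter> A'"]) auto
      qed
    next
      fix x :: real assume x: "0 \<le> x" "x \<le> 1"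
      then have ax: "\<Phi> a x \<in> X" using im[OF a] by simp
      obtain W where W[rule_format]: "open W" "\<Phi> a x \<in> W" "cocycle_on (W \<inter> X) t"
        by (rule local_cocycleE[OF t ax])
      obtain Q where Q[rule_format]: "open Q" "Q \<inter> (X \<times> {0..1}) = (\<lambda>(x, s). \<Phi> x s) -` W \<inter> (X \<times> {0..1})"
        using cont W(1) by (metis continuous_on_open_invariant)
      have "(a, x) \<in> Q" using Q W a x by auto
      then obtain A I where AI[rule_format]: "open A" "open I" "a \<in> A" "x \<in> I" "A \<times> I \<subseteq> Q"
        using Q(1) by (metis mem_Sigma_iff open_prod_elim)
      have sub: "strip A I \<subseteq> W \<inter> X"
        unfolding strip_def
      proof clarify
        fix y s assume "y \<in> A" "y \<in> X" "s \<in> I" "s \<in> {0..1}"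
        then have "(y, s) \<in> Q \<inter> (X \<times> {0..1})" using AI(5) by blast
        then show "\<Phi> y s \<in> W \<inter> X" using Q(2) im \<open>y \<in> X\<close> \<open>s \<in> {0..1}\<close> by auto
      qed
      have good: "good A s" if "s \<in> I" for s
        unfolding good_def using AI that cocycle_on_subset[OF W(3) sub] by blast
      obtain d where d[rule_format]: "d > 0" "ball x d \<subseteq> I" using AI by (metis open_contains_ball)
      have "{u..v} \<subseteq> I" if "u \<le> x \<and> x \<le> v \<and> v - u < d" for u v
        using that d(2) by (auto simp: dist_real_def intro!: subsetD[OF d(2)])
      then show "\<exists>d>0. \<forall>u v. u \<le> x \<and> x \<le> v \<and> v - u < d \<longrightarrow> 0 \<le> u \<and> v \<le> 1 \<longrightarrow>
          (\<exists>A. open A \<and> a \<in> A \<and> (\<forall>s\<in>{u..v}. good A s))"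
        using d(1) AI good by (intro exI[of _ d]) blast
    qed
    then obtain A where A[rule_format]: "open A" "a \<in> A" "\<And>s. s \<in> {0..1} \<Longrightarrow> good A s" by auto
    have key: "t a b = - g a 1 + g b 1" if b: "b \<in> A \<inter> X" for b
    proof -
      \<comment> \<open>The primitive along the path of \<open>a\<close>, moved over to the path of
        \<open>b\<close> by the short step between them, is a primitive along the path of
        \<open>b\<close>. Both start at 0, so it agrees with \<open>g b\<close>.\<close>
      define G where "G s = g a s + t (\<Phi> a s) (\<Phi> b s)" for s
      have "primitive {0..1} (T b) G"
      proof (rule primitiveI)
        fix s :: real assume s: "s \<in> {0..1}"
        obtain I where I[rule_format]: "open I" "s \<in> I"
          "cocycle_on (strip A I) t"
          using A(3)[OF s] unfolding good_def by (elim exE conjE)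
        obtain J where J[rule_format]: "open J" "s \<in> J"
          "\<forall>u v. u \<in> J \<longrightarrow> u \<in> {0..1} \<longrightarrow> v \<in> J \<longrightarrow> v \<in> {0..1} \<longrightarrow> T a u v = - g a u + g a v"
          by (rule primitiveE[OF g(1)[OF a] s])
        have "T b u v = - G u + G v" if "u \<in> (I \<inter> J) \<inter> {0..1}" "v \<in> (I \<inter> J) \<inter> {0..1}" for u v
        proof -
          have mem: "\<Phi> a u \<in> strip A I" "\<Phi> a v \<in> strip A I" "\<Phi> b u \<in> strip A I" "\<Phi> b v \<in> strip A I"
            using that a b A(2) by (auto intro!: stripI)
          have "t (\<Phi> a u) (\<Phi> b u) + t (\<Phi> b u) (\<Phi> b v) = t (\<Phi> a u) (\<Phi> b v)"
            "t (\<Phi> a u) (\<Phi> a v) + t (\<Phi> a v) (\<Phi> b v) = t (\<Phi> a u) (\<Phi> b v)"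
            by (simp_all only: cocycle_onD[OF I(3)] mem)
          moreover have "t (\<Phi> a u) (\<Phi> a v) = - g a u + g a v" using J(3)[of u v] that unfolding T_def by simp
          ultimately have "t (\<Phi> a u) (\<Phi> b u) + t (\<Phi> b u) (\<Phi> b v) = - g a u + G v"
            unfolding G_def by (metis add.assoc)
          then have "t (\<Phi> b u) (\<Phi> b v) = - t (\<Phi> a u) (\<Phi> b u) + (- g a u + G v)"
            by (metis minus_add_cancel)
          then show ?thesis unfolding T_def G_def by (simp only: minus_add add.assoc)
        qed
        then show "\<exists>W. open W \<and> s \<in> W \<and> (\<forall>u v. u \<in> W \<longrightarrow> u \<in> {0..1} \<longrightarrow> v \<in> W \<longrightarrow> v \<in> {0..1} \<longrightarrow> T b u v = - G u + G v)"
          by (intro exI[of _ "I \<inter> J"]) (use I(1,2) J(1,2) in auto)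
      qed
      then obtain k where k[rule_format]: "\<forall>s\<in>{0..1}. g b s = k + G s"
        using primitive_unique[OF _ g(1)] b by (metis IntD2 connected_Icc)
      have z: "z \<in> X" using im[OF a, of 0] ends(1)[OF a] by simp
      obtain V where V[rule_format]: "open V" "z \<in> V" "cocycle_on (V \<inter> X) t"
        by (rule local_cocycleE[OF t z])
      have "t z z = 0" using cocycle_on_refl[OF V(3)] V(2) z by simp
      then have "G 0 = 0" using g(2)[OF a] ends(1) a b by (simp add: G_def)
      then have "k = 0" using k g(2) b by force
      then have "g b 1 = g a 1 + t a b" using k ends(2) a b by (simp add: G_def)
      then show ?thesis by (metis minus_add_cancel)
    qed
    obtain W where W[rule_format]: "open W" "a \<in> W" "cocycle_on (W \<inter> X) t"
      by (rule local_cocycleE[OF t a])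
    have "t b c = - g b 1 + g c 1" if "b \<in> (A \<inter> W) \<inter> X" "c \<in> (A \<inter> W) \<inter> X" for b c
    proof -
      have "t b c = - t a b + t a c"
        using cocycle_onD[OF W(3), of a b c] that a W(2) by (simp flip: cocycle_onD[OF W(3), of a b c])
      then show ?thesis using key[of b] key[of c] that by (simp add: minus_add_left_cancel)
    qed
    then show "\<exists>W. open W \<and> a \<in> W \<and> (\<forall>b c. b \<in> W \<longrightarrow> b \<in> X \<longrightarrow> c \<in> W \<longrightarrow> c \<in> X \<longrightarrow> t b c = - g b 1 + g c 1)"
      by (intro exI[of _ "A \<inter> W"]) (use A(1,2) W(1,2) in auto)
  qed
  then show ?thesis by blast
qed

section \<open>The regions above and below a family of curves with heights\<close>

lemma primitive_compose:
  assumes "primitive X t f" "continuous_on Y h" "h ` Y \<subseteq> X"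
  shows "primitive Y (\<lambda>a b. t (h a) (h b)) (\<lambda>a. f (h a))"
proof (rule primitiveI)
  fix y assume y: "y \<in> Y"
  then have "h y \<in> X" using assms(3) by blast
  obtain W where W[rule_format]: "open W" "h y \<in> W" "\<forall>a b. a \<in> W \<longrightarrow> a \<in> X \<longrightarrow> b \<in> W \<longrightarrow> b \<in> X \<longrightarrow> t a b = - f a + f b"
    by (rule primitiveE[OF assms(1) \<open>h y \<in> X\<close>])
  obtain A where A[rule_format]: "open A" "y \<in> A" "\<forall>z. z \<in> A \<inter> Y \<longrightarrow> h z \<in> W \<inter> X"
    by (rule continuous_on_open_preimage[OF assms(2,3) W(1,2) y])
  show "\<exists>W. open W \<and> y \<in> W \<and> (\<forall>a b. a \<in> W \<longrightarrow> a \<in> Y \<longrightarrow> b \<in> W \<longrightarrow> b \<in> Y \<longrightarrow> t (h a) (h b) = - f (h a) + f (h b))"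
    using A(3) by (intro exI[of _ A] conjI A(1,2) allI impI W(3)) blast+
qed

lemma periodic_shift_int:
  fixes f :: "real \<Rightarrow> 'a"
  assumes "\<And>s. f (s + 1) = f s"
  shows "f (s + of_int k) = f s"
proof (induction k rule: int_induct[where k=0])
  case (step1 i)
  then show ?case using assms[of "s + of_int i"] by (simp add: add.assoc)
next
  case (step2 i)
  then show ?case using assms[of "s + of_int (i - 1)"] by (simp add: algebra_simps)
qed simp

lemma periodic_frac:
  fixes f :: "real \<Rightarrow> 'a"
  assumes "\<And>s. f (s + 1) = f s"
  shows "f (frac s) = f s"
  using periodic_shift_int[of f "frac s" "\<lfloor>s\<rfloor>"] assms by (simp add: frac_def)

section \<open>Height coordinates and meridians of the 3-sphere\<close>

lemma at_height_in_S3: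
  assumes "norm x = 1" "-1 \<le> h" "h \<le> 1"
  shows "at_height x h \<in> S3"
proof -
  have "h\<^sup>2 \<le> 1" using assms by (simp add: abs_square_le_1 abs_le_iff)
  then show ?thesis using assms by (simp add: at_height_def norm_Pair)
qed

lemma at_height_eq_iff:
  assumes "norm x = 1" "norm y = 1" "-1 < h" "h < 1"
  shows "at_height x h = at_height y k \<longleftrightarrow> x = y \<and> h = k"
proof -
  have "h\<^sup>2 < 1" using assms by (simp add: abs_square_less_1 abs_less_iff)
  then show ?thesis by (auto simp: at_height_def)
qed

lemma at_height_poles: "at_height x 1 = (0, 1)" "at_height x (-1) = (0, -1)"
  by (simp_all add: at_height_def)

lemma snd_at_height [simp]: "snd (at_height x h) = h"
  by (simp add: at_height_def)

lemma continuous_at_height: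
  "continuous_on S f \<Longrightarrow> continuous_on S g \<Longrightarrow> continuous_on S (\<lambda>x. at_height (f x) (g x))"
  unfolding at_height_def by (intro continuous_intros)

lemma S3_pole: "z \<in> S3 \<Longrightarrow> fst z = 0 \<Longrightarrow> z = (0, 1) \<or> z = (0, -1)"
  by (cases z) (auto simp: norm_Pair abs_square_eq_1 abs_eq_iff')

lemma at_height_sgn:
  assumes "z \<in> S3" "fst z \<noteq> 0"
  shows "at_height (sgn (fst z)) (snd z) = z" "-1 < snd z" "snd z < 1" "norm (sgn (fst z)) = 1"
proof -
  have eq: "(norm (fst z))\<^sup>2 + (snd z)\<^sup>2 = 1"
    using assms(1) by (cases z) (simp add: norm_Pair)
  then have "sqrt (1 - (snd z)\<^sup>2) = norm (fst z)"
    by (metis add_diff_cancel_right' norm_ge_zero real_sqrt_unique)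
  then show "at_height (sgn (fst z)) (snd z) = z"
    using assms(2) by (cases z) (simp add: at_height_def sgn_div_norm)
  have "(snd z)\<^sup>2 < 1" using eq assms(2) by (smt (verit) zero_less_power zero_less_norm_iff)
  then show "-1 < snd z" "snd z < 1" by (simp_all add: abs_square_less_1 abs_less_iff)
  show "norm (sgn (fst z)) = 1" using assms(2) by (simp add: norm_sgn)
qed

lemma S3_cases:
  assumes "z \<in> S3"
  obtains "z = (0, 1)" | "z = (0, -1)"
    | x k where "norm x = 1" "-1 < k" "k < 1" "z = at_height x k"
  using S3_pole[OF assms] at_height_sgn[OF assms] by metis

text \<open>The height moves linearly from 1 at \<open>s = 0\<close> to that of \<open>z\<close> at
  \<open>s = 1\<close> in a fixed direction. Writing the point as a multiple of \<open>fst z\<close>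
  instead of its normalisation keeps the formula continuous at the north pole; only the south pole
  is singular.\<close>

definition meridian :: "(real^3) \<times> real \<Rightarrow> real \<Rightarrow> (real^3) \<times> real" where
  "meridian z s = (sqrt (s * (2 - s * (1 - snd z)) / (1 + snd z)) *\<^sub>R fst z, 1 - s * (1 - snd z))"

lemma meridian_at_height:
  assumes "-1 < k" "k < 1" "0 \<le> s" "s \<le> 1"
  shows "meridian (at_height x k) s = at_height x (1 - s * (1 - k))"
proof -
  have "s * (2 - s * (1 - k)) / (1 + k) * (1 - k\<^sup>2) = 1 - (1 - s * (1 - k))\<^sup>2"
  proof -
    have "1 - k\<^sup>2 = (1 + k) * (1 - k)" by (simp add: algebra_simps power2_eq_square)
    then show ?thesis using assms by (simp add: field_simps power2_eq_square)
  qed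
  then have "sqrt (s * (2 - s * (1 - k)) / (1 + k)) * sqrt (1 - k\<^sup>2) = sqrt (1 - (1 - s * (1 - k))\<^sup>2)"
    by (metis real_sqrt_mult)
  then show ?thesis by (simp add: meridian_def at_height_def)
qed

lemma meridian_pole: "meridian (0, 1) s = (0, 1)"
  by (simp add: meridian_def)

lemma continuous_meridian:
  assumes "\<And>z. z \<in> X \<Longrightarrow> snd z \<noteq> -1"
  shows "continuous_on (X \<times> {0..1}) (\<lambda>(z, s). meridian z s)"
proof -
  have "1 + snd (fst p) \<noteq> 0" if "p \<in> X \<times> {0..1}" for p
    using assms[of "fst p"] that by (auto simp: add_eq_0_iff)
  then show ?thesis
    unfolding meridian_def case_prod_unfold
    by (intro continuous_on_Pair continuous_on_scaleR continuous_on_real_sqrt continuous_on_divide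
        continuous_on_mult continuous_on_diff continuous_on_add continuous_on_const
        continuous_on_fst continuous_on_snd continuous_on_id ballI) auto
qed

text \<open>Each of the two regions contracts along meridians to a pole, so a cocycle has a primitive there.\<close>

definition above :: "nat \<Rightarrow> (nat \<Rightarrow> real \<Rightarrow> real^3) \<Rightarrow> (nat \<Rightarrow> real \<Rightarrow> real) \<Rightarrow> ((real^3) \<times> real) set" where
  "above n \<gamma> h = S3 - {at_height (\<gamma> i s) t | i s t. i < n \<and> -1 \<le> t \<and> t \<le> h i s}"

definition flip_height :: "(real^3) \<times> real \<Rightarrow> (real^3) \<times> real" where
  "flip_height z = (fst z, - snd z)"

text \<open>Reflecting the height turns this region into one above negated heights, so its
  properties are inherited from \<open>above\<close>.\<close>

definition below :: "nat \<Rightarrow> (nat \<Rightarrow> real \<Rightarrow> real^3) \<Rightarrow> (nat \<Rightarrow> real \<Rightarrow> real) \<Rightarrow> ((real^3) \<times> real) set" where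
  "below n \<gamma> h = flip_height ` above n \<gamma> (\<lambda>i s. - h i s)"

lemma flip_height_flip_height [simp]: "flip_height (flip_height z) = z"
  by (simp add: flip_height_def)

lemma flip_height_at_height: "flip_height (at_height x k) = at_height x (- k)"
  by (simp add: flip_height_def at_height_def)

lemma flip_height_S3: "z \<in> S3 \<Longrightarrow> flip_height z \<in> S3"
  by (cases z) (simp add: flip_height_def norm_Pair)

lemma continuous_flip_height: "continuous_on X flip_height"
proof -
  have "continuous_on X (\<lambda>z::(real^3) \<times> real. (fst z, - snd z))"
    by (intro continuous_on_Pair continuous_on_fst continuous_on_snd continuous_on_minus continuous_on_id)
  then show ?thesis by (simp add: flip_height_def[abs_def])
qed

lemma flip_height_below_iff: "flip_height z \<in> above n \<gamma> (\<lambda>i s. - h i s) \<longleftrightarrow> z \<in> below n \<gamma> h"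
  unfolding below_def
proof
  assume "flip_height z \<in> above n \<gamma> (\<lambda>i s. - h i s)"
  then show "z \<in> flip_height ` above n \<gamma> (\<lambda>i s. - h i s)" by (intro image_eqI[of z _ "flip_height z"]) simp_all
qed auto

locale height_curves =
  fixes n :: nat and \<gamma> :: "nat \<Rightarrow> real \<Rightarrow> real^3" and h :: "nat \<Rightarrow> real \<Rightarrow> real"
  assumes n_pos: "0 < n"
    and curve_S2: "\<And>i s. i < n \<Longrightarrow> norm (\<gamma> i s) = 1"
    and curve_cont: "\<And>i. i < n \<Longrightarrow> continuous_on UNIV (\<gamma> i)"
    and curve_periodic: "\<And>i s. i < n \<Longrightarrow> \<gamma> i (s + 1) = \<gamma> i s"
    and height_cont: "\<And>i. i < n \<Longrightarrow> continuous_on UNIV (h i)"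
    and height_periodic: "\<And>i s. i < n \<Longrightarrow> h i (s + 1) = h i s"
    and height_bounds: "\<And>i s. i < n \<Longrightarrow> -1 < h i s" "\<And>i s. i < n \<Longrightarrow> h i s < 1"
begin

definition K where "K = (\<Union>i<n. range (\<lambda>s. at_height (\<gamma> i s) (h i s)))"
definition P where "P = (\<Union>i<n. range (\<gamma> i))"

lemma P_sub: "P \<subseteq> S2" using curve_S2 by (auto simp: P_def)

lemma P_compact: "compact P"
proof -
  have "range (\<gamma> i) = \<gamma> i ` {0..1}" if "i < n" for i
  proof -
    have "\<gamma> i s \<in> \<gamma> i ` {0..1}" for s
      by (rule image_eqI[of _ _ "frac s"]) (simp_all add: periodic_frac[of "\<gamma> i"] curve_periodic that frac_lt_1 less_imp_le)
    then show ?thesis by auto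
  qed
  moreover have "compact (\<gamma> i ` {0..1})" if "i < n" for i
    by (intro compact_continuous_image continuous_on_subset[OF curve_cont[OF that]]) auto
  ultimately show ?thesis unfolding P_def by (intro compact_UN) auto
qed

lemma flipped: "height_curves n \<gamma> (\<lambda>i s. - h i s)"
  using n_pos curve_S2 curve_cont curve_periodic height_cont height_periodic height_bounds
  by unfold_locales (auto intro!: continuous_intros simp: minus_less_iff)

lemma at_height_above_iff:
  assumes "norm x = 1" "-1 < k" "k < 1"
  shows "at_height x k \<in> above n \<gamma> h \<longleftrightarrow> (\<forall>i s. i < n \<longrightarrow> \<gamma> i s = x \<longrightarrow> h i s < k)"
proof -
  have "at_height x k \<in> S3" using assms by (intro at_height_in_S3) auto
  moreover have "at_height x k = at_height (\<gamma> i s) t \<longleftrightarrow> x = \<gamma> i s \<and> k = t" if "i < n" for i s t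
    using at_height_eq_iff assms curve_S2 that by metis
  then have "at_height x k \<in> {at_height (\<gamma> i s) t | i s t. i < n \<and> -1 \<le> t \<and> t \<le> h i s}
      \<longleftrightarrow> (\<exists>i s. i < n \<and> \<gamma> i s = x \<and> k \<le> h i s)"
    using less_imp_le[OF assms(2)] unfolding mem_Collect_eq by metis
  ultimately show ?thesis unfolding above_def by (auto simp: not_le)
qed

lemma north_above: "(0, 1) \<in> above n \<gamma> h"
proof -
  have "(0, 1) \<noteq> at_height (\<gamma> i s) t" if "i < n" "t \<le> h i s" for i s t
    using that height_bounds(2)[of i s] by (metis snd_at_height snd_conv not_le)
  then show ?thesis unfolding above_def by (auto simp: norm_Pair)
qed

text \<open>All removed vertical segments start at height -1, where \<open>at_height\<close> forgets
  the direction, so a single curve already removes the south pole.\<close>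

lemma south_not_above: "(0, -1) \<notin> above n \<gamma> h"
proof -
  have "(0, -1) = at_height (\<gamma> 0 0) (-1)" by (simp add: at_height_poles)
  then show ?thesis unfolding above_def using n_pos height_bounds(1)[of 0 0] by force
qed

lemma above_subset: "above n \<gamma> h \<subseteq> S3 - K"
proof
  fix z assume z: "z \<in> above n \<gamma> h"
  have "z \<noteq> at_height (\<gamma> i s) (h i s)" if "i < n" for i s
    using z that height_bounds(1)[OF that, of s] unfolding above_def by fastforce
  then show "z \<in> S3 - K" using z unfolding K_def by (auto simp: above_def)
qed

text \<open>The removed set is compact: rescaling the vertical segments to the unit interval
  presents it as a finite union of images of the unit square, one period of a strand times the
  segment below it.\<close>

lemma above_openin: "openin (top_of_set S3) (above n \<gamma> h)"
proof -
  define q where "q i = (\<lambda>(s, r). at_height (\<gamma> i s) (-1 + r * (1 + h i s)))" for i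
  have "{at_height (\<gamma> i s) t | i s t. i < n \<and> -1 \<le> t \<and> t \<le> h i s} = (\<Union>i<n. q i ` ({0..1} \<times> {0..1}))" (is "?L = ?R")
  proof (intro equalityI subsetI)
    fix z assume "z \<in> ?L"
    then obtain i s t where z: "z = at_height (\<gamma> i s) t" "i < n" "-1 \<le> t" "t \<le> h i s" by auto
    have fr: "\<gamma> i (frac s) = \<gamma> i s" "h i (frac s) = h i s"
      by (intro periodic_frac curve_periodic height_periodic z(2))+
    have hp: "0 < 1 + h i s" using height_bounds(1)[OF z(2), of s] by simp
    define r where "r = (t + 1) / (1 + h i s)"
    have "r * (1 + h i s) = t + 1" using hp by (simp add: r_def)
    then have "z = q i (frac s, r)" using z(1) fr by (simp add: q_def)
    moreover have "0 \<le> r" "r \<le> 1" using z hp by (simp_all add: r_def field_simps)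
    ultimately show "z \<in> ?R" using z(2)
      by (intro UN_I[of i] image_eqI[of _ _ "(frac s, r)"]) (auto simp: frac_lt_1 less_imp_le)
  next
    fix z assume "z \<in> ?R"
    then obtain i s r where z: "i < n" "z = q i (s, r)" "0 \<le> r" "r \<le> 1" by auto
    have hp: "0 < 1 + h i s" using height_bounds(1)[OF z(1), of s] by simp
    have "0 \<le> r * (1 + h i s)" "r * (1 + h i s) \<le> 1 * (1 + h i s)"
      using z hp by (auto intro: mult_right_mono)
    then show "z \<in> ?L"
      using z unfolding mem_Collect_eq
      by (intro exI[of _ i] exI[of _ s] exI[of _ "-1 + r * (1 + h i s)"]) (simp add: q_def)
  qed
  moreover have "compact ?R"
  proof (intro compact_UN compact_continuous_image)
    fix i assume "i \<in> {..<n}"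
    then have "i < n" by simp
    have "continuous_on ({0..1} \<times> {0..1}) (\<lambda>p::real\<times>real. \<gamma> i (fst p))" "continuous_on ({0..1} \<times> {0..1}) (\<lambda>p::real\<times>real. h i (fst p))"
      by (intro continuous_on_compose2[OF curve_cont[OF \<open>i < n\<close>]] continuous_on_compose2[OF height_cont[OF \<open>i < n\<close>]] continuous_intros; simp)+
    then show "continuous_on ({0..1} \<times> {0..1}) (q i)"
      unfolding q_def case_prod_unfold by (intro continuous_at_height continuous_intros)
  qed (auto intro: compact_Times)
  ultimately have "closed {at_height (\<gamma> i s) t | i s t. i < n \<and> -1 \<le> t \<and> t \<le> h i s}"
    by (simp add: compact_imp_closed)
  then show ?thesis unfolding above_def unfolding Diff_eq by (intro openin_open_Int open_Compl)
qed

lemma meridian_above: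
  assumes "z \<in> above n \<gamma> h" "s \<in> {0..1}"
  shows "meridian z s \<in> above n \<gamma> h"
proof -
  have "z \<in> S3" using assms(1) by (simp add: above_def)
  then show ?thesis
  proof (cases rule: S3_cases)
    case 1 then show ?thesis using north_above by (simp add: meridian_pole)
  next
    case 2 then show ?thesis using assms south_not_above by simp
  next
    case (3 x k)
    have "s * (1 - k) \<le> 1 * (1 - k)" using assms(2) 3 by (intro mult_right_mono) auto
    then have le: "k \<le> 1 - s * (1 - k)" by simp
    show ?thesis
    proof (cases "s = 0")
      case True
      then show ?thesis using north_above 3 by (simp add: meridian_at_height at_height_poles)
    next
      case False
      then have "1 - s * (1 - k) < 1" using assms(2) 3 by auto
      then show ?thesis using 3 assms le
        by (auto simp: meridian_at_height at_height_above_iff intro: less_le_trans)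
    qed
  qed
qed

lemma meridian_ends:
  assumes "z \<in> above n \<gamma> h"
  shows "meridian z 0 = (0, 1)" "meridian z 1 = z" "snd z \<noteq> -1"
proof -
  have "z \<in> S3" using assms(1) by (simp add: above_def)
  then have "meridian z 0 = (0, 1) \<and> meridian z 1 = z \<and> snd z \<noteq> -1"
  proof (cases rule: S3_cases)
    case 1 then show ?thesis by (simp add: meridian_pole)
  next
    case 2 then show ?thesis using assms south_not_above by simp
  next
    case (3 x k)
    then show ?thesis by (simp add: meridian_at_height at_height_poles)
  qed
  then show "meridian z 0 = (0, 1)" "meridian z 1 = z" "snd z \<noteq> -1" by auto
qed

lemma above_primitive:
  assumes "local_cocycle (S3 - K) t"
  shows "\<exists>f. primitive (above n \<gamma> h) t f"
proof (rule contractible_primitive[where \<Phi>=meridian and z="(0,1)"])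
  show "local_cocycle (above n \<gamma> h) t" by (rule local_cocycle_subset[OF assms above_subset])
  show "continuous_on (above n \<gamma> h \<times> {0..1}) (\<lambda>(x, s). meridian x s)"
    by (intro continuous_meridian meridian_ends)
qed (use meridian_above meridian_ends in auto)

lemma above_connected: "connected (above n \<gamma> h)"
proof -
  have "above n \<gamma> h = \<Union> ((\<lambda>z. meridian z ` {0..1}) ` above n \<gamma> h)" (is "_ = ?R")
  proof (intro equalityI subsetI)
    fix z assume "z \<in> above n \<gamma> h"
    then show "z \<in> ?R" using meridian_ends(2)[of z] by (intro UN_I[of z] image_eqI[of _ _ 1]) auto
  qed (use meridian_above in auto)
  moreover have "connected ?R"
  proof (rule connected_Union)
    fix S assume "S \<in> (\<lambda>z. meridian z ` {0..1}) ` above n \<gamma> h"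
    then obtain z where z: "S = meridian z ` {0..1}" "z \<in> above n \<gamma> h" by auto
    have "continuous_on ({z} \<times> {0..1}) (\<lambda>(x, s). meridian x s)"
      using meridian_ends(3)[OF z(2)] by (intro continuous_meridian) auto
    then have "connected ((\<lambda>(x, s). meridian x s) ` ({z} \<times> {0..1}))"
      by (intro connected_continuous_image connected_Times) auto
    moreover have "(\<lambda>(x, s). meridian x s) ` ({z} \<times> {0..1}) = S" unfolding z(1) by force
    ultimately show "connected S" by simp
  next
    have "(0, 1) \<in> meridian z ` {0..1}" if "z \<in> above n \<gamma> h" for z
      using meridian_ends(1)[OF that] by (intro image_eqI[of _ _ 0]) auto
    then show "\<Inter> ((\<lambda>z. meridian z ` {0..1}) ` above n \<gamma> h) \<noteq> {}" by blast
  qed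
  ultimately show ?thesis by simp
qed

lemma flip_height_K: "flip_height ` height_curves.K n \<gamma> (\<lambda>i s. - h i s) = K"
  unfolding K_def height_curves.K_def[OF flipped] by (simp add: image_UN image_image flip_height_at_height)

lemma at_height_below_iff:
  assumes "norm x = 1" "-1 < k" "k < 1"
  shows "at_height x k \<in> below n \<gamma> h \<longleftrightarrow> (\<forall>i s. i < n \<longrightarrow> \<gamma> i s = x \<longrightarrow> k < h i s)"
  using height_curves.at_height_above_iff[OF flipped, of x "- k"] assms
  by (simp flip: flip_height_below_iff add: flip_height_at_height minus_less_iff)

lemma below_subset: "below n \<gamma> h \<subseteq> S3 - K"
proof -
  have "below n \<gamma> h \<subseteq> flip_height ` (S3 - height_curves.K n \<gamma> (\<lambda>i s. - h i s))"
    unfolding below_def by (intro image_mono height_curves.above_subset[OF flipped])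
  also have "\<dots> \<subseteq> S3 - K"
    unfolding flip_height_K[symmetric] using flip_height_S3 by (auto simp: inj_image_mem_iff) (metis flip_height_flip_height)
  finally show ?thesis .
qed

lemma south_below: "(0, -1) \<in> below n \<gamma> h"
  using height_curves.north_above[OF flipped] by (simp flip: flip_height_below_iff add: flip_height_def)

lemma below_openin: "openin (top_of_set S3) (below n \<gamma> h)"
proof -
  obtain W where W: "open W" "above n \<gamma> (\<lambda>i s. - h i s) = S3 \<inter> W"
    using height_curves.above_openin[OF flipped] by (auto simp: openin_open)
  have "open (flip_height -` W)"
    using W(1) continuous_flip_height[of UNIV] by (simp add: continuous_on_open_vimage)
  moreover have "below n \<gamma> h = S3 \<inter> flip_height -` W"
  proof (intro set_eqI)
    fix z
    have "z \<in> S3 \<longleftrightarrow> flip_height z \<in> S3" using flip_height_S3 flip_height_flip_height by metis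
    then show "z \<in> below n \<gamma> h \<longleftrightarrow> z \<in> S3 \<inter> flip_height -` W"
      using W(2) flip_height_below_iff[of z n \<gamma> h] by auto
  qed
  ultimately show ?thesis by (auto simp: openin_open)
qed

lemma below_primitive:
  assumes "local_cocycle (S3 - K) t"
  shows "\<exists>f. primitive (below n \<gamma> h) t f"
proof -
  have im: "flip_height ` (S3 - height_curves.K n \<gamma> (\<lambda>i s. - h i s)) \<subseteq> S3 - K"
    unfolding flip_height_K[symmetric] using flip_height_S3 by (auto simp: inj_image_mem_iff) (metis flip_height_flip_height)
  obtain f where f: "primitive (above n \<gamma> (\<lambda>i s. - h i s)) (\<lambda>a b. t (flip_height a) (flip_height b)) f"
    using height_curves.above_primitive[OF flipped local_cocycle_compose[OF assms continuous_flip_height im]] by blast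
  have "primitive (below n \<gamma> h) (\<lambda>a b. t (flip_height (flip_height a)) (flip_height (flip_height b))) (\<lambda>a. f (flip_height a))"
    by (rule primitive_compose[OF f continuous_flip_height]) (auto simp: below_def)
  then show ?thesis by auto
qed

lemma below_connected: "connected (below n \<gamma> h)"
  unfolding below_def
  by (intro connected_continuous_image continuous_flip_height height_curves.above_connected[OF flipped])

lemma off_P_above_below:
  assumes "x \<in> S2 - P" "-1 < k" "k < 1"
  shows "at_height x k \<in> above n \<gamma> h \<inter> below n \<gamma> h"
  using assms by (auto simp: at_height_above_iff at_height_below_iff P_def)

text \<open>Over a face the two regions overlap in the whole open vertical segment, so the
  difference of the two primitives depends only on the face. This difference is the colour of the
  face.\<close>

lemma transition_loc_const:
  assumes "primitive (above n \<gamma> h) t f" "primitive (below n \<gamma> h) t f'"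
  shows "loc_const (S2 - P) (\<lambda>x. f (at_height x 0) - f' (at_height x 0))"
    "\<And>x k. x \<in> S2 - P \<Longrightarrow> -1 < k \<Longrightarrow> k < 1 \<Longrightarrow>
       f (at_height x k) - f' (at_height x k) = f (at_height x 0) - f' (at_height x 0)"
proof -
  have lc: "loc_const (above n \<gamma> h \<inter> below n \<gamma> h) (\<lambda>z. f z - f' z)"
    by (intro primitive_diff_loc_const[where t=t] primitive_subset[OF assms(1)] primitive_subset[OF assms(2)]) auto
  show "loc_const (S2 - P) (\<lambda>x. f (at_height x 0) - f' (at_height x 0))"
    using off_P_above_below
    by (intro loc_const_compose[OF lc, where h="\<lambda>x. at_height x 0"] continuous_at_height continuous_intros) auto
  fix x and k :: real assume x: "x \<in> S2 - P" and k: "-1 < k" "k < 1"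
  have "loc_const {-1<..<1} (\<lambda>k. f (at_height x k) - f' (at_height x k))"
    using off_P_above_below[OF x]
    by (intro loc_const_compose[OF lc, where h="\<lambda>k. at_height x k"] continuous_at_height continuous_intros) auto
  then show "f (at_height x k) - f' (at_height x k) = f (at_height x 0) - f' (at_height x 0)"
    using k by (intro loc_const_connected[of "{-1<..<1}" _ k 0]) auto
qed

end

section \<open>Charts of the 2-sphere\<close>

text \<open>\<open>u\<close> and \<open>v\<close> are coordinates of the projection along
  \<open>x\<close>; the positive inner product selects the sheet of the sphere near
  \<open>x\<close>.\<close>

definition chart_box :: "real^3 \<Rightarrow> (real^3 \<Rightarrow> real) \<Rightarrow> (real^3 \<Rightarrow> real) \<Rightarrow> real \<Rightarrow> (real^3) set" where
  "chart_box x u v r = {y. norm y = 1 \<and> 0 < y \<bullet> x \<and> \<bar>u y\<bar> < r \<and> \<bar>v y\<bar> < r}"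

text \<open>The slope bound 1/2 confines the graph to a double cone around the \<open>u\<close>
  axis. Two branches that are graphs over different axes then meet only at the centre and lie on
  known sides of each other.\<close>

definition chart_graph :: "real^3 \<Rightarrow> (real^3 \<Rightarrow> real) \<Rightarrow> (real^3 \<Rightarrow> real) \<Rightarrow> real \<Rightarrow> (real^3) set \<Rightarrow> (real \<Rightarrow> real) \<Rightarrow> bool" where
  "chart_graph x u v r C \<phi> \<longleftrightarrow> continuous_on {-r<..<r} \<phi> \<and> (\<forall>a. \<bar>a\<bar> < r \<longrightarrow> \<bar>\<phi> a\<bar> \<le> \<bar>a\<bar> / 2) \<and>
     (\<forall>y\<in>chart_box x u v r. y \<in> C \<longleftrightarrow> v y = \<phi> (u y))"

locale sphere_chart =
  fixes x :: "real^3" and u v :: "real^3 \<Rightarrow> real" and \<Theta> :: "real \<times> real \<Rightarrow> real^3" and R :: real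
  assumes x_norm: "norm x = 1"
    and u_lin: "bounded_linear u" and v_lin: "bounded_linear v"
    and u_x: "u x = 0" and v_x: "v x = 0"
    and R_pos: "0 < R"
    and chart_in: "\<And>a b. \<bar>a\<bar> < R \<Longrightarrow> \<bar>b\<bar> < R \<Longrightarrow>
          norm (\<Theta> (a, b)) = 1 \<and> 0 < \<Theta> (a, b) \<bullet> x \<and> u (\<Theta> (a, b)) = a \<and> v (\<Theta> (a, b)) = b"
    and chart_inv: "\<And>y. norm y = 1 \<Longrightarrow> 0 < y \<bullet> x \<Longrightarrow> \<bar>u y\<bar> < R \<Longrightarrow> \<bar>v y\<bar> < R \<Longrightarrow> \<Theta> (u y, v y) = y"
    and chart_cont: "continuous_on {p. \<bar>fst p\<bar> < R \<and> \<bar>snd p\<bar> < R} \<Theta>"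
begin

abbreviation box where "box \<equiv> chart_box x u v"

lemma x_in_box: "0 < r \<Longrightarrow> x \<in> box r"
  using x_norm u_x v_x by (simp add: chart_box_def norm_eq_1)

lemma chart_0: "\<Theta> (0, 0) = x"
proof -
  have "x \<noteq> 0" using x_norm by auto
  then show ?thesis using chart_inv[of x] x_norm u_x v_x R_pos by simp
qed

lemma u_cont: "continuous_on S u" and v_cont: "continuous_on S v"
  using u_lin v_lin by (simp_all add: linear_continuous_on)

lemma box_eq: "r \<le> R \<Longrightarrow> box r = \<Theta> ` ({-r<..<r} \<times> {-r<..<r})"
proof (intro equalityI subsetI)
  fix y assume r: "r \<le> R" and y: "y \<in> box r"
  then have "y = \<Theta> (u y, v y)" using chart_inv[of y] by (simp add: chart_box_def)
  then show "y \<in> \<Theta> ` ({-r<..<r} \<times> {-r<..<r})"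
    using y by (intro image_eqI[of _ _ "(u y, v y)"]) (auto simp: chart_box_def)
next
  fix y assume r: "r \<le> R" and y: "y \<in> \<Theta> ` ({-r<..<r} \<times> {-r<..<r})"
  then obtain a b where ab: "y = \<Theta> (a, b)" "\<bar>a\<bar> < r" "\<bar>b\<bar> < r" by auto
  then show "y \<in> box r" using chart_in[of a b] r by (simp add: chart_box_def)
qed

lemma box_openin: "openin (top_of_set S2) (box r)"
proof -
  have "open {y. 0 < y \<bullet> x \<and> \<bar>u y\<bar> < r \<and> \<bar>v y\<bar> < r}"
    by (intro open_Collect_conj open_Collect_less continuous_intros u_cont v_cont)
  moreover have "box r = S2 \<inter> {y. 0 < y \<bullet> x \<and> \<bar>u y\<bar> < r \<and> \<bar>v y\<bar> < r}"
    by (auto simp: chart_box_def)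
  ultimately show ?thesis by (auto simp: openin_open)
qed

lemma box_mono: "r \<le> r' \<Longrightarrow> box r \<subseteq> box r'"
  by (auto simp: chart_box_def)

lemma chart_cont_comp:
  assumes "continuous_on S f" "\<And>s. s \<in> S \<Longrightarrow> \<bar>fst (f s)\<bar> < R \<and> \<bar>snd (f s)\<bar> < R"
  shows "continuous_on S (\<lambda>s. \<Theta> (f s))"
  using assms by (intro continuous_on_compose2[OF chart_cont]) auto

lemma box_basis:
  assumes "open W" "x \<in> W"
  obtains r where "0 < r" "r \<le> R" "box r \<subseteq> W"
proof -
  have op: "open {p::real\<times>real. \<bar>fst p\<bar> < R \<and> \<bar>snd p\<bar> < R}"
    by (intro open_Collect_conj open_Collect_less continuous_intros)
  have "open (\<Theta> -` W \<inter> {p. \<bar>fst p\<bar> < R \<and> \<bar>snd p\<bar> < R})"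
    using iffD1[OF continuous_on_open_vimage[OF op] chart_cont] assms(1) by blast
  moreover have "(0, 0) \<in> \<Theta> -` W \<inter> {p. \<bar>fst p\<bar> < R \<and> \<bar>snd p\<bar> < R}"
    using chart_0 assms(2) R_pos by simp
  ultimately obtain A B where AB: "open A" "open B" "(0::real, 0::real) \<in> A \<times> B"
      "A \<times> B \<subseteq> \<Theta> -` W \<inter> {p. \<bar>fst p\<bar> < R \<and> \<bar>snd p\<bar> < R}"
    by (rule open_prod_elim)
  obtain e1 where e1: "e1 > 0" "ball 0 e1 \<subseteq> A" using AB(1,3) openE[of A 0] by auto
  obtain e2 where e2: "e2 > 0" "ball 0 e2 \<subseteq> B" using AB(2,3) openE[of B 0] by auto
  define r where "r = min R (min e1 e2)"
  have r: "0 < r" "r \<le> R" using e1 e2 R_pos by (auto simp: r_def)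
  have "{-r<..<r} \<subseteq> A" "{-r<..<r} \<subseteq> B"
    using e1(2) e2(2) by (auto simp: r_def dist_real_def subset_iff)
  then have "{-r<..<r} \<times> {-r<..<r} \<subseteq> \<Theta> -` W" using AB(4) by blast
  then have "box r \<subseteq> W" using box_eq[OF r(2)] by auto
  then show thesis using that r by blast
qed

text \<open>This is what lets a gauge extend over the segment between the two strands of a crossing:
  the neighbourhood without that vertical line is still connected.\<close>

lemma box_punctured_connected:
  assumes "r \<le> R" "0 < r"
  shows "connected (box r - {x})"
proof -
  have "connected (({-r<..<r} \<times> {-r<..<r}) - {(0, 0)} :: (real \<times> real) set)"
    by (intro connected_open_delete open_Times connected_Times) auto
  moreover have "continuous_on (({-r<..<r} \<times> {-r<..<r}) - {(0, 0)}) (\<lambda>p. \<Theta> p)"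
    using assms by (intro chart_cont_comp continuous_intros) auto
  ultimately have "connected (\<Theta> ` (({-r<..<r} \<times> {-r<..<r}) - {(0, 0)}))"
    by (rule connected_continuous_image[rotated])
  moreover have "\<Theta> ` (({-r<..<r} \<times> {-r<..<r}) - {(0, 0)}) = box r - {x}"
  proof -
    have "inj_on \<Theta> ({-r<..<r} \<times> {-r<..<r})"
    proof (rule inj_onI)
      fix p q assume pq: "p \<in> {-r<..<r} \<times> {-r<..<r}" "q \<in> {-r<..<r} \<times> {-r<..<r}" "\<Theta> p = \<Theta> q"
      then show "p = q" using chart_in[of "fst p" "snd p"] chart_in[of "fst q" "snd q"] assms
        by (auto simp: prod_eq_iff mem_Times_iff)
    qed
    then have "\<Theta> ` (({-r<..<r} \<times> {-r<..<r}) - {(0, 0)}) = \<Theta> ` ({-r<..<r} \<times> {-r<..<r}) - \<Theta> ` {(0, 0)}"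
      using assms by (intro inj_on_image_set_diff) auto
    then show ?thesis using box_eq[OF assms(1)] chart_0 by simp
  qed
  ultimately show ?thesis by simp
qed

text \<open>Exchanges the two sides of a graph, so that only the upper side has to be
  studied.\<close>

lemma flipped: "sphere_chart x u (\<lambda>y. - v y) (\<lambda>p. \<Theta> (fst p, - snd p)) R"
proof (rule sphere_chart.intro)
  show "bounded_linear (\<lambda>y. - v y)" using v_lin by (rule bounded_linear_minus)
  show "continuous_on {p. \<bar>fst p\<bar> < R \<and> \<bar>snd p\<bar> < R} (\<lambda>p. \<Theta> (fst p, - snd p))"
    by (intro chart_cont_comp continuous_intros) auto
qed (use x_norm u_lin v_x u_x R_pos chart_in chart_inv in auto)

text \<open>Lets the second strand of a crossing be treated as a graph over the other axis of the
  same chart.\<close>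

lemma swapped: "sphere_chart x v u (\<lambda>p. \<Theta> (snd p, fst p)) R"
proof (rule sphere_chart.intro)
  show "continuous_on {p. \<bar>fst p\<bar> < R \<and> \<bar>snd p\<bar> < R} (\<lambda>p. \<Theta> (snd p, fst p))"
    by (intro chart_cont_comp continuous_intros) auto
qed (use x_norm u_lin v_lin v_x u_x R_pos chart_in chart_inv in auto)

definition upper :: "real \<Rightarrow> (real \<Rightarrow> real) \<Rightarrow> (real^3) set" where
  "upper r \<phi> = {y \<in> box r. \<phi> (u y) < v y}"

lemma upper_graph:
  assumes "0 < r" "r \<le> R" "continuous_on {-r<..<r} \<phi>" and bd: "\<And>a. \<bar>a\<bar> < r \<Longrightarrow> \<bar>\<phi> a\<bar> \<le> \<bar>a\<bar> / 2"
  shows "openin (top_of_set S2) (upper r \<phi>)" "connected (upper r \<phi>)"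
    "\<And>y. y \<in> box r \<Longrightarrow> v y = \<phi> (u y) \<Longrightarrow> y \<in> closure (upper r \<phi>)"
proof -
  have "continuous_on (box r) (\<lambda>y. v y - \<phi> (u y))"
    by (intro continuous_intros v_cont continuous_on_compose2[OF assms(3) u_cont]) (auto simp: chart_box_def abs_less_iff)
  then have "openin (top_of_set (box r)) (box r \<inter> (\<lambda>y. v y - \<phi> (u y)) -` {0<..})"
    by (rule continuous_openin_preimage_gen) auto
  moreover have "box r \<inter> (\<lambda>y. v y - \<phi> (u y)) -` {0<..} = upper r \<phi>"
    by (auto simp: upper_def)
  ultimately show "openin (top_of_set S2) (upper r \<phi>)"
    using box_openin by (metis openin_trans)
  \<comment> \<open>Rescaling the segment from the graph to the top edge of the box parametrises the
    upper side by a rectangle. The slope bound keeps the graph strictly inside the box, so the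
    segments never degenerate.\<close>
  define q where "q p = \<Theta> (fst p, \<phi> (fst p) + snd p * (r - \<phi> (fst p)))" for p
  have bd': "\<bar>\<phi> a\<bar> < r" if "\<bar>a\<bar> < r" for a using bd[OF that] that by auto
  have qbd: "\<phi> a < \<phi> a + s * (r - \<phi> a)" "\<phi> a + s * (r - \<phi> a) < r" "- r < \<phi> a + s * (r - \<phi> a)"
    if "\<bar>a\<bar> < r" "0 < s" "s < 1" for a s
  proof -
    have p: "0 < r - \<phi> a" using bd'[OF that(1)] by auto
    then have "0 < s * (r - \<phi> a)" "s * (r - \<phi> a) < 1 * (r - \<phi> a)" using that by (auto intro: mult_strict_right_mono)
    then show "\<phi> a < \<phi> a + s * (r - \<phi> a)" "\<phi> a + s * (r - \<phi> a) < r" "- r < \<phi> a + s * (r - \<phi> a)"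
      using bd'[OF that(1)] by auto
  qed
  have "upper r \<phi> = q ` ({-r<..<r} \<times> {0<..<1})"
  proof (intro equalityI subsetI)
    fix y assume y: "y \<in> upper r \<phi>"
    then have yb: "y \<in> box r" "\<phi> (u y) < v y" by (auto simp: upper_def)
    then have uy: "\<bar>u y\<bar> < r" "\<bar>v y\<bar> < r" by (auto simp: chart_box_def)
    define s where "s = (v y - \<phi> (u y)) / (r - \<phi> (u y))"
    have p: "0 < r - \<phi> (u y)" using bd'[OF uy(1)] by auto
    have "0 < s" "s < 1" using p yb uy by (auto simp: s_def field_simps)
    moreover have "s * (r - \<phi> (u y)) = v y - \<phi> (u y)" using p by (simp add: s_def)
    then have "y = q (u y, s)" using chart_inv[of y] yb assms by (simp add: q_def chart_box_def)
    ultimately show "y \<in> q ` ({-r<..<r} \<times> {0<..<1})"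
      using uy by (intro image_eqI[of _ _ "(u y, s)"]) auto
  next
    fix y assume "y \<in> q ` ({-r<..<r} \<times> {0<..<1})"
    then obtain p where p: "p \<in> {-r<..<r} \<times> {0<..<1}" "y = q p" by blast
    define a s where "a = fst p" and "s = snd p"
    have as: "\<bar>a\<bar> < r" "0 < s" "s < 1" "y = q (a, s)" using p by (auto simp: a_def s_def mem_Times_iff)
    then show "y \<in> upper r \<phi>"
      using qbd[OF as(1-3)] chart_in[of a "\<phi> a + s * (r - \<phi> a)"] assms by (auto simp: q_def upper_def chart_box_def abs_less_iff)
  qed
  moreover have "continuous_on ({-r<..<r} \<times> {0<..<1}) q"
    unfolding q_def
  proof (rule chart_cont_comp)
    show "continuous_on ({- r<..<r} \<times> {0<..<1}) (\<lambda>p. (fst p, \<phi> (fst p) + snd p * (r - \<phi> (fst p))))"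
      by (intro continuous_intros continuous_on_compose2[OF assms(3)]) auto
  next
    fix p :: "real \<times> real" assume "p \<in> {- r<..<r} \<times> {0<..<1}"
    then show "\<bar>fst (fst p, \<phi> (fst p) + snd p * (r - \<phi> (fst p)))\<bar> < R \<and> \<bar>snd (fst p, \<phi> (fst p) + snd p * (r - \<phi> (fst p)))\<bar> < R"
      using qbd[of "fst p" "snd p"] assms by (auto simp: mem_Times_iff abs_less_iff)
  qed
  ultimately show "connected (upper r \<phi>)"
    by (metis connected_continuous_image connected_Times connected_Ioo)
  fix y assume y: "y \<in> box r" "v y = \<phi> (u y)"
  then have uy: "\<bar>u y\<bar> < r" "\<bar>v y\<bar> < r" by (auto simp: chart_box_def)
  have "continuous_on {-r<..<r} (\<lambda>s. \<Theta> (u y, s))"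
    using uy assms by (intro chart_cont_comp continuous_intros) auto
  then have "((\<lambda>s. \<Theta> (u y, s)) \<longlongrightarrow> \<Theta> (u y, v y)) (at (v y))"
    using uy by (metis abs_less_iff at_within_open continuous_on_def greaterThanLessThan_iff minus_less_iff open_greaterThanLessThan)
  then have "((\<lambda>s. \<Theta> (u y, s)) \<longlongrightarrow> y) (at_right (v y))"
    using chart_inv[of y] y assms by (auto simp: chart_box_def intro: tendsto_mono[OF at_le])
  moreover have "eventually (\<lambda>s. \<Theta> (u y, s) \<in> closure (upper r \<phi>)) (at_right (v y))"
    unfolding eventually_at_right_field
  proof (intro exI[of _ r] conjI allI impI)
    fix s assume "v y < s" "s < r"
    then have "\<Theta> (u y, s) \<in> upper r \<phi>"
      using chart_in[of "u y" s] uy y assms by (auto simp: upper_def chart_box_def)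
    then show "\<Theta> (u y, s) \<in> closure (upper r \<phi>)" by (rule subsetD[OF closure_subset])
  qed (use uy in auto)
  ultimately show "y \<in> closure (upper r \<phi>)"
    by (intro Lim_in_closed_set[of _ "\<lambda>s. \<Theta> (u y, s)"]) auto
qed

text \<open>A one dimensional inverse function argument: \<open>u\<close> is strictly increasing
  along the curve near \<open>s0\<close>, so the curve is a graph over \<open>u\<close>. The
  parameter window \<open>d\<close> is fixed before the box, which is then shrunk to fit, because
  the window has to meet further conditions coming from the heights.\<close>

lemma branch:
  assumes C1: "f C1_differentiable_on UNIV" and f_S2: "\<And>s. norm (f s) = 1" and f0: "f s0 = x"
    and u1: "u (vector_derivative f (at s0)) = 1" and v0: "v (vector_derivative f (at s0)) = 0"
  obtains d0 where "0 < d0"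
    "\<forall>s. s0 < s \<longrightarrow> s < s0 + d0 \<longrightarrow> 0 < u (f s) \<and> \<bar>v (f s)\<bar> \<le> u (f s) / 2"
    "\<forall>s. s0 - d0 < s \<longrightarrow> s < s0 \<longrightarrow> u (f s) < 0 \<and> \<bar>v (f s)\<bar> \<le> - u (f s) / 2"
    "\<forall>d. 0 < d \<longrightarrow> d \<le> d0 \<longrightarrow> (\<exists>r1>0. \<forall>r. 0 < r \<longrightarrow> r \<le> r1 \<longrightarrow> r \<le> R \<longrightarrow>
       (\<exists>\<phi>. chart_graph x u v r (f ` {s0-d<..<s0+d}) \<phi>))"
proof -
  define f' where "f' s = vector_derivative f (at s)" for s
  have df: "(f has_vector_derivative f' s) (at s)" and cf': "continuous_on UNIV f'" for s
    using C1 unfolding C1_differentiable_on_eq f'_def by (auto simp: vector_derivative_works)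
  have du: "((\<lambda>s. u (f s)) has_field_derivative u (f' s)) (at s)"
    and dv: "((\<lambda>s. v (f s)) has_field_derivative v (f' s)) (at s)" for s
    using bounded_linear.has_vector_derivative[OF u_lin df] bounded_linear.has_vector_derivative[OF v_lin df]
    by (simp_all add: has_real_derivative_iff_has_vector_derivative)
  have cf: "continuous_on UNIV f"
    by (meson df has_vector_derivative_continuous continuous_at_imp_continuous_on)
  \<comment> \<open>The bounds make the derivative of \<open>u\<close> at least 3/4 and that of
    \<open>v\<close> at most 1/4 in absolute value, hence the slope at most 1/3, within the allowed
    1/2. The last condition keeps the curve on the sheet covered by the chart.\<close>
  define N where "N = {s. \<bar>u (f' s) - 1\<bar> < 1/4 \<and> \<bar>v (f' s)\<bar> < 1/4 \<and> 0 < f s \<bullet> x}"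
  have "open N" unfolding N_def
    by (intro open_Collect_conj open_Collect_less continuous_intros
        continuous_on_compose2[OF u_cont[of UNIV] cf'] continuous_on_compose2[OF v_cont[of UNIV] cf'] cf) auto
  moreover have "s0 \<in> N" using u1 v0 f0 x_norm by (simp add: N_def f'_def norm_eq_1)
  ultimately obtain d0 where d0: "d0 > 0" "ball s0 d0 \<subseteq> N" by (metis open_contains_ball)
  then have N: "s \<in> N" if "\<bar>s - s0\<bar> < d0" for s using that by (auto simp: dist_real_def subset_iff)
  have mono: "u (f s) < u (f t)" if st: "s < t" "\<bar>s - s0\<bar> < d0" "\<bar>t - s0\<bar> < d0" for s t
  proof (rule DERIV_pos_imp_increasing[OF st(1)])
    fix w assume "s \<le> w" "w \<le> t"
    then have "w \<in> N" using st by (intro N) auto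
    then show "\<exists>y. ((\<lambda>s. u (f s)) has_real_derivative y) (at w) \<and> 0 < y"
      using du[of w] unfolding N_def mem_Collect_eq by (intro exI[of _ "u (f' w)"] conjI) linarith+
  qed
  have est: "\<bar>v (f s)\<bar> \<le> \<bar>u (f s)\<bar> / 2" if s: "\<bar>s - s0\<bar> < d0" for s
  proof (cases "s = s0")
    case True then show ?thesis using f0 u_x v_x by simp
  next
    case False
    define a b where "a = min s s0" and "b = max s s0"
    have ab: "a < b" "\<bar>a - s0\<bar> < d0" "\<bar>b - s0\<bar> < d0" using False s d0(1) by (auto simp: a_def b_def min_def max_def)
    obtain z where z: "a < z" "z < b" "u (f b) - u (f a) = (b - a) * u (f' z)"
      using MVT2[OF ab(1), of "\<lambda>s. u (f s)" "\<lambda>s. u (f' s)"] du by blast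
    obtain w where w: "a < w" "w < b" "v (f b) - v (f a) = (b - a) * v (f' w)"
      using MVT2[OF ab(1), of "\<lambda>s. v (f s)" "\<lambda>s. v (f' s)"] dv by blast
    have "z \<in> N" "w \<in> N" using z w ab by (auto intro!: N)
    then have 1: "3/4 \<le> u (f' z)" "\<bar>v (f' w)\<bar> \<le> 1/4" unfolding N_def mem_Collect_eq by linarith+
    have "\<bar>u (f b) - u (f a)\<bar> = (b - a) * \<bar>u (f' z)\<bar>" "\<bar>v (f b) - v (f a)\<bar> = (b - a) * \<bar>v (f' w)\<bar>"
      using z w ab by (auto simp: abs_mult)
    moreover have "(b - a) * \<bar>v (f' w)\<bar> \<le> (b - a) * (\<bar>u (f' z)\<bar> / 2)"
      using 1 ab by (intro mult_left_mono) auto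
    ultimately have "\<bar>v (f b) - v (f a)\<bar> \<le> \<bar>u (f b) - u (f a)\<bar> / 2" by simp
    moreover have "\<bar>v (f b) - v (f a)\<bar> = \<bar>v (f s)\<bar>" "\<bar>u (f b) - u (f a)\<bar> = \<bar>u (f s)\<bar>"
      using f0 u_x v_x by (auto simp: a_def b_def min_def max_def)
    ultimately show ?thesis by simp
  qed
  have pos: "0 < u (f s)" if "s0 < s" "s < s0 + d0" for s using mono[of s0 s] that f0 u_x d0(1) by auto
  have neg: "u (f s) < 0" if "s0 - d0 < s" "s < s0" for s using mono[of s s0] that f0 u_x d0(1) by auto
  have graph: "\<exists>r1>0. \<forall>r. 0 < r \<longrightarrow> r \<le> r1 \<longrightarrow> r \<le> R \<longrightarrow>
        (\<exists>\<phi>. chart_graph x u v r (f ` {s0-d<..<s0+d}) \<phi>)"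
    if d: "0 < d" "d \<le> d0" for d
  proof -
    \<comment> \<open>A closed window half as long: compactness makes the inverse of
      \<open>g\<close> continuous, and the endpoints determine the size of the box.\<close>
    define I where "I = {s0 - d/2..s0 + d/2}"
    define g where "g = (\<lambda>s. u (f s))"
    have cg: "continuous_on S g" for S unfolding g_def
      by (intro continuous_on_compose2[OF u_cont continuous_on_subset[OF cf]]) auto
    have inj: "inj_on g {s. \<bar>s - s0\<bar> < d0}"
      using mono by (intro linorder_inj_onI') (auto simp: g_def, force)
    have ginj: "inj_on g I" by (rule inj_on_subset[OF inj]) (use d in \<open>auto simp: I_def abs_less_iff\<close>)
    define r1 where "r1 = min (g (s0 + d/2)) (- g (s0 - d/2))"
    have r1: "0 < r1" using pos[of "s0 + d/2"] neg[of "s0 - d/2"] d by (auto simp: r1_def g_def)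
    define k where "k = the_inv_into I g"
    have kI: "k a \<in> I \<and> g (k a) = a" if "\<bar>a\<bar> < r1" for a
    proof -
      have "g (s0 - d/2) \<le> a" "a \<le> g (s0 + d/2)" using that by (auto simp: r1_def)
      then obtain s where s: "s0 - d/2 \<le> s" "s \<le> s0 + d/2" "g s = a"
        using IVT'[of g "s0 - d/2" a "s0 + d/2"] cg d by auto
      then have "a \<in> g ` I" by (auto simp: I_def)
      then show ?thesis using ginj by (simp add: k_def the_inv_into_into f_the_inv_into_f)
    qed
    have kc: "continuous_on (g ` I) k"
      by (rule continuous_on_inv[OF cg]) (use ginj in \<open>auto simp: I_def k_def the_inv_into_f_f\<close>)
    have Id: "\<bar>s - s0\<bar> < d" if "s \<in> I" for s using that d by (auto simp: I_def abs_less_iff)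
    show ?thesis
    proof (intro exI[of _ r1] conjI r1 allI impI)
      fix r assume r: "0 < r" "r \<le> r1" "r \<le> R"
      define \<phi> where "\<phi> a = v (f (k a))" for a
      have kr: "k a \<in> I \<and> g (k a) = a" if "\<bar>a\<bar> < r" for a using kI that r by simp
      have "{-r<..<r} \<subseteq> g ` I"
      proof
        fix a assume "a \<in> {-r<..<r}"
        then have "\<bar>a\<bar> < r" by auto
        then show "a \<in> g ` I" using kr[of a] by (metis imageI)
      qed
      then have "continuous_on {-r<..<r} \<phi>" unfolding \<phi>_def
        by (intro continuous_on_compose2[OF v_cont[of UNIV]] continuous_on_compose2[OF cf] continuous_on_subset[OF kc]) auto
      moreover have "\<bar>\<phi> a\<bar> \<le> \<bar>a\<bar> / 2" if "\<bar>a\<bar> < r" for a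
        using est[of "k a"] kr[OF that] Id[of "k a"] d by (simp add: \<phi>_def g_def)
      moreover have "y \<in> f ` {s0-d<..<s0+d} \<longleftrightarrow> v y = \<phi> (u y)" if y: "y \<in> box r" for y
      proof -
        have uy: "\<bar>u y\<bar> < r" using y by (simp add: chart_box_def)
        note k = kr[OF uy]
        show ?thesis
        proof
          assume "y \<in> f ` {s0-d<..<s0+d}"
          then obtain s where "s \<in> {s0-d<..<s0+d}" and "y = f s" by blast
          then have s: "\<bar>s - s0\<bar> < d" "y = f s" by auto
          have "s = k (u y)"
            by (rule inj_onD[OF inj]) (use s k Id[of "k (u y)"] d in \<open>auto simp: g_def\<close>)
          then show "v y = \<phi> (u y)" using s by (simp add: \<phi>_def)
        next
          assume vy: "v y = \<phi> (u y)"
          let ?z = "f (k (u y))"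
          have kd: "\<bar>k (u y) - s0\<bar> < d" using Id k by blast
          then have "k (u y) \<in> N" using d by (intro N) auto
          then have "0 < ?z \<bullet> x" by (simp add: N_def)
          moreover have "u ?z = u y" "v ?z = v y" using k vy by (auto simp: g_def \<phi>_def)
          ultimately have "?z = \<Theta> (u y, v y)" using chart_inv[of ?z] f_S2 y r by (auto simp: chart_box_def)
          also have "\<dots> = y" using chart_inv[of y] y r by (auto simp: chart_box_def)
          finally show "y \<in> f ` {s0-d<..<s0+d}" using kd by (intro image_eqI[of _ _ "k (u y)"]) (auto simp: abs_less_iff)
        qed
      qed
      ultimately show "\<exists>\<phi>. chart_graph x u v r (f ` {s0-d<..<s0+d}) \<phi>"
        unfolding chart_graph_def by (intro exI[of _ \<phi>] conjI allI impI ballI) blast+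
    qed
  qed
  have right: "0 < u (f s) \<and> \<bar>v (f s)\<bar> \<le> u (f s) / 2" if "s0 < s" "s < s0 + d0" for s
    using pos[of s] est[of s] that by auto
  have left: "u (f s) < 0 \<and> \<bar>v (f s)\<bar> \<le> - u (f s) / 2" if "s0 - d0 < s" "s < s0" for s
    using neg[of s] est[of s] that by auto
  show thesis
    by (rule that[of d0]) (intro d0(1) allI impI right left graph; assumption)+
qed

end

text \<open>The functionals are given by Cramer's rule for the basis \<open>e1\<close>,
  \<open>e2\<close>, \<open>x\<close> with determinant \<open>D\<close>. The inverse chart takes the
  tangential combination of \<open>e1\<close> and \<open>e2\<close> and adds the positive multiple
  of \<open>x\<close> that reaches the unit sphere.\<close>

lemma sphere_chart_exists:
  fixes x e1 e2 :: "real^3"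
  assumes x: "norm x = 1" and orth: "e1 \<bullet> x = 0" "e2 \<bullet> x = 0" and ind: "\<not> collinear {0, e1, e2}"
  shows "\<exists>u v \<Theta> R. sphere_chart x u v \<Theta> R \<and> u e1 = 1 \<and> u e2 = 0 \<and> v e1 = 0 \<and> v e2 = 1"
proof -
  define w where "w = cross3 e1 e2"
  define D where "D = w \<bullet> x"
  have xx: "x \<bullet> x = 1" using x by (simp add: norm_eq_1)
  have "w \<noteq> 0" using ind by (simp add: w_def cross_eq_0)
  have "cross3 x w = 0" using orth
    by (simp add: w_def Lagrange inner_commute)
  then have "(norm x * norm w)\<^sup>2 = (x \<bullet> w)\<^sup>2" using norm_cross_dot[of x w] by simp
  then have "D \<noteq> 0" using \<open>w \<noteq> 0\<close> x by (auto simp: D_def inner_commute)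
  define u where "u y = (cross3 y e2 \<bullet> x) / D" for y
  define v where "v y = (cross3 e1 y \<bullet> x) / D" for y
  have "linear u" "linear v"
    unfolding u_def v_def
    by (simp_all add: linear_iff cross_add_left cross_add_right cross_mult_left cross_mult_right
        inner_add_left add_divide_distrib)
  then have lin: "bounded_linear u" "bounded_linear v"
    by (simp_all add: linear_conv_bounded_linear)
  have ue: "u e1 = 1" "u e2 = 0" "v e1 = 0" "v e2 = 1" "u x = 0" "v x = 0"
    using \<open>D \<noteq> 0\<close> by (auto simp: u_def v_def D_def w_def dot_cross_self)
  have decomp: "y = u y *\<^sub>R e1 + v y *\<^sub>R e2 + (y \<bullet> x) *\<^sub>R x" for y
  proof -
    define t where "t = (w \<bullet> y) / D"
    have "D *\<^sub>R y = (cross3 y e2 \<bullet> x) *\<^sub>R e1 + (cross3 e1 y \<bullet> x) *\<^sub>R e2 + (w \<bullet> y) *\<^sub>R x"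
      unfolding D_def w_def by (simp add: cross3_simps forall_3)
    then have "(1 / D) *\<^sub>R (D *\<^sub>R y) = (1 / D) *\<^sub>R ((cross3 y e2 \<bullet> x) *\<^sub>R e1 + (cross3 e1 y \<bullet> x) *\<^sub>R e2 + (w \<bullet> y) *\<^sub>R x)" by simp
    then have y: "y = u y *\<^sub>R e1 + v y *\<^sub>R e2 + t *\<^sub>R x"
      using \<open>D \<noteq> 0\<close> by (simp add: u_def v_def t_def scaleR_add_right)
    then have "y \<bullet> x = (u y *\<^sub>R e1 + v y *\<^sub>R e2 + t *\<^sub>R x) \<bullet> x" by simp
    then have "y \<bullet> x = t" using orth xx by (simp add: inner_add_left)
    then show ?thesis using y by simp
  qed
  define m where "m a b = a *\<^sub>R e1 + b *\<^sub>R e2" for a b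
  define \<Theta> where "\<Theta> p = m (fst p) (snd p) + sqrt (1 - (norm (m (fst p) (snd p)))\<^sup>2) *\<^sub>R x" for p
  \<comment> \<open>With coordinates below \<open>R\<close> the tangential part has norm less than
    1, so the square root in \<open>\<Theta>\<close> is positive.\<close>
  define R where "R = 1 / (norm e1 + norm e2 + 1)"
  have R: "0 < R" by (simp add: R_def add_nonneg_pos)
  have mx: "m a b \<bullet> x = 0" "x \<bullet> m a b = 0" for a b using orth by (simp_all add: m_def inner_add_left inner_commute inner_add_right)
  have nrm: "(norm (m a b + c *\<^sub>R x))\<^sup>2 = (norm (m a b))\<^sup>2 + c\<^sup>2" for a b c
    using xx mx by (simp only: power2_norm_eq_inner inner_add_left inner_add_right inner_scaleR_left inner_scaleR_right) (simp add: power2_eq_square)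
  have small: "(norm (m a b))\<^sup>2 < 1" if "\<bar>a\<bar> < R" "\<bar>b\<bar> < R" for a b
  proof -
    have "norm (m a b) \<le> \<bar>a\<bar> * norm e1 + \<bar>b\<bar> * norm e2" unfolding m_def by (metis norm_scaleR norm_triangle_ineq)
    also have "\<dots> \<le> R * norm e1 + R * norm e2" using that by (intro add_mono mult_right_mono) auto
    also have "\<dots> < R * (norm e1 + norm e2 + 1)" using R by (simp add: algebra_simps)
    also have "\<dots> = 1" by (simp add: R_def add_nonneg_pos less_imp_neq[symmetric])
    finally show ?thesis by (simp add: abs_square_less_1)
  qed
  have "sphere_chart x u v \<Theta> R"
  proof (rule sphere_chart.intro)
    fix a b :: real assume ab: "\<bar>a\<bar> < R" "\<bar>b\<bar> < R"
    define c where "c = sqrt (1 - (norm (m a b))\<^sup>2)"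
    have c: "0 < c" "c\<^sup>2 = 1 - (norm (m a b))\<^sup>2" using small[OF ab] by (simp_all add: c_def)
    have th: "\<Theta> (a, b) = m a b + c *\<^sub>R x" by (simp add: \<Theta>_def c_def)
    have "(norm (\<Theta> (a, b)))\<^sup>2 = 1" using nrm[of a b c] c th by simp
    then have "norm (\<Theta> (a, b)) = 1" by (simp add: abs_square_eq_1 power2_eq_1_iff)
    moreover have "0 < \<Theta> (a, b) \<bullet> x" using c th mx xx by (simp add: inner_add_left)
    moreover have "u (\<Theta> (a, b)) = a" "v (\<Theta> (a, b)) = b"
      using lin ue unfolding th m_def by (simp_all add: linear_simps)
    ultimately show "norm (\<Theta> (a, b)) = 1 \<and> 0 < \<Theta> (a, b) \<bullet> x \<and> u (\<Theta> (a, b)) = a \<and> v (\<Theta> (a, b)) = b" by blast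
  next
    fix y assume y: "norm y = 1" "0 < y \<bullet> x" "\<bar>u y\<bar> < R" "\<bar>v y\<bar> < R"
    have ym: "y = m (u y) (v y) + (y \<bullet> x) *\<^sub>R x" using decomp[of y] by (simp add: m_def)
    then have "1 = (norm (m (u y) (v y)))\<^sup>2 + (y \<bullet> x)\<^sup>2" using nrm[of "u y" "v y" "y \<bullet> x"] y(1) by simp
    then have "sqrt (1 - (norm (m (u y) (v y)))\<^sup>2) = y \<bullet> x" using y(2) by (intro real_sqrt_unique) auto
    then show "\<Theta> (u y, v y) = y" using ym by (simp add: \<Theta>_def)
  next
    show "continuous_on {p. \<bar>fst p\<bar> < R \<and> \<bar>snd p\<bar> < R} \<Theta>"
      unfolding \<Theta>_def m_def by (intro continuous_intros)
  qed (use x lin ue R in auto)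
  then show ?thesis using ue by blast
qed

text \<open>Within one period, the parameters not close to the fibre of \<open>x\<close> form a
  compact set whose image avoids \<open>x\<close>. Periodicity transfers the conclusion to all
  parameters.\<close>

lemma periodic_localise:
  fixes f :: "real \<Rightarrow> 'a::metric_space"
  assumes cont: "continuous_on UNIV f" and per: "\<And>s. f (s + 1) = f s" and d: "0 < d"
  shows "\<exists>W. open W \<and> x \<in> W \<and> (\<forall>s. f s \<in> W \<longrightarrow> (\<exists>t. f t = x \<and> \<bar>s - t\<bar> < d))"
proof -
  define A where "A = (\<Union>t\<in>{t. f t = x}. ball t d)"
  have "compact ({0..1} - A)" unfolding A_def by (intro compact_diff) auto
  then have "compact (f ` ({0..1} - A))"
    by (intro compact_continuous_image continuous_on_subset[OF cont]) auto
  then have "open (- (f ` ({0..1} - A)))" by (simp add: compact_imp_closed open_Compl)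
  moreover have "x \<notin> f ` ({0..1} - A)" using d by (auto simp: A_def)
  moreover have "\<exists>t. f t = x \<and> \<bar>s - t\<bar> < d" if "f s \<notin> f ` ({0..1} - A)" for s
  proof -
    have "f (frac s) = f s" by (rule periodic_frac[of f, OF per])
    moreover have "frac s \<in> {0..1}" by (simp add: frac_lt_1 less_imp_le)
    ultimately have "frac s \<in> A" using that by (metis DiffI imageI)
    then obtain t where t: "f t = x" "\<bar>frac s - t\<bar> < d" by (auto simp: A_def dist_real_def abs_minus_commute)
    have "f (t + of_int \<lfloor>s\<rfloor>) = x" using periodic_shift_int[of f t "\<lfloor>s\<rfloor>", OF per] t(1) by simp
    moreover have "\<bar>s - (t + of_int \<lfloor>s\<rfloor>)\<bar> < d" using t(2) by (simp add: frac_def algebra_simps)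
    ultimately show ?thesis by blast
  qed
  ultimately show ?thesis by (intro exI[of _ "- (f ` ({0..1} - A))"]) auto
qed

section \<open>Charts of a diagram\<close>

text \<open>\<open>A\<close> and \<open>B\<close> are the two sides of an arc \<open>C\<close> in
  \<open>W\<close>. The closure clause makes both sides visible from every point of the arc, so that
  the colours of both can be read off there.\<close>

definition splits :: "(real^3) set \<Rightarrow> (real^3) set \<Rightarrow> (real^3) set \<Rightarrow> (real^3) set \<Rightarrow> bool" where
  "splits W C A B \<longleftrightarrow> openin (top_of_set S2) A \<and> openin (top_of_set S2) B \<and> connected A \<and> connected B \<and>
     A \<inter> B = {} \<and> W - C = A \<union> B \<and> (\<forall>y\<in>W \<inter> C. y \<in> closure A \<and> y \<in> closure B)"

lemma (in sphere_chart) splits_graph: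
  assumes r: "0 < r" "r \<le> R" and graph: "chart_graph x u v r C \<phi>"
  shows "splits (box r) C {y \<in> box r. \<phi> (u y) < v y} {y \<in> box r. v y < \<phi> (u y)}"
proof -
  have \<phi>: "continuous_on {-r<..<r} \<phi>" "\<And>a. \<bar>a\<bar> < r \<Longrightarrow> \<bar>\<phi> a\<bar> \<le> \<bar>a\<bar> / 2"
    and C: "\<And>y. y \<in> box r \<Longrightarrow> y \<in> C \<longleftrightarrow> v y = \<phi> (u y)"
    using graph unfolding chart_graph_def by auto
  note up = upper_graph[OF r \<phi>]
  have \<phi>': "continuous_on {-r<..<r} (\<lambda>a. - \<phi> a)" "\<And>a. \<bar>a\<bar> < r \<Longrightarrow> \<bar>- \<phi> a\<bar> \<le> \<bar>a\<bar> / 2"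
    using \<phi> by (auto intro: continuous_intros)
  have bx: "chart_box x u (\<lambda>y. - v y) r = box r" by (simp add: chart_box_def)
  note dn = sphere_chart.upper_graph[OF flipped r \<phi>']
  have U: "upper r \<phi> = {y \<in> box r. \<phi> (u y) < v y}" by (simp add: upper_def)
  have L: "sphere_chart.upper x u (\<lambda>y. - v y) r (\<lambda>a. - \<phi> a) = {y \<in> box r. v y < \<phi> (u y)}"
    by (simp add: sphere_chart.upper_def[OF flipped] bx)
  have "y \<in> closure {y \<in> box r. \<phi> (u y) < v y} \<and> y \<in> closure {y \<in> box r. v y < \<phi> (u y)}"
    if "y \<in> box r \<inter> C" for y
    using up(3)[of y] dn(3)[of y] that C[of y] unfolding U L bx by simp
  moreover have "box r - C = {y \<in> box r. \<phi> (u y) < v y} \<union> {y \<in> box r. v y < \<phi> (u y)}"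
    using C by auto
  ultimately show ?thesis
    unfolding splits_def using up(1,2) dn(1,2) unfolding U L by auto
qed

locale diagram_lift =
  fixes D :: link_diagram and h :: "nat \<Rightarrow> real \<Rightarrow> real"
  assumes diagram: "is_diagram D" and ncomps_pos: "0 < ncomps D"
    and h_cont: "\<And>i. i < ncomps D \<Longrightarrow> continuous_on UNIV (h i)"
    and h_periodic: "\<And>i s. i < ncomps D \<Longrightarrow> h i (s + 1) = h i s"
    and h_bounds: "\<And>i s. i < ncomps D \<Longrightarrow> -1 < h i s \<and> h i s < 1"
    and h_over: "\<And>i s j t. meet D i s j t \<Longrightarrow> over D i s \<Longrightarrow> h j t < h i s"
begin

lemma strand_facts:
  assumes "i < ncomps D"
  shows "norm (strand D i s) = 1" "strand D i (s + 1) = strand D i s"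
    "strand D i C1_differentiable_on UNIV" "vector_derivative (strand D i) (at s) \<noteq> 0"
    "over D i (s + 1) = over D i s"
  using diagram assms unfolding is_diagram_def by (auto simp: image_subset_iff)

sublocale height_curves "ncomps D" "strand D" h
proof
  show "continuous_on UNIV (strand D i)" if "i < ncomps D" for i
    using strand_facts(3)[OF that] by (rule C1_differentiable_imp_continuous_on)
qed (use ncomps_pos strand_facts h_cont h_periodic h_bounds in auto)

lemma tangent:
  assumes "i < ncomps D"
  shows "vector_derivative (strand D i) (at s) \<bullet> strand D i s = 0"
proof -
  let ?f = "strand D i" and ?f' = "vector_derivative (strand D i) (at s)"
  have d: "(?f has_vector_derivative ?f') (at s)"
    using strand_facts(3)[OF assms] unfolding C1_differentiable_on_eq by (auto simp: vector_derivative_works)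
  have "((\<lambda>s. ?f s \<bullet> ?f s) has_vector_derivative (?f s \<bullet> ?f' + ?f' \<bullet> ?f s)) (at s)"
    by (rule bounded_bilinear.has_vector_derivative[OF bounded_bilinear_inner d d])
  moreover have "(\<lambda>s. ?f s \<bullet> ?f s) = (\<lambda>s. 1)" using strand_facts(1)[OF assms] by (simp add: norm_eq_1)
  ultimately have "((\<lambda>s. 1::real) has_vector_derivative (?f s \<bullet> ?f' + ?f' \<bullet> ?f s)) (at s)" by simp
  then have "?f s \<bullet> ?f' + ?f' \<bullet> ?f s = 0"
    by (metis has_vector_derivative_const vector_derivative_at)
  then show ?thesis by (simp add: inner_commute)
qed

lemma strand_shift: "i < ncomps D \<Longrightarrow> strand D i (s + of_int k) = strand D i s"
  by (rule periodic_shift_int) (rule strand_facts)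

lemma over_shift: "i < ncomps D \<Longrightarrow> over D i (s + of_int k) = over D i s"
  by (rule periodic_shift_int) (rule strand_facts)

lemma meet_sym: "meet D i s j t \<Longrightarrow> meet D j t i s"
  unfolding meet_def by (metis Ints_minus minus_diff_eq)

lemma meet_facts:
  assumes "meet D i s j t"
  shows "i < ncomps D" "j < ncomps D" "strand D i s = strand D j t" "strand D i s \<in> crossings D"
    "over D i s \<noteq> over D j t"
    "\<not> collinear {0, vector_derivative (strand D i) (at s), vector_derivative (strand D j) (at t)}"
proof -
  show "strand D i s \<in> crossings D" using assms unfolding crossings_def by blast
  show "over D i s \<noteq> over D j t"
    "\<not> collinear {0, vector_derivative (strand D i) (at s), vector_derivative (strand D j) (at t)}"
    using diagram assms unfolding is_diagram_def by blast+
qed (use assms in \<open>auto simp: meet_def\<close>)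

lemma meet_fiber:
  assumes "meet D i s j t" "k < ncomps D" "strand D k r = strand D i s"
  shows "k = i \<and> r - s \<in> \<int> \<or> k = j \<and> r - t \<in> \<int>"
proof (cases "k = i \<and> s - r \<in> \<int>")
  case True
  then show ?thesis by (metis Ints_minus minus_diff_eq)
next
  case False
  then have "meet D i s k r" using assms meet_facts(1)[OF assms(1)] by (auto simp: meet_def)
  then have "j = k \<and> t - r \<in> \<int>" using diagram assms(1) unfolding is_diagram_def by blast
  then show ?thesis by (metis Ints_minus minus_diff_eq)
qed

lemma noncrossing_fiber:
  assumes "i < ncomps D" "strand D i s \<notin> crossings D" "k < ncomps D" "strand D k r = strand D i s"
  shows "k = i \<and> r - s \<in> \<int>"
proof (rule ccontr)
  assume "\<not> ?thesis"
  then have "meet D k r i s" using assms by (simp add: meet_def)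
  then show False using meet_facts(4) assms by metis
qed

lemma crossing_meet:
  assumes "x \<in> crossings D"
  obtains i s j t where "meet D i s j t" "over D i s" "\<not> over D j t" "x = strand D i s"
proof -
  obtain i s j t where m: "meet D i s j t" "x = strand D i s" using assms unfolding crossings_def by blast
  show thesis
  proof (cases "over D i s")
    case True
    then show thesis using that[OF m(1)] m(2) meet_facts(5)[OF m(1)] by simp
  next
    case False
    then show thesis using that[OF meet_sym[OF m(1)]] m(2) meet_facts(3,5)[OF m(1)] by simp
  qed
qed

lemma localise:
  assumes "0 < d"
  shows "\<exists>W. open W \<and> x \<in> W \<and>
    (\<forall>k s. k < ncomps D \<longrightarrow> strand D k s \<in> W \<longrightarrow> (\<exists>t. strand D k t = x \<and> \<bar>s - t\<bar> < d))"
proof -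
  have "\<exists>W. open W \<and> x \<in> W \<and> (\<forall>s. strand D k s \<in> W \<longrightarrow> (\<exists>t. strand D k t = x \<and> \<bar>s - t\<bar> < d))"
    if "k < ncomps D" for k
    by (rule periodic_localise[OF curve_cont[OF that] curve_periodic[OF that] assms])
  then obtain W where W: "\<forall>k<ncomps D. open (W k) \<and> x \<in> W k \<and>
      (\<forall>s. strand D k s \<in> W k \<longrightarrow> (\<exists>t. strand D k t = x \<and> \<bar>s - t\<bar> < d))"
    by metis
  show ?thesis
  proof (intro exI[of _ "\<Inter>k<ncomps D. W k"] conjI allI impI)
    show "open (\<Inter>k<ncomps D. W k)" using W by (intro open_INT) auto
    show "x \<in> (\<Inter>k<ncomps D. W k)" using W by auto
    fix k s assume "k < ncomps D" "strand D k s \<in> (\<Inter>k<ncomps D. W k)"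
    then show "\<exists>t. strand D k t = x \<and> \<bar>s - t\<bar> < d" using W by auto
  qed
qed

lemma strand_near:
  assumes "i < ncomps D" "openin (top_of_set S2) W" "strand D i s0 \<in> W"
  obtains d where "0 < d" "\<forall>s. \<bar>s - s0\<bar> < d \<longrightarrow> strand D i s \<in> W"
proof -
  obtain V where V: "open V" "W = S2 \<inter> V" using assms(2) by (auto simp: openin_open)
  have "open (strand D i -` V)" using curve_cont[OF assms(1)] V(1) by (simp add: continuous_on_open_vimage)
  moreover have "s0 \<in> strand D i -` V" using assms V by auto
  ultimately obtain d where d: "0 < d" "ball s0 d \<subseteq> strand D i -` V" by (metis open_contains_ball)
  have "strand D i s \<in> W" if "\<bar>s - s0\<bar> < d" for s
  proof -
    have "s \<in> ball s0 d" using that by (simp add: dist_real_def abs_minus_commute)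
    then show ?thesis using d(2) V(2) strand_facts(1)[OF assms(1)] by auto
  qed
  then show thesis using that d(1) by blast
qed

text \<open>The fibre of a point that is no crossing is one parameter modulo 1, and parameters
  landing in a small box are close to the fibre. So the box meets a single branch, which is a
  graph.\<close>

lemma edge_chart:
  assumes i: "i < ncomps D" and nc: "strand D i s0 \<notin> crossings D"
  shows "\<exists>W A B d. 0 < d \<and> openin (top_of_set S2) W \<and> strand D i s0 \<in> W \<and> splits W P A B \<and>
    (\<forall>s. \<bar>s - s0\<bar> < d \<longrightarrow> strand D i s \<in> W)"
proof -
  let ?x = "strand D i s0"
  define e1 where "e1 = vector_derivative (strand D i) (at s0)"
  have x: "norm ?x = 1" and e1: "e1 \<noteq> 0" "e1 \<bullet> ?x = 0"
    using strand_facts[OF i] tangent[OF i] by (simp_all add: e1_def)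
  \<comment> \<open>The chart needs a second tangent direction; the cross product of the position
    with the velocity supplies the one perpendicular to the strand.\<close>
  have "cross3 e1 (cross3 ?x e1) = (e1 \<bullet> e1) *\<^sub>R ?x" using e1(2) by (simp add: Lagrange)
  then have "cross3 e1 (cross3 ?x e1) \<noteq> 0" using x e1(1) by auto
  then have "\<not> collinear {0, e1, cross3 ?x e1}" by (simp add: cross_eq_0)
  moreover have "cross3 ?x e1 \<bullet> ?x = 0" by (simp add: inner_commute dot_cross_self)
  ultimately obtain u v \<Theta> R where chart: "sphere_chart ?x u v \<Theta> R" and uv: "u e1 = 1" "v e1 = 0"
    using sphere_chart_exists[OF x e1(2)] by blast
  interpret ch: sphere_chart ?x u v \<Theta> R by (rule chart)
  have f1: "u (vector_derivative (strand D i) (at s0)) = 1" "v (vector_derivative (strand D i) (at s0)) = 0"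
    using uv by (simp_all add: e1_def)
  obtain d where d: "0 < d" and br: "\<forall>d'. 0 < d' \<longrightarrow> d' \<le> d \<longrightarrow> (\<exists>r1>0. \<forall>r. 0 < r \<longrightarrow> r \<le> r1 \<longrightarrow> r \<le> R \<longrightarrow>
       (\<exists>\<phi>. chart_graph ?x u v r (strand D i ` {s0-d'<..<s0+d'}) \<phi>))"
    by (rule ch.branch[OF strand_facts(3)[OF i] strand_facts(1)[OF i] refl f1])
  obtain r1 where r1: "0 < r1" "\<forall>r. 0 < r \<longrightarrow> r \<le> r1 \<longrightarrow> r \<le> R \<longrightarrow>
       (\<exists>\<phi>. chart_graph ?x u v r (strand D i ` {s0-d<..<s0+d}) \<phi>)"
    using br[rule_format, OF d order_refl] by blast
  obtain W where W: "open W" "?x \<in> W"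
    "\<forall>k s. k < ncomps D \<longrightarrow> strand D k s \<in> W \<longrightarrow> (\<exists>t. strand D k t = ?x \<and> \<bar>s - t\<bar> < d)"
    using localise[OF d] by blast
  obtain rb where rb: "0 < rb" "rb \<le> R" "ch.box rb \<subseteq> W" by (rule ch.box_basis[OF W(1,2)])
  define r where "r = min rb r1"
  have r: "0 < r" "r \<le> r1" "r \<le> R" "ch.box r \<subseteq> W"
    using rb r1 ch.box_mono[of r rb] by (auto simp: r_def)
  obtain \<phi> where \<phi>: "chart_graph ?x u v r (strand D i ` {s0-d<..<s0+d}) \<phi>"
    using r1(2) r by blast
  have P: "y \<in> P \<longleftrightarrow> y \<in> strand D i ` {s0-d<..<s0+d}" if y: "y \<in> ch.box r" for y
  proof -
    have "y \<in> strand D i ` {s0-d<..<s0+d}" if "y \<in> P"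
    proof -
      obtain k s where ks: "k < ncomps D" "y = strand D k s" using \<open>y \<in> P\<close> by (auto simp: P_def)
      then obtain t where t: "strand D k t = ?x" "\<bar>s - t\<bar> < d" using W(3) r(4) y by blast
      then have "k = i" "t - s0 \<in> \<int>" using noncrossing_fiber[OF i nc ks(1)] by auto
      then obtain m where m: "t - s0 = of_int m" by (auto elim: Ints_cases)
      have "y = strand D i (s + of_int (- m))" using strand_shift[OF i, of s "-m"] ks \<open>k = i\<close> by simp
      moreover have "s + of_int (- m) \<in> {s0-d<..<s0+d}" using m t(2) by (auto simp: abs_less_iff)
      ultimately show ?thesis by blast
    qed
    moreover have "y \<in> P" if "y \<in> strand D i ` {s0-d<..<s0+d}" using that i by (auto simp: P_def)
    ultimately show ?thesis by blast
  qed
  have graph: "chart_graph ?x u v r P \<phi>" using \<phi> P unfolding chart_graph_def by simp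
  obtain d' where d': "0 < d'" "\<forall>s. \<bar>s - s0\<bar> < d' \<longrightarrow> strand D i s \<in> ch.box r"
    by (rule strand_near[OF i ch.box_openin ch.x_in_box[OF r(1)]])
  show ?thesis
    by (intro exI conjI) (rule d' ch.splits_graph[OF r(1,3) graph] ch.box_openin ch.x_in_box[OF r(1)])+
qed

text \<open>\<open>A\<close>, \<open>B\<close> are the sides of the first strand and
  \<open>A'\<close>, \<open>B'\<close> those of the second, so the four local faces are the
  intersections of a side of one with a side of the other. The last clauses tie the sides to the
  direction of travel: each strand arrives from the \<open>B\<close> side of the other and leaves
  into its \<open>A\<close> side.\<close>

definition crossing_chart where
  "crossing_chart i s0 j t0 d W A B A' B' \<longleftrightarrow>
     openin (top_of_set S2) W \<and> strand D i s0 \<in> W \<and> connected (W - {strand D i s0}) \<and>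
     splits W (strand D i ` {s0-d<..<s0+d}) A B \<and> splits W (strand D j ` {t0-d<..<t0+d}) A' B' \<and>
     (\<forall>k s. k < ncomps D \<longrightarrow> strand D k s \<in> W \<longrightarrow>
        (\<exists>m::int. k = i \<and> \<bar>s - of_int m - s0\<bar> < d \<or> k = j \<and> \<bar>s - of_int m - t0\<bar> < d)) \<and>
     (\<forall>s. strand D i s \<in> W \<longrightarrow> (s0 < s \<longrightarrow> s < s0 + d \<longrightarrow> strand D i s \<in> A') \<and>
        (s0 - d < s \<longrightarrow> s < s0 \<longrightarrow> strand D i s \<in> B')) \<and>
     (\<forall>t. strand D j t \<in> W \<longrightarrow> (t0 < t \<longrightarrow> t < t0 + d \<longrightarrow> strand D j t \<in> A) \<and>
        (t0 - d < t \<longrightarrow> t < t0 \<longrightarrow> strand D j t \<in> B))"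

lemma crossing_chart_exists:
  assumes m: "meet D i s0 j t0" and V: "open V" "strand D i s0 \<in> V" and eps: "0 < eps"
  shows "\<exists>d W A B A' B'. 0 < d \<and> d < eps \<and> W \<subseteq> V \<and> crossing_chart i s0 j t0 d W A B A' B'"
proof -
  note mf = meet_facts[OF m]
  note i = mf(1) and j = mf(2)
  let ?x = "strand D i s0"
  define e1 where "e1 = vector_derivative (strand D i) (at s0)"
  define e2 where "e2 = vector_derivative (strand D j) (at t0)"
  have x: "norm ?x = 1" and e: "e1 \<bullet> ?x = 0" "e2 \<bullet> ?x = 0" "\<not> collinear {0, e1, e2}"
    unfolding e1_def e2_def by (fact strand_facts(1)[OF i] tangent[OF i] tangent[OF j, of t0, folded mf(3)] mf(6))+
  obtain u v \<Theta> R where chart: "sphere_chart ?x u v \<Theta> R"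
    and uv: "u e1 = 1" "u e2 = 0" "v e1 = 0" "v e2 = 1"
    using sphere_chart_exists[OF x e] by blast
  interpret ch: sphere_chart ?x u v \<Theta> R by (rule chart)
  interpret sw: sphere_chart ?x v u "\<lambda>p. \<Theta> (snd p, fst p)" R by (rule ch.swapped)
  have bx: "chart_box ?x v u r = chart_box ?x u v r" for r by (auto simp: chart_box_def)
  have f1: "u (vector_derivative (strand D i) (at s0)) = 1" "v (vector_derivative (strand D i) (at s0)) = 0"
    and f2: "v (vector_derivative (strand D j) (at t0)) = 1" "u (vector_derivative (strand D j) (at t0)) = 0"
    using uv by (simp_all add: e1_def e2_def)
  obtain d1 where d1: "0 < d1" and pos1: "\<forall>s. s0 < s \<longrightarrow> s < s0 + d1 \<longrightarrow> 0 < u (strand D i s) \<and> \<bar>v (strand D i s)\<bar> \<le> u (strand D i s) / 2"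
    and neg1: "\<forall>s. s0 - d1 < s \<longrightarrow> s < s0 \<longrightarrow> u (strand D i s) < 0 \<and> \<bar>v (strand D i s)\<bar> \<le> - u (strand D i s) / 2"
    and br1: "\<forall>d. 0 < d \<longrightarrow> d \<le> d1 \<longrightarrow> (\<exists>r1>0. \<forall>r. 0 < r \<longrightarrow> r \<le> r1 \<longrightarrow> r \<le> R \<longrightarrow>
       (\<exists>\<phi>. chart_graph ?x u v r (strand D i ` {s0-d<..<s0+d}) \<phi>))"
    by (rule ch.branch[OF strand_facts(3)[OF i] strand_facts(1)[OF i] refl f1])
  obtain d2 where d2: "0 < d2" and pos2: "\<forall>s. t0 < s \<longrightarrow> s < t0 + d2 \<longrightarrow> 0 < v (strand D j s) \<and> \<bar>u (strand D j s)\<bar> \<le> v (strand D j s) / 2"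
    and neg2: "\<forall>s. t0 - d2 < s \<longrightarrow> s < t0 \<longrightarrow> v (strand D j s) < 0 \<and> \<bar>u (strand D j s)\<bar> \<le> - v (strand D j s) / 2"
    and br2: "\<forall>d. 0 < d \<longrightarrow> d \<le> d2 \<longrightarrow> (\<exists>r1>0. \<forall>r. 0 < r \<longrightarrow> r \<le> r1 \<longrightarrow> r \<le> R \<longrightarrow>
       (\<exists>\<phi>. chart_graph ?x v u r (strand D j ` {t0-d<..<t0+d}) \<phi>))"
    by (rule sw.branch[OF strand_facts(3)[OF j] strand_facts(1)[OF j] mf(3)[symmetric] f2])
  define d where "d = min (min d1 d2) (eps / 2)"
  have d: "0 < d" "d \<le> d1" "d \<le> d2" "d < eps" using d1 d2 eps by (auto simp: d_def)
  obtain r1 where r1: "0 < r1" "\<forall>r. 0 < r \<longrightarrow> r \<le> r1 \<longrightarrow> r \<le> R \<longrightarrow>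
       (\<exists>\<phi>. chart_graph ?x u v r (strand D i ` {s0-d<..<s0+d}) \<phi>)"
    using br1[rule_format, OF d(1) d(2)] by blast
  obtain r2 where r2: "0 < r2" "\<forall>r. 0 < r \<longrightarrow> r \<le> r2 \<longrightarrow> r \<le> R \<longrightarrow>
       (\<exists>\<phi>. chart_graph ?x v u r (strand D j ` {t0-d<..<t0+d}) \<phi>)"
    using br2[rule_format, OF d(1) d(3)] by blast
  obtain W where W: "open W" "?x \<in> W"
    "\<forall>k s. k < ncomps D \<longrightarrow> strand D k s \<in> W \<longrightarrow> (\<exists>t. strand D k t = ?x \<and> \<bar>s - t\<bar> < d)"
    using localise[OF d(1)] by blast
  obtain rb where rb: "0 < rb" "rb \<le> R" "ch.box rb \<subseteq> W \<inter> V"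
    by (rule ch.box_basis[of "W \<inter> V"]) (use W V in auto)
  define r where "r = min rb (min r1 r2)"
  have r: "0 < r" "r \<le> r1" "r \<le> r2" "r \<le> R" "ch.box r \<subseteq> W \<inter> V"
    using rb r1 r2 ch.box_mono[of r rb] by (auto simp: r_def)
  obtain \<phi> where \<phi>: "chart_graph ?x u v r (strand D i ` {s0-d<..<s0+d}) \<phi>"
    using r1(2) r by blast
  obtain \<psi> where \<psi>: "chart_graph ?x v u r (strand D j ` {t0-d<..<t0+d}) \<psi>"
    using r2(2) r by blast
  have bd: "\<bar>u y\<bar> < r \<and> \<bar>v y\<bar> < r" if "y \<in> ch.box r" for y using that by (simp add: chart_box_def)
  let ?A = "{y \<in> ch.box r. \<phi> (u y) < v y}" and ?B = "{y \<in> ch.box r. v y < \<phi> (u y)}"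
  let ?A' = "{y \<in> ch.box r. \<psi> (v y) < u y}" and ?B' = "{y \<in> ch.box r. u y < \<psi> (v y)}"
  have loc: "\<exists>m::int. k = i \<and> \<bar>s - of_int m - s0\<bar> < d \<or> k = j \<and> \<bar>s - of_int m - t0\<bar> < d"
    if k: "k < ncomps D" "strand D k s \<in> ch.box r" for k s
  proof -
    obtain t where t: "strand D k t = ?x" "\<bar>s - t\<bar> < d" using W(3) r(5) k by blast
    from meet_fiber[OF m k(1) t(1)] consider m where "k = i" "t - s0 = of_int m" | m where "k = j" "t - t0 = of_int m"
      by (auto elim!: Ints_cases)
    then show ?thesis
    proof cases
      case (1 m) then show ?thesis using t(2) by (intro exI[of _ m]) (auto simp: abs_less_iff)
    next
      case (2 m) then show ?thesis using t(2) by (intro exI[of _ m]) (auto simp: abs_less_iff)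
    qed
  qed
  have sp1: "splits (ch.box r) (strand D i ` {s0-d<..<s0+d}) ?A ?B"
    by (rule ch.splits_graph[OF r(1,4) \<phi>])
  have sp2: "splits (ch.box r) (strand D j ` {t0-d<..<t0+d}) ?A' ?B'"
    by (rule sw.splits_graph[OF r(1,4) \<psi>, unfolded bx])
  \<comment> \<open>Each strand stays in a cone of slope 1/2 around its own axis, so off the centre
    it lies strictly on one side of the graph of the other.\<close>
  have q1: "\<bar>\<psi> (v y)\<bar> \<le> \<bar>v y\<bar> / 2" "\<bar>\<phi> (u y)\<bar> \<le> \<bar>u y\<bar> / 2" if "y \<in> ch.box r" for y
    using bd[OF that] \<phi> \<psi> unfolding chart_graph_def by blast+
  have en: "(strand D i s \<in> ch.box r \<longrightarrow> (s0 < s \<longrightarrow> s < s0 + d \<longrightarrow> strand D i s \<in> ?A') \<and>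
        (s0 - d < s \<longrightarrow> s < s0 \<longrightarrow> strand D i s \<in> ?B'))" for s
    using pos1[rule_format, of s] neg1[rule_format, of s] q1(1)[of "strand D i s"] d by auto
  have en': "(strand D j t \<in> ch.box r \<longrightarrow> (t0 < t \<longrightarrow> t < t0 + d \<longrightarrow> strand D j t \<in> ?A) \<and>
        (t0 - d < t \<longrightarrow> t < t0 \<longrightarrow> strand D j t \<in> ?B))" for t
    using pos2[rule_format, of t] neg2[rule_format, of t] q1(2)[of "strand D j t"] d by auto
  have "crossing_chart i s0 j t0 d (ch.box r) ?A ?B ?A' ?B'"
    unfolding crossing_chart_def
    by (intro conjI ch.box_openin ch.x_in_box[OF r(1)] ch.box_punctured_connected[OF r(4,1)] sp1 sp2)
      (intro allI impI loc, assumption+, intro allI en, intro allI en')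
  then show ?thesis using d r(5) by (intro exI conjI) auto
qed

end

section \<open>The face colouring of a cocycle\<close>

lemma add_diff_add_cancel: "(p + q) - (r + q) = p - (r::'g::group_add)"
  by (simp only: diff_conv_add_uminus minus_add add.assoc add_minus_cancel)

text \<open>The sum is the value that \<open>f\<close> would take at \<open>m\<close> if it were
  continued there inside the cocycle set. In this way primitives on different regions can be
  compared at a point that need not lie in either.\<close>

lemma primitive_plus_loc_const:
  assumes f: "primitive Y t f" and coc: "cocycle_on (W \<inter> X) t" and "Y \<subseteq> X" and m: "m \<in> W \<inter> X"
  shows "loc_const (Y \<inter> W) (\<lambda>z. f z + t z m)"
  unfolding loc_const_def
proof
  fix z assume z: "z \<in> Y \<inter> W"
  then have "z \<in> Y" by blast
  obtain V where V[rule_format]: "open V" "z \<in> V" "\<forall>a b. a \<in> V \<longrightarrow> a \<in> Y \<longrightarrow> b \<in> V \<longrightarrow> b \<in> Y \<longrightarrow> t a b = - f a + f b"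
    by (rule primitiveE[OF f \<open>z \<in> Y\<close>])
  have "f y + t y m = f z + t z m" if "y \<in> V \<inter> (Y \<inter> W)" for y
  proof -
    have "y \<in> X" "z \<in> X" using that z assms(3) by auto
    then have "t y m = t y z + t z m" using cocycle_onD[OF coc, of y z m] that z m by simp
    also have "t y z = - f y + f z" using V(3)[of y z] V(2) that z by auto
    finally show ?thesis by (simp only: add.assoc add_minus_cancel)
  qed
  then show "\<exists>V. open V \<and> z \<in> V \<and> (\<forall>y\<in>V \<inter> (Y \<inter> W). f y + t y m = f z + t z m)"
    by (intro exI[of _ V] conjI V(1,2) ballI)
qed

text \<open>The colours of the faces that touch a given point.\<close>

definition vals :: "(real^3) set \<Rightarrow> (real^3 \<Rightarrow> 'g) \<Rightarrow> real^3 \<Rightarrow> 'g set" where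
  "vals P c x = {g. \<forall>W. openin (top_of_set S2) W \<longrightarrow> x \<in> W \<longrightarrow> (\<exists>y\<in>W - P. c y = g)}"

lemma vals_subset:
  assumes "openin (top_of_set S2) W" "y \<in> W" "\<And>z. z \<in> W - P \<Longrightarrow> c z \<in> E"
  shows "vals P c y \<subseteq> E"
proof
  fix g assume "g \<in> vals P c y"
  then obtain z where "z \<in> W - P" "c z = g" using assms(1,2) unfolding vals_def by blast
  then show "g \<in> E" using assms(3) by blast
qed

lemma vals_closure:
  assumes W: "openin (top_of_set S2) W" "y \<in> W" and A: "A \<subseteq> S2" "y \<in> closure A"
    and off: "W \<inter> A \<inter> P = {}" and c: "\<And>z. z \<in> W \<Longrightarrow> z \<in> A \<Longrightarrow> c z = a"
  shows "a \<in> vals P c y"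
  unfolding vals_def
proof (intro CollectI allI impI)
  fix V assume V: "openin (top_of_set S2) V" "y \<in> V"
  obtain W' where W': "open W'" "W = S2 \<inter> W'" using W(1) by (auto simp: openin_open)
  obtain V' where V': "open V'" "V = S2 \<inter> V'" using V(1) by (auto simp: openin_open)
  have "y \<in> (W' \<inter> V') \<inter> closure A" using W(2) V(2) W'(2) V'(2) A(2) by blast
  then have "(W' \<inter> V') \<inter> A \<noteq> {}" using open_Int_closure_eq_empty[OF open_Int[OF W'(1) V'(1)], of A] by blast
  then obtain z where z: "z \<in> W'" "z \<in> V'" "z \<in> A" by blast
  then have "z \<in> W" "z \<in> V" using A(1) W'(2) V'(2) by auto
  then show "\<exists>z\<in>V - P. c z = a" using off c z(3) by blast
qed

lemma vals_meets:
  assumes "g \<in> vals P c y" "openin (top_of_set S2) W" "y \<in> W"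
  shows "\<exists>z\<in>W - P. c z = g"
  using assms unfolding vals_def by blast

context diagram_lift
begin

abbreviation X where "X \<equiv> S3 - K"
abbreviation U where "U \<equiv> above (ncomps D) (strand D) h"
abbreviation V where "V \<equiv> below (ncomps D) (strand D) h"

definition transition where "transition f f' x = f (at_height x 0) - f' (at_height x 0)"

lemma h_shift: "i < ncomps D \<Longrightarrow> h i (s + of_int k) = h i s"
  by (rule periodic_shift_int) (rule h_periodic)

lemma fiber_height:
  assumes "meet D i s0 j t0" "k < ncomps D" "strand D k s = strand D i s0"
  shows "h k s = h i s0 \<or> h k s = h j t0"
proof -
  from meet_fiber[OF assms] consider m where "k = i" "s - s0 = of_int m" | m where "k = j" "s - t0 = of_int m"
    by (auto elim!: Ints_cases)
  then show ?thesis
  proof cases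
    case (1 m)
    then have "s = s0 + of_int m" by simp
    then have "h k s = h i s0" using h_shift[of i s0 m] assms(2) 1(1) by simp
    then show ?thesis ..
  next
    case (2 m)
    then have "s = t0 + of_int m" by simp
    then have "h k s = h j t0" using h_shift[of j t0 m] assms(2) 2(1) by simp
    then show ?thesis ..
  qed
qed

lemma at_height_in_K_iff:
  assumes "norm x = 1" "-1 < k" "k < 1"
  shows "at_height x k \<in> K \<longleftrightarrow> (\<exists>i s. i < ncomps D \<and> strand D i s = x \<and> h i s = k)"
proof -
  have "at_height x k = at_height (strand D i s) (h i s) \<longleftrightarrow> strand D i s = x \<and> h i s = k" if "i < ncomps D" for i s
    using at_height_eq_iff[OF assms(1) strand_facts(1)[OF that] assms(2,3)] by auto
  then have "(\<exists>i s. i < ncomps D \<and> at_height x k = at_height (strand D i s) (h i s)) \<longleftrightarrow>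
      (\<exists>i s. i < ncomps D \<and> strand D i s = x \<and> h i s = k)"
    by (simp cong: conj_cong)
  then show ?thesis unfolding K_def by auto
qed

lemma continuous_near:
  fixes f :: "real \<Rightarrow> real"
  assumes "continuous_on UNIV f" "f s0 > k"
  obtains e where "0 < e" "\<forall>s. \<bar>s - s0\<bar> < e \<longrightarrow> f s > k"
proof -
  have "open {s. f s > k}" using assms(1) by (intro open_Collect_less continuous_intros)
  then obtain e where e: "0 < e" "ball s0 e \<subseteq> {s. f s > k}" using assms(2) openE by (metis mem_Collect_eq)
  have "\<bar>s - s0\<bar> < e \<longrightarrow> f s > k" for s using e(2) by (auto simp: dist_real_def subset_iff abs_minus_commute)
  then show thesis using that e(1) by blast
qed

text \<open>At a crossing, the overpass splits the primitive above into two local branches \<open>g1\<close>, \<open>g2\<close>, the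
  underpass splits the primitive below into \<open>k1\<close>, \<open>k2\<close>, and all of them are compared at a point between
  the two strands.\<close>

lemma crossing_relation:
  assumes coc: "local_cocycle X t" and f: "primitive U t f" and f': "primitive V t f'"
    and m: "meet D i s0 j t0" and ov: "over D i s0"
  shows "\<exists>d W A B A' B' g1 g2 k1 k2. 0 < d \<and> crossing_chart i s0 j t0 d W A B A' B' \<and>
    (\<forall>y\<in>W. (y \<in> A \<longrightarrow> y \<in> A' \<longrightarrow> transition f f' y = g1 - k1) \<and> (y \<in> A \<longrightarrow> y \<in> B' \<longrightarrow> transition f f' y = g1 - k2) \<and>
       (y \<in> B \<longrightarrow> y \<in> A' \<longrightarrow> transition f f' y = g2 - k1) \<and> (y \<in> B \<longrightarrow> y \<in> B' \<longrightarrow> transition f f' y = g2 - k2))"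
proof -
  note mf = meet_facts[OF m]
  let ?x = "strand D i s0"
  \<comment> \<open>A level strictly between the two strands at the crossing; by continuity it also
    separates nearby pieces of them.\<close>
  define k where "k = (h i s0 + h j t0) / 2"
  have hk: "h j t0 < k" "k < h i s0" using h_over[OF m ov] by (simp_all add: k_def)
  have kb: "-1 < k" "k < 1" using hk h_bounds[OF mf(1), of s0] h_bounds[OF mf(2), of t0] by auto
  have x1: "norm ?x = 1" by (rule strand_facts(1)[OF mf(1)])
  define z where "z = at_height ?x k"
  have z: "z \<in> X"
  proof -
    have "z \<notin> K"
    proof
      assume "z \<in> K"
      then obtain l s where "l < ncomps D" "strand D l s = ?x" "h l s = k"
        unfolding z_def at_height_in_K_iff[OF x1 kb] by blast
      then show False using fiber_height[OF m] hk by force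
    qed
    then show ?thesis using at_height_in_S3[OF x1, of k] kb by (simp add: z_def)
  qed
  obtain W0 where W0: "open W0" "z \<in> W0" "cocycle_on (W0 \<inter> X) t" by (rule local_cocycleE[OF coc z])
  define N where "N = (\<lambda>y. at_height y k) -` W0"
  have "continuous_on UNIV (\<lambda>y. at_height y k)" by (intro continuous_at_height continuous_intros)
  then have N: "open N" "?x \<in> N" using W0(1,2) by (simp_all add: N_def z_def continuous_on_open_vimage)
  obtain e1 where e1: "0 < e1" "\<forall>s. \<bar>s - s0\<bar> < e1 \<longrightarrow> h i s > k"
    by (rule continuous_near[OF h_cont[OF mf(1)] hk(2)])
  have "continuous_on UNIV (\<lambda>s. - h j s)" "- h j t0 > - k"
    using h_cont[OF mf(2)] hk(1) by (auto intro: continuous_intros)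
  then obtain e2 where e2: "0 < e2" "\<forall>s. \<bar>s - t0\<bar> < e2 \<longrightarrow> - h j s > - k"
    by (rule continuous_near)
  have "0 < min e1 e2" using e1 e2 by simp
  then obtain d W A B A' B' where d: "0 < d" "d < min e1 e2" and WN: "W \<subseteq> N"
    and chart: "crossing_chart i s0 j t0 d W A B A' B'"
    using crossing_chart_exists[OF m N] by blast
  have sp1: "splits W (strand D i ` {s0-d<..<s0+d}) A B" and sp2: "splits W (strand D j ` {t0-d<..<t0+d}) A' B'"
    and loc: "\<And>k s. k < ncomps D \<Longrightarrow> strand D k s \<in> W \<Longrightarrow>
        \<exists>m::int. k = i \<and> \<bar>s - of_int m - s0\<bar> < d \<or> k = j \<and> \<bar>s - of_int m - t0\<bar> < d"
    and WS: "openin (top_of_set S2) W"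
    using chart unfolding crossing_chart_def by blast+
  have W1: "norm y = 1" if "y \<in> W" for y using openin_imp_subset[OF WS] that by auto
  have AB: "W - strand D i ` {s0-d<..<s0+d} = A \<union> B" "W - strand D j ` {t0-d<..<t0+d} = A' \<union> B'"
    using sp1 sp2 unfolding splits_def by simp_all
  then have AW: "A \<subseteq> W" "B \<subseteq> W" "A' \<subseteq> W" "B' \<subseteq> W" by auto
  have cases: "(y \<in> strand D i ` {s0-d<..<s0+d} \<and> k < h l s) \<or> (y \<in> strand D j ` {t0-d<..<t0+d} \<and> h l s < k)"
    if y: "y \<in> W" "l < ncomps D" "strand D l s = y" for l s y
  proof -
    obtain m' :: int where "l = i \<and> \<bar>s - of_int m' - s0\<bar> < d \<or> l = j \<and> \<bar>s - of_int m' - t0\<bar> < d"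
      using loc[OF y(2)] y by blast
    then show ?thesis
    proof
      assume a: "l = i \<and> \<bar>s - of_int m' - s0\<bar> < d"
      have "strand D i (s + of_int (- m')) = y" "h i (s + of_int (- m')) = h l s"
        using strand_shift[OF mf(1), of s "-m'"] h_shift[OF mf(1), of s "-m'"] a y by simp_all
      moreover have "s + of_int (- m') \<in> {s0-d<..<s0+d}" "k < h i (s + of_int (- m'))"
        using a d e1(2) by (auto simp: abs_less_iff)
      ultimately show ?thesis by (metis imageI)
    next
      assume a: "l = j \<and> \<bar>s - of_int m' - t0\<bar> < d"
      have "strand D j (s + of_int (- m')) = y" "h j (s + of_int (- m')) = h l s"
        using strand_shift[OF mf(2), of s "-m'"] h_shift[OF mf(2), of s "-m'"] a y by simp_all
      moreover have "s + of_int (- m') \<in> {t0-d<..<t0+d}" "h j (s + of_int (- m')) < k"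
        using a d e2(2) by (auto simp: abs_less_iff)
      ultimately show ?thesis by (metis imageI)
    qed
  qed
  \<comment> \<open>Off the overpass only the underpass can lie over \<open>y\<close>, and it is
    below level \<open>k\<close>. So on each side of the overpass the level surface is inside the
    upper region; likewise for the underpass and the lower region.\<close>
  have inU: "at_height y k \<in> U \<inter> W0" if "y \<in> A \<union> B" for y
  proof -
    have y: "y \<in> W" "y \<notin> strand D i ` {s0-d<..<s0+d}" using that AB(1) by blast+
    then show ?thesis using cases[OF y(1)] WN unfolding N_def at_height_above_iff[OF W1[OF y(1)] kb] Int_iff by blast
  qed
  have inV: "at_height y k \<in> V \<inter> W0" if "y \<in> A' \<union> B'" for y
  proof -
    have y: "y \<in> W" "y \<notin> strand D j ` {t0-d<..<t0+d}" using that AB(2) by blast+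
    then show ?thesis using cases[OF y(1)] WN unfolding N_def at_height_below_iff[OF W1[OF y(1)] kb] Int_iff by blast
  qed
  have lcU: "loc_const (A \<union> B) (\<lambda>y. f (at_height y k) + t (at_height y k) z)"
    by (rule loc_const_compose[OF primitive_plus_loc_const[OF f W0(3) above_subset]])
      (use inU z W0(2) in \<open>auto intro!: continuous_at_height continuous_intros\<close>)
  have lcV: "loc_const (A' \<union> B') (\<lambda>y. f' (at_height y k) + t (at_height y k) z)"
    by (rule loc_const_compose[OF primitive_plus_loc_const[OF f' W0(3) below_subset]])
      (use inV z W0(2) in \<open>auto intro!: continuous_at_height continuous_intros\<close>)
  have const: "\<exists>g. \<forall>y\<in>E. q y = g" if "connected E" "loc_const F q" "E \<subseteq> F" for E F and q :: "real^3 \<Rightarrow> 'b"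
    using loc_const_connected[OF that(1) loc_const_subset[OF that(2,3)]] by metis
  have con: "connected A" "connected B" "connected A'" "connected B'" using sp1 sp2 unfolding splits_def by blast+
  obtain g1 where g1: "\<forall>y\<in>A. f (at_height y k) + t (at_height y k) z = g1" using const[OF con(1) lcU] by blast
  obtain g2 where g2: "\<forall>y\<in>B. f (at_height y k) + t (at_height y k) z = g2" using const[OF con(2) lcU] by blast
  obtain k1 where k1: "\<forall>y\<in>A'. f' (at_height y k) + t (at_height y k) z = k1" using const[OF con(3) lcV] by blast
  obtain k2 where k2: "\<forall>y\<in>B'. f' (at_height y k) + t (at_height y k) z = k2" using const[OF con(4) lcV] by blast
  \<comment> \<open>The step to the reference point \<open>z\<close> is the last summand of both
    terms and cancels.\<close>
  have tr: "transition f f' y = (f (at_height y k) + t (at_height y k) z) - (f' (at_height y k) + t (at_height y k) z)"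
    if "y \<in> A \<union> B" "y \<in> A' \<union> B'" for y
  proof -
    have "y \<in> W" using that AW by blast
    have "y \<notin> P"
    proof
      assume "y \<in> P"
      then obtain l s where "l < ncomps D" "strand D l s = y" by (auto simp: P_def)
      then have "y \<in> strand D i ` {s0-d<..<s0+d} \<or> y \<in> strand D j ` {t0-d<..<t0+d}"
        using cases[OF \<open>y \<in> W\<close>] by blast
      then show False using that AB by blast
    qed
    then have "y \<in> S2 - P" using W1[OF \<open>y \<in> W\<close>] by simp
    then show ?thesis unfolding add_diff_add_cancel transition_def using transition_loc_const(2)[OF f f' _ kb] by simp
  qed
  show ?thesis
    by (rule exI[of _ d], rule exI[of _ W], rule exI[of _ A], rule exI[of _ B], rule exI[of _ A'], rule exI[of _ B'],
        rule exI[of _ g1], rule exI[of _ g2], rule exI[of _ k1], rule exI[of _ k2])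
      (use d(1) chart tr g1 g2 k1 k2 in auto)
qed

end

lemma vals_pair:
  assumes E: "openin (top_of_set S2) E" "y \<in> E" and S: "A \<subseteq> S2" "B \<subseteq> S2" and cl: "y \<in> closure A" "y \<in> closure B"
    and sub: "E - P \<subseteq> A \<union> B" and off: "E \<inter> A \<inter> P = {}" "E \<inter> B \<inter> P = {}"
    and c: "\<And>z. z \<in> E \<Longrightarrow> z \<in> A \<Longrightarrow> c z = a" "\<And>z. z \<in> E \<Longrightarrow> z \<in> B \<Longrightarrow> c z = b"
  shows "vals P c y = {a, b}"
proof
  show "vals P c y \<subseteq> {a, b}"
    by (rule vals_subset[OF E]) (use sub c in blast)
  show "{a, b} \<subseteq> vals P c y"
    using vals_closure[OF E S(1) cl(1) off(1) c(1)] vals_closure[OF E S(2) cl(2) off(2) c(2)] by simp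
qed

lemma splitsD:
  assumes "splits W C A B"
  shows "openin (top_of_set S2) A" "openin (top_of_set S2) B" "connected A" "connected B"
    "A \<inter> B = {}" "W - C = A \<union> B" "A \<subseteq> S2" "B \<subseteq> S2" "A \<subseteq> W" "B \<subseteq> W"
    "\<And>y. y \<in> W \<Longrightarrow> y \<in> C \<Longrightarrow> y \<in> closure A \<and> y \<in> closure B"
proof -
  show 1: "openin (top_of_set S2) A" "openin (top_of_set S2) B" "connected A" "connected B"
    "A \<inter> B = {}" "W - C = A \<union> B"
    using assms unfolding splits_def by simp_all
  show "A \<subseteq> S2" "B \<subseteq> S2" using openin_imp_subset[OF 1(1)] openin_imp_subset[OF 1(2)] by simp_all
  show "A \<subseteq> W" "B \<subseteq> W" using 1(6) by auto
  show "\<And>y. y \<in> W \<Longrightarrow> y \<in> C \<Longrightarrow> y \<in> closure A \<and> y \<in> closure B"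
    using assms unfolding splits_def by simp
qed

lemma loc_const_const:
  assumes "connected E" "loc_const F c" "E \<subseteq> F"
  obtains g where "\<forall>y\<in>E. c y = g"
  using loc_const_connected[OF assms(1) loc_const_subset[OF assms(2,3)]] by metis

lemma splits_vals:
  assumes sp: "splits W P A B" and W: "openin (top_of_set S2) W" and c: "loc_const (S2 - P) c"
  shows "\<exists>a b. (\<forall>y\<in>A. c y = a) \<and> (\<forall>y\<in>B. c y = b) \<and> (\<forall>y\<in>W \<inter> P. vals P c y = {a, b})"
proof -
  note sd = splitsD[OF sp]
  have AP: "A \<subseteq> S2 - P" "B \<subseteq> S2 - P" using sd(6,7,8) by auto
  obtain a where a: "\<forall>y\<in>A. c y = a" by (rule loc_const_const[OF sd(3) c AP(1)])
  obtain b where b: "\<forall>y\<in>B. c y = b" by (rule loc_const_const[OF sd(4) c AP(2)])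
  have "vals P c y = {a, b}" if "y \<in> W \<inter> P" for y
    by (rule vals_pair[OF W _ sd(7,8)]) (use that sd(6) sd(11)[of y] AP a b in auto)
  then show ?thesis using a b by blast
qed

context diagram_lift
begin

lemma edge_vals:
  assumes "i < ncomps D" "strand D i s0 \<notin> crossings D" "loc_const (S2 - P) c"
  shows "\<exists>W \<delta> a b. openin (top_of_set S2) W \<and> strand D i s0 \<in> W \<and> 0 < \<delta> \<and>
    (\<forall>y\<in>W - P. c y \<in> {a, b}) \<and> (\<forall>y\<in>W \<inter> P. vals P c y = {a, b}) \<and>
    (\<forall>s. \<bar>s - s0\<bar> < \<delta> \<longrightarrow> strand D i s \<in> W)"
proof -
  obtain W A B \<delta> where W: "0 < \<delta>" "openin (top_of_set S2) W" "strand D i s0 \<in> W" "splits W P A B"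
    "\<forall>s. \<bar>s - s0\<bar> < \<delta> \<longrightarrow> strand D i s \<in> W"
    using edge_chart[OF assms(1,2)] by (elim exE conjE)
  obtain a b where ab: "\<forall>y\<in>A. c y = a" "\<forall>y\<in>B. c y = b" "\<forall>y\<in>W \<inter> P. vals P c y = {a, b}"
    using splits_vals[OF W(4,2) assms(3)] by (elim exE conjE)
  have "\<forall>y\<in>W - P. c y \<in> {a, b}" using splitsD(6)[OF W(4)] ab(1,2) by auto
  then show ?thesis using W(1,2,3,5) ab(3)
    by (intro exI[of _ W] exI[of _ \<delta>] exI[of _ a] exI[of _ b] conjI)
qed

text \<open>Crossing the overpass exchanges \<open>g1\<close> and \<open>g2\<close>, crossing the
  underpass exchanges \<open>k1\<close> and \<open>k2\<close>. Each half of a strand therefore sees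
  the two colours that agree in the letter of the other strand. The chart enters the conclusion only
  through \<open>vals\<close>, so later arguments work with colours alone.\<close>

lemma crossing_vals:
  assumes coc: "local_cocycle X t" and f: "primitive U t f" and f': "primitive V t f'"
    and m: "meet D i s0 j t0" and ov: "over D i s0"
  defines "c \<equiv> transition f f'"
  shows "\<exists>W \<delta> g1 g2 k1 k2. openin (top_of_set S2) W \<and> strand D i s0 \<in> W \<and> 0 < \<delta> \<and>
    (\<forall>y\<in>W - P. c y \<in> {g1 - k1, g1 - k2, g2 - k1, g2 - k2}) \<and>
    vals P c (strand D i s0) = {g1 - k1, g1 - k2, g2 - k1, g2 - k2} \<and>
    (\<forall>y\<in>W \<inter> P. y = strand D i s0 \<or>
       vals P c y \<in> {{g1 - k1, g2 - k1}, {g1 - k2, g2 - k2}, {g1 - k1, g1 - k2}, {g2 - k1, g2 - k2}}) \<and>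
    (\<forall>s. s0 < s \<longrightarrow> s < s0 + \<delta> \<longrightarrow> vals P c (strand D i s) = {g1 - k1, g2 - k1}) \<and>
    (\<forall>s. s0 - \<delta> < s \<longrightarrow> s < s0 \<longrightarrow> vals P c (strand D i s) = {g1 - k2, g2 - k2}) \<and>
    (\<forall>s. t0 < s \<longrightarrow> s < t0 + \<delta> \<longrightarrow> vals P c (strand D j s) = {g1 - k1, g1 - k2}) \<and>
    (\<forall>s. t0 - \<delta> < s \<longrightarrow> s < t0 \<longrightarrow> vals P c (strand D j s) = {g2 - k1, g2 - k2})"
proof -
  note mf = meet_facts[OF m]
  let ?x = "strand D i s0"
  obtain d W A B A' B' g1 g2 k1 k2 where d: "0 < d" and chart: "crossing_chart i s0 j t0 d W A B A' B'"
    and vs: "\<forall>y\<in>W. (y \<in> A \<longrightarrow> y \<in> A' \<longrightarrow> c y = g1 - k1) \<and> (y \<in> A \<longrightarrow> y \<in> B' \<longrightarrow> c y = g1 - k2) \<and>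
       (y \<in> B \<longrightarrow> y \<in> A' \<longrightarrow> c y = g2 - k1) \<and> (y \<in> B \<longrightarrow> y \<in> B' \<longrightarrow> c y = g2 - k2)"
    using crossing_relation[OF coc f f' m ov] unfolding c_def by (elim exE conjE)
  let ?I = "strand D i ` {s0-d<..<s0+d}" and ?J = "strand D j ` {t0-d<..<t0+d}"
  have WS: "openin (top_of_set S2) W" and xW: "?x \<in> W" and sp1: "splits W ?I A B" and sp2: "splits W ?J A' B'"
    and loc: "\<forall>k s. k < ncomps D \<longrightarrow> strand D k s \<in> W \<longrightarrow>
        (\<exists>m::int. k = i \<and> \<bar>s - of_int m - s0\<bar> < d \<or> k = j \<and> \<bar>s - of_int m - t0\<bar> < d)"
    and e1: "\<forall>s. strand D i s \<in> W \<longrightarrow> (s0 < s \<longrightarrow> s < s0 + d \<longrightarrow> strand D i s \<in> A') \<and>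
        (s0 - d < s \<longrightarrow> s < s0 \<longrightarrow> strand D i s \<in> B')"
    and e2: "\<forall>t. strand D j t \<in> W \<longrightarrow> (t0 < t \<longrightarrow> t < t0 + d \<longrightarrow> strand D j t \<in> A) \<and>
        (t0 - d < t \<longrightarrow> t < t0 \<longrightarrow> strand D j t \<in> B)"
    using chart unfolding crossing_chart_def by simp_all
  note s1 = splitsD[OF sp1] and s2 = splitsD[OF sp2]
  have IJP: "?I \<subseteq> P" "?J \<subseteq> P" using mf(1,2) by (auto simp: P_def)
  have WP: "y \<in> ?I \<or> y \<in> ?J" if y: "y \<in> W" "y \<in> P" for y
  proof -
    obtain k s where ks: "k < ncomps D" "y = strand D k s" using y(2) by (auto simp: P_def)
    then obtain m' :: int where "k = i \<and> \<bar>s - of_int m' - s0\<bar> < d \<or> k = j \<and> \<bar>s - of_int m' - t0\<bar> < d"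
      using loc y(1) by blast
    then show ?thesis
    proof (elim disjE conjE)
      assume a: "k = i" "\<bar>s - of_int m' - s0\<bar> < d"
      have "y = strand D i (s + of_int (- m'))" using strand_shift[OF mf(1), of s "- m'"] ks a by simp
      moreover have "s + of_int (- m') \<in> {s0-d<..<s0+d}" using a(2) by (auto simp: abs_less_iff)
      ultimately show ?thesis by blast
    next
      assume a: "k = j" "\<bar>s - of_int m' - t0\<bar> < d"
      have "y = strand D j (s + of_int (- m'))" using strand_shift[OF mf(2), of s "- m'"] ks a by simp
      moreover have "s + of_int (- m') \<in> {t0-d<..<t0+d}" using a(2) by (auto simp: abs_less_iff)
      ultimately show ?thesis by blast
    qed
  qed
  have nP: "y \<notin> P" if "y \<in> A \<union> B" "y \<in> A' \<union> B'" for y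
    using WP[of y] that s1(6,9,10) s2(6) by blast
  have cover: "W - P \<subseteq> A \<union> B" "W - P \<subseteq> A' \<union> B'" using s1(6) s2(6) IJP by blast+
  have vA': "vals P c y = {g1 - k1, g2 - k1}" if "y \<in> W" "y \<in> ?I" "y \<in> A'" for y
    by (rule vals_pair[OF s2(1) that(3) s1(7,8)]) (use s1(11)[OF that(1,2)] cover(1) s2(9,10) s1(9,10) nP vs in blast)+
  have vB': "vals P c y = {g1 - k2, g2 - k2}" if "y \<in> W" "y \<in> ?I" "y \<in> B'" for y
    by (rule vals_pair[OF s2(2) that(3) s1(7,8)]) (use s1(11)[OF that(1,2)] cover(1) s2(9,10) s1(9,10) nP vs in blast)+
  have vA: "vals P c y = {g1 - k1, g1 - k2}" if "y \<in> W" "y \<in> ?J" "y \<in> A" for y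
    by (rule vals_pair[OF s1(1) that(3) s2(7,8)]) (use s2(11)[OF that(1,2)] cover(2) s2(9,10) s1(9,10) nP vs in blast)+
  have vB: "vals P c y = {g2 - k1, g2 - k2}" if "y \<in> W" "y \<in> ?J" "y \<in> B" for y
    by (rule vals_pair[OF s1(2) that(3) s2(7,8)]) (use s2(11)[OF that(1,2)] cover(2) s2(9,10) s1(9,10) nP vs in blast)+
  obtain d1 where d1: "0 < d1" "\<forall>s. \<bar>s - s0\<bar> < d1 \<longrightarrow> strand D i s \<in> W" by (rule strand_near[OF mf(1) WS xW])
  have xW': "strand D j t0 \<in> W" using xW mf(3) by simp
  obtain d2 where d2: "0 < d2" "\<forall>s. \<bar>s - t0\<bar> < d2 \<longrightarrow> strand D j s \<in> W" by (rule strand_near[OF mf(2) WS xW'])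
  define \<delta> where "\<delta> = min d (min d1 d2)"
  have \<delta>: "0 < \<delta>" "\<delta> \<le> d" "\<delta> \<le> d1" "\<delta> \<le> d2" using d d1 d2 by (auto simp: \<delta>_def)
  have p1: "vals P c (strand D i s) = {g1 - k1, g2 - k1}" if "s0 < s" "s < s0 + \<delta>" for s
  proof -
    have "strand D i s \<in> W" using d1(2) that \<delta> by simp
    moreover have "strand D i s \<in> ?I" using that \<delta> by (intro imageI) auto
    moreover have "strand D i s \<in> A'" using e1 calculation(1) that \<delta> by auto
    ultimately show ?thesis by (rule vA')
  qed
  have p2: "vals P c (strand D i s) = {g1 - k2, g2 - k2}" if "s0 - \<delta> < s" "s < s0" for s
  proof -
    have "strand D i s \<in> W" using d1(2) that \<delta> by simp
    moreover have "strand D i s \<in> ?I" using that \<delta> by (intro imageI) auto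
    moreover have "strand D i s \<in> B'" using e1 calculation(1) that \<delta> by auto
    ultimately show ?thesis by (rule vB')
  qed
  have p3: "vals P c (strand D j s) = {g1 - k1, g1 - k2}" if "t0 < s" "s < t0 + \<delta>" for s
  proof -
    have "strand D j s \<in> W" using d2(2) that \<delta> by simp
    moreover have "strand D j s \<in> ?J" using that \<delta> by (intro imageI) auto
    moreover have "strand D j s \<in> A" using e2 calculation(1) that \<delta> by auto
    ultimately show ?thesis by (rule vA)
  qed
  have p4: "vals P c (strand D j s) = {g2 - k1, g2 - k2}" if "t0 - \<delta> < s" "s < t0" for s
  proof -
    have "strand D j s \<in> W" using d2(2) that \<delta> by simp
    moreover have "strand D j s \<in> ?J" using that \<delta> by (intro imageI) auto
    moreover have "strand D j s \<in> B" using e2 calculation(1) that \<delta> by auto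
    ultimately show ?thesis by (rule vB)
  qed
  have q1: "c y \<in> {g1 - k1, g1 - k2, g2 - k1, g2 - k2}" if "y \<in> W - P" for y
    using cover that vs by blast
  \<comment> \<open>Each of the four colours is seen from one of the two halves of the overpass, and
    both halves come arbitrarily close to the crossing.\<close>
  have "g \<in> vals P c ?x" if g: "g \<in> {g1 - k1, g1 - k2, g2 - k1, g2 - k2}" for g
    unfolding vals_def
  proof (intro CollectI allI impI)
    fix N assume N: "openin (top_of_set S2) N" "?x \<in> N"
    obtain e where e: "0 < e" "\<forall>s. \<bar>s - s0\<bar> < e \<longrightarrow> strand D i s \<in> N" by (rule strand_near[OF mf(1) N])
    define r where "r = min e \<delta> / 2"
    have r: "0 < r" "r < e" "r < \<delta>" using e \<delta> by (auto simp: r_def)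
    have "g \<in> vals P c (strand D i (s0 + r)) \<or> g \<in> vals P c (strand D i (s0 - r))"
      using p1[of "s0 + r"] p2[of "s0 - r"] r g by auto
    moreover have "strand D i (s0 + r) \<in> N" "strand D i (s0 - r) \<in> N" using e(2) r by auto
    ultimately show "\<exists>y\<in>N - P. c y = g" using vals_meets[OF _ N(1)] by metis
  qed
  then have vx: "vals P c ?x = {g1 - k1, g1 - k2, g2 - k1, g2 - k2}"
    using vals_subset[OF WS xW, of P c "{g1 - k1, g1 - k2, g2 - k1, g2 - k2}"] q1 by blast
  have q2: "y = ?x \<or> vals P c y \<in> {{g1 - k1, g2 - k1}, {g1 - k2, g2 - k2}, {g1 - k1, g1 - k2}, {g2 - k1, g2 - k2}}"
    if y: "y \<in> W \<inter> P" for y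
  proof -
    consider s where "y = strand D i s" "s0 - d < s" "s < s0 + d" | s where "y = strand D j s" "t0 - d < s" "s < t0 + d"
      using WP[of y] y by auto
    then show ?thesis
    proof cases
      case (1 s)
      then have yI: "y \<in> W" "y \<in> ?I" using y by auto
      consider "s = s0" | "s0 < s" | "s < s0" by linarith
      then show ?thesis
      proof cases
        case 2
        then have "y \<in> A'" using e1 1 yI by auto
        then show ?thesis using vA'[OF yI] by simp
      next
        case 3
        then have "y \<in> B'" using e1 1 yI by auto
        then show ?thesis using vB'[OF yI] by simp
      qed (use 1 in simp)
    next
      case (2 s)
      then have yJ: "y \<in> W" "y \<in> ?J" using y by auto
      consider "s = t0" | "t0 < s" | "s < t0" by linarith
      then show ?thesis
      proof cases
        case 1
        then show ?thesis using 2(1) mf(3) by simp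
      next
        case 2
        then have "y \<in> A" using e2 \<open>y = strand D j s\<close> \<open>s < t0 + d\<close> yJ by auto
        then show ?thesis using vA[OF yJ] by simp
      next
        case 3
        then have "y \<in> B" using e2 2 yJ by auto
        then show ?thesis using vB[OF yJ] by simp
      qed
    qed
  qed
  show ?thesis
    by (rule exI[of _ W], rule exI[of _ \<delta>], rule exI[of _ g1], rule exI[of _ g2], rule exI[of _ k1], rule exI[of _ k2])
      (intro conjI WS xW \<delta>(1) ballI allI impI vx q1 q2 p1 p2 p3 p4; assumption)
qed

end

section \<open>Gauges on the link complement from equal face colourings\<close>

lemma (in height_curves) K_compact: "compact K"
proof -
  have "range (\<lambda>s. at_height (\<gamma> i s) (h i s)) = (\<lambda>s. at_height (\<gamma> i s) (h i s)) ` {0..1}" if "i < n" for i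
  proof -
    have "at_height (\<gamma> i s) (h i s) \<in> (\<lambda>s. at_height (\<gamma> i s) (h i s)) ` {0..1}" for s
      by (rule image_eqI[of _ _ "frac s"])
        (simp_all add: periodic_frac[of "\<gamma> i"] periodic_frac[of "h i"] curve_periodic height_periodic that frac_lt_1 less_imp_le)
    then show ?thesis by auto
  qed
  moreover have "compact ((\<lambda>s. at_height (\<gamma> i s) (h i s)) ` {0..1})" if "i < n" for i
    using curve_cont[OF that] height_cont[OF that]
    by (intro compact_continuous_image continuous_at_height) (auto intro: continuous_on_subset)
  ultimately show ?thesis unfolding K_def by (intro compact_UN) auto
qed

lemma (in height_curves) above_below_off_P:
  assumes "z \<in> above n \<gamma> h" "z \<in> below n \<gamma> h"
  obtains y k where "y \<in> S2 - P" "-1 < k" "k < 1" "z = at_height y k"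
proof -
  have "z \<in> S3" using assms(1) by (simp add: above_def)
  then show thesis
  proof (cases rule: S3_cases)
    case 1
    then have "flip_height z = (0, -1)" by (simp add: flip_height_def)
    then show thesis
      using assms(2) height_curves.south_not_above[OF flipped] by (simp flip: flip_height_below_iff)
  next
    case 2
    then show thesis using assms(1) south_not_above by simp
  next
    case (3 y k)
    then have "\<forall>i s. i < n \<longrightarrow> \<gamma> i s = y \<longrightarrow> h i s < k" "\<forall>i s. i < n \<longrightarrow> \<gamma> i s = y \<longrightarrow> k < h i s"
      using assms at_height_above_iff at_height_below_iff by simp_all
    then have "y \<notin> P" unfolding P_def by force
    then show thesis using that 3 by simp
  qed
qed

lemma S2_connected: "connected S2"
  by (rule connected_sphere) simp

lemma local_cocycle_0: "local_cocycle X (\<lambda>a b. 0 :: 'g::group_add)"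
  unfolding local_cocycle_def cocycle_on_def by (auto intro: exI[of _ UNIV])

lemma primitive_0: "primitive X (\<lambda>a b. 0) (\<lambda>a. 0 :: 'g::group_add)"
  unfolding primitive_def by (auto intro: exI[of _ UNIV])

lemma open_fst_direction:
  assumes "open (B :: (real^3) set)"
  shows "open {z :: (real^3) \<times> real. fst z \<noteq> 0 \<and> sgn (fst z) \<in> B}"
proof -
  have "open {z :: (real^3) \<times> real. fst z \<noteq> 0}"
    by (intro open_Collect_neq continuous_intros)
  moreover have "continuous_on {z :: (real^3) \<times> real. fst z \<noteq> 0} (\<lambda>z. sgn (fst z))"
    unfolding sgn_div_norm by (intro continuous_intros) auto
  ultimately have "open ({z :: (real^3) \<times> real. fst z \<noteq> 0} \<inter> (\<lambda>z. sgn (fst z)) -` B)"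
    using assms by (intro continuous_open_preimage)
  moreover have "{z :: (real^3) \<times> real. fst z \<noteq> 0} \<inter> (\<lambda>z. sgn (fst z)) -` B = {z. fst z \<noteq> 0 \<and> sgn (fst z) \<in> B}"
    by auto
  ultimately show ?thesis by simp
qed

lemma at_height_fst:
  assumes "norm y = 1" "-1 < k" "k < 1"
  shows "fst (at_height y k) \<noteq> 0" "sgn (fst (at_height y k)) = y"
proof -
  have "k\<^sup>2 < 1" using assms by (simp add: abs_square_less_1 abs_less_iff)
  then show "fst (at_height y k) \<noteq> 0" "sgn (fst (at_height y k)) = y"
    using assms(1) by (auto simp: at_height_def sgn_scaleR sgn_div_norm)
qed

context diagram_lift
begin

text \<open>An element of \<open>vals\<close> is attained off the projection in every neighbourhood,
  so it is enough that \<open>vals\<close> is nonempty for some colouring. A trivial colouring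
  provides one.\<close>

lemma off_P_dense:
  assumes N: "openin (top_of_set S2) N" "x \<in> N"
  shows "\<exists>y\<in>N. y \<notin> P"
proof (cases "x \<in> P")
  case True
  then obtain i s0 where ix: "i < ncomps D" "x = strand D i s0" by (auto simp: P_def)
  have "\<exists>c :: real^3 \<Rightarrow> int. \<exists>g. g \<in> vals P c x"
  proof (cases "x \<in> crossings D")
    case False
    have "loc_const (S2 - P) (\<lambda>y. 0 :: int)" unfolding loc_const_def by (auto intro: exI[of _ UNIV])
    from edge_vals[OF ix(1) False[unfolded ix(2)] this] obtain W and a b :: int where
      "x \<in> W" "\<forall>y\<in>W \<inter> P. vals P (\<lambda>y. 0) y = {a, b}" unfolding ix(2) by (elim exE conjE)
    then show ?thesis using True by (intro exI[of _ "\<lambda>y. 0"] exI[of _ a]) auto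
  next
    case x: True
    obtain i s j t where m: "meet D i s j t" "over D i s" "x = strand D i s"
      by (rule crossing_meet[OF x])
    from crossing_vals[OF local_cocycle_0 primitive_0 primitive_0 m(1,2)]
    obtain g1 g2 k1 k2 :: int where "vals P (transition (\<lambda>a. 0) (\<lambda>a. 0)) (strand D i s) = {g1 - k1, g1 - k2, g2 - k1, g2 - k2}"
      by (elim exE conjE)
    then show ?thesis using m(3) by blast
  qed
  then obtain c :: "real^3 \<Rightarrow> int" and g where g: "g \<in> vals P c x" by (elim exE)
  show ?thesis using vals_meets[OF g N] by blast
qed (use assms in auto)

text \<open>Connectedness of the whole sphere is used: points are classified by whether the colours
  nearby lie in \<open>E\<close>. Both classes are open, and they are disjoint because points off
  the projection are dense.\<close>

lemma transition_spread:
  assumes c: "loc_const (S2 - P) c" and y0: "y0 \<in> S2 - P" "c y0 \<in> E"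
    and loc: "\<And>x. x \<in> P \<Longrightarrow> \<exists>W. openin (top_of_set S2) W \<and> x \<in> W \<and> ((\<forall>y\<in>W - P. c y \<in> E) \<or> (\<forall>y\<in>W - P. c y \<notin> E))"
    and y: "y \<in> S2 - P"
  shows "c y \<in> E"
proof (rule ccontr)
  assume ny: "c y \<notin> E"
  define Q where "Q q = \<Union> {W. openin (top_of_set S2) W \<and> (\<forall>z\<in>W - P. (c z \<in> E) = q)}" for q
  have opP: "openin (top_of_set S2) (S2 - P)"
    unfolding Diff_eq by (intro openin_open_Int open_Compl compact_imp_closed P_compact)
  have inQ: "z \<in> Q (c z \<in> E)" if z: "z \<in> S2 - P" for z
  proof -
    obtain W where W[rule_format]: "open W" "z \<in> W" "\<forall>w. w \<in> W \<longrightarrow> w \<in> S2 - P \<longrightarrow> c w = c z"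
      by (rule loc_constD[OF c z])
    then have "openin (top_of_set S2) ((S2 - P) \<inter> W)" "\<forall>w\<in>(S2 - P) \<inter> W - P. (c w \<in> E) = (c z \<in> E)"
      using openin_Int_open[OF opP W(1)] W(3) by auto
    then show ?thesis unfolding Q_def using z W(2) by blast
  qed
  have opQ: "openin (top_of_set S2) (Q q)" for q unfolding Q_def by (intro openin_Union) auto
  have "S2 \<subseteq> Q True \<union> Q False"
  proof
    fix z assume "z \<in> S2"
    show "z \<in> Q True \<union> Q False"
    proof (cases "z \<in> P")
      case True
      then obtain W where "openin (top_of_set S2) W" "z \<in> W" "(\<forall>y\<in>W - P. c y \<in> E) \<or> (\<forall>y\<in>W - P. c y \<notin> E)"
        using loc by blast
      then show ?thesis unfolding Q_def by blast
    next
      case False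
      then show ?thesis using inQ[of z] \<open>z \<in> S2\<close> by (cases "c z \<in> E") auto
    qed
  qed
  moreover have "Q True \<inter> Q False = {}"
  proof (rule ccontr)
    assume "Q True \<inter> Q False \<noteq> {}"
    then obtain x W W' where x: "x \<in> W" "x \<in> W'" "openin (top_of_set S2) W" "openin (top_of_set S2) W'"
      "\<forall>z\<in>W - P. c z \<in> E" "\<forall>z\<in>W' - P. c z \<notin> E"
      unfolding Q_def by auto
    then obtain z where "z \<in> W \<inter> W'" "z \<notin> P"
      using off_P_dense[of "W \<inter> W'" x] openin_Int[OF x(3,4)] by blast
    then show False using x by blast
  qed
  moreover have "y0 \<in> Q True" "y \<in> Q False" using inQ[OF y0(1)] inQ[OF y] y0(2) ny by simp_all
  ultimately show False
    using S2_connected opQ[of True] opQ[of False] y0(1) y unfolding connected_openin by blast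
qed

text \<open>Points of the complement in neither region lie between the strands of a crossing. Removing the
  two regions does not disconnect a neighbourhood of such a point, so the gauge extends over it.\<close>

lemma gauge_near_middle:
  assumes coc: "local_cocycle X t" "local_cocycle X t'"
    and Y: "Y = U \<union> V"
    and F: "\<And>x. x \<in> Y \<Longrightarrow> \<exists>W. open W \<and> x \<in> W \<and> (\<forall>a b. a \<in> W \<inter> X \<longrightarrow> b \<in> W \<inter> X \<longrightarrow> F a + t a b = t' a b + F b)"
    and m: "m \<in> X - Y"
  shows "\<exists>Q g. open Q \<and> m \<in> Q \<and> cocycle_on (Q \<inter> X) t \<and> cocycle_on (Q \<inter> X) t' \<and>
    (\<forall>a\<in>Q \<inter> Y. g + t m a = t' m a + F a) \<and>
    (\<forall>p Q'. p \<in> Q \<inter> X \<longrightarrow> open Q' \<longrightarrow> p \<in> Q' \<longrightarrow> Q \<inter> Q' \<inter> Y \<noteq> {})"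
proof -
  have mX: "m \<in> X" "m \<notin> U" "m \<notin> V" using m Y by auto
  obtain x k where x: "norm x = 1" "-1 < k" "k < 1" "m = at_height x k"
  proof -
    have "m \<in> S3" using mX by simp
    then show thesis using that mX north_above south_below by (cases rule: S3_cases) auto
  qed
  have nK: "k \<noteq> h i s" if "i < ncomps D" "strand D i s = x" for i s
    using mX(1) x(4) at_height_in_K_iff[OF x(1-3)] that by auto
  obtain i s0 where i: "i < ncomps D" "strand D i s0 = x" "k < h i s0"
    using mX(2) x(4) at_height_above_iff[OF x(1-3)] nK by (metis not_less_iff_gr_or_eq)
  obtain j t0 where j: "j < ncomps D" "strand D j t0 = x" "h j t0 < k"
    using mX(3) x(4) at_height_below_iff[OF x(1-3)] nK by (metis not_less_iff_gr_or_eq)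
  have "\<not> (i = j \<and> s0 - t0 \<in> \<int>)"
  proof
    assume a: "i = j \<and> s0 - t0 \<in> \<int>"
    then obtain l where "s0 - t0 = of_int l" by (auto elim: Ints_cases)
    then have "s0 = t0 + of_int l" by simp
    then have "h i s0 = h j t0" using h_shift[OF j(1), of t0 l] a by simp
    then show False using i j by simp
  qed
  then have meet: "meet D i s0 j t0" using i j by (simp add: meet_def)
  obtain W0 where W0: "open W0" "m \<in> W0" "cocycle_on (W0 \<inter> X) t" by (rule local_cocycleE[OF coc(1) mX(1)])
  obtain W0' where W0': "open W0'" "m \<in> W0'" "cocycle_on (W0' \<inter> X) t'" by (rule local_cocycleE[OF coc(2) mX(1)])
  define W1 where "W1 = W0 \<inter> W0' \<inter> - K"
  have W1: "open W1" "m \<in> W1"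
    using W0 W0' mX(1) compact_imp_closed[OF K_compact] unfolding W1_def by auto
  have "continuous_on UNIV (\<lambda>p. at_height (fst p) (snd p))" by (intro continuous_at_height continuous_intros)
  then have "open ((\<lambda>p. at_height (fst p) (snd p)) -` W1)" using W1(1) by (simp add: continuous_on_open_vimage)
  moreover have "(x, k) \<in> (\<lambda>p. at_height (fst p) (snd p)) -` W1" using W1(2) x(4) by simp
  ultimately obtain A J where AJ: "open A" "open J" "(x, k) \<in> A \<times> J" "A \<times> J \<subseteq> (\<lambda>p. at_height (fst p) (snd p)) -` W1"
    by (rule open_prod_elim)
  define I where "I = J \<inter> {max (-1) (h j t0)<..<min 1 (h i s0)}"
  have "open I" "k \<in> I" using AJ x i j by (auto simp: I_def)
  then obtain e where e: "0 < e" "ball k e \<subseteq> I" by (metis openE)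
  have Ik: "k' \<in> J \<and> -1 < k' \<and> k' < 1 \<and> h j t0 < k' \<and> k' < h i s0" if "\<bar>k' - k\<bar> < e" for k'
  proof -
    have "k' \<in> ball k e" using that by (simp add: dist_real_def abs_minus_commute)
    then show ?thesis using e(2) unfolding I_def by auto
  qed
  \<comment> \<open>The other crossings are removed from the chart, so that over each point of it
    except \<open>x\<close> all strands have one common height.\<close>
  have "finite (crossings D - {x})" using diagram unfolding is_diagram_def by auto
  then have oA: "open (A \<inter> - (crossings D - {x}))" using AJ(1) by (intro open_Int open_Compl finite_imp_closed)
  have xA: "strand D i s0 \<in> A \<inter> - (crossings D - {x})" using AJ(3) i by auto
  obtain d B C1 C2 C3 C4 where B: "B \<subseteq> A \<inter> - (crossings D - {x})"
    "crossing_chart i s0 j t0 d B C1 C2 C3 C4"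
    using crossing_chart_exists[OF meet oA xA zero_less_one] by (elim exE conjE)
  have BS: "openin (top_of_set S2) B" "x \<in> B" "connected (B - {x})"
    using B(2) i(2) unfolding crossing_chart_def by simp_all
  have B1: "norm y = 1" if "y \<in> B" for y using openin_imp_subset[OF BS(1)] that by auto
  obtain B' where B': "open B'" "B = S2 \<inter> B'" using BS(1) by (auto simp: openin_open)
  define Q where "Q = {z. fst z \<noteq> 0 \<and> sgn (fst z) \<in> B'} \<inter> {z :: (real^3) \<times> real. \<bar>snd z - k\<bar> < e}"
  have "open {z :: (real^3) \<times> real. \<bar>snd z - k\<bar> < e}" by (intro open_Collect_less continuous_intros)
  then have Qo: "open Q" unfolding Q_def using open_fst_direction[OF B'(1)] by blast
  have Qin: "at_height y k' \<in> Q" if "y \<in> B" "\<bar>k' - k\<bar> < e" for y k'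
    using at_height_fst[OF B1[OF that(1)], of k'] Ik[OF that(2)] that B'(2) by (simp add: Q_def)
  have Qout: "\<exists>y k'. y \<in> B \<and> \<bar>k' - k\<bar> < e \<and> z = at_height y k'" if z: "z \<in> Q" "z \<in> S3" for z
  proof -
    have "fst z \<noteq> 0" "sgn (fst z) \<in> B'" "\<bar>snd z - k\<bar> < e" using z(1) by (auto simp: Q_def)
    then show ?thesis using at_height_sgn[OF z(2)] B'(2)
      by (intro exI[of _ "sgn (fst z)"] exI[of _ "snd z"]) auto
  qed
  have inW1: "at_height y k' \<in> W1" if "y \<in> B" "\<bar>k' - k\<bar> < e" for y k'
  proof -
    have "(y, k') \<in> A \<times> J" using B(1) Ik[OF that(2)] that(1) by auto
    then show ?thesis using AJ(4) by auto
  qed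
  have QW1: "Q \<inter> X \<subseteq> W1" using Qout inW1 by blast
  \<comment> \<open>Over such a point the link has at most one height, and the point differs from it
    because it lies in the complement. It is thus above or below everything.\<close>
  have offx: "at_height y k' \<in> Y" if y: "y \<in> B" "y \<noteq> x" "\<bar>k' - k\<bar> < e" for y k'
  proof (cases "y \<in> P")
    case False
    then show ?thesis using off_P_above_below[of y k'] Ik[OF y(3)] B1[OF y(1)] Y by auto
  next
    case True
    then obtain l s where l: "l < ncomps D" "y = strand D l s" by (auto simp: P_def)
    have nc: "strand D l s \<notin> crossings D" using B(1) y l by blast
    have kb: "-1 < k'" "k' < 1" using Ik[OF y(3)] by auto
    have same: "h l' s' = h l s" if ls: "l' < ncomps D" "strand D l' s' = y" for l' s'
    proof -
      have "l' = l" "s' - s \<in> \<int>" using noncrossing_fiber[OF l(1) nc ls(1)] ls l by auto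
      then obtain q where "s' - s = of_int q" by (auto elim: Ints_cases)
      then have "s' = s + of_int q" by simp
      then show ?thesis using h_shift[OF l(1), of s q] \<open>l' = l\<close> by simp
    qed
    have "at_height y k' \<notin> K" using inW1[OF y(1,3)] by (simp add: W1_def)
    then have "k' \<noteq> h l s" using at_height_in_K_iff[OF B1[OF y(1)] kb] l by auto
    then consider "k' < h l s" | "h l s < k'" by linarith
    then show ?thesis
    proof cases
      case 1
      then have "at_height y k' \<in> V" using at_height_below_iff[OF B1[OF y(1)] kb] same by auto
      then show ?thesis using Y by simp
    next
      case 2
      then have "at_height y k' \<in> U" using at_height_above_iff[OF B1[OF y(1)] kb] same by auto
      then show ?thesis using Y by simp
    qed
  qed
  have onx: "at_height x k' \<notin> Y" if k': "\<bar>k' - k\<bar> < e" for k'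
  proof -
    have kb: "-1 < k'" "k' < 1" "h j t0 < k'" "k' < h i s0" using Ik[OF k'] by auto
    then show ?thesis
      using at_height_above_iff[OF x(1) kb(1,2)] at_height_below_iff[OF x(1) kb(1,2)] i j Y by (metis UnE less_asym)
  qed
  \<comment> \<open>A punctured box times an interval. This connected set is the part of
    \<open>Q\<close> inside the two regions.\<close>
  define Y0 where "Y0 = (\<lambda>p. at_height (fst p) (snd p)) ` ((B - {x}) \<times> {k - e<..<k + e})"
  have "connected Y0" unfolding Y0_def
    by (intro connected_continuous_image continuous_at_height continuous_intros connected_Times BS(3)) auto
  have Y0Y: "Y0 \<subseteq> Y"
  proof
    fix z assume "z \<in> Y0"
    then obtain p where p: "p \<in> (B - {x}) \<times> {k - e<..<k + e}" "z = at_height (fst p) (snd p)"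
      unfolding Y0_def by blast
    then have "fst p \<in> B" "fst p \<noteq> x" "\<bar>snd p - k\<bar> < e" by (auto simp: abs_less_iff mem_Times_iff)
    then show "z \<in> Y" unfolding p(2) by (rule offx)
  qed
  have YX: "Y \<subseteq> X" unfolding Y using above_subset below_subset by blast
  have Y0Q: "Y0 \<subseteq> Q"
  proof
    fix z assume "z \<in> Y0"
    then obtain p where p: "p \<in> (B - {x}) \<times> {k - e<..<k + e}" "z = at_height (fst p) (snd p)"
      unfolding Y0_def by blast
    then have "fst p \<in> B" "\<bar>snd p - k\<bar> < e" by (auto simp: abs_less_iff mem_Times_iff)
    then show "z \<in> Q" unfolding p(2) by (rule Qin)
  qed
  have QY: "Q \<inter> Y \<subseteq> Y0"
  proof
    fix z assume z: "z \<in> Q \<inter> Y"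
    then have "z \<in> S3" using YX by auto
    then obtain y k' where yk: "y \<in> B" "\<bar>k' - k\<bar> < e" "z = at_height y k'" using Qout z by blast
    then have "y \<noteq> x" using onx z by auto
    then show "z \<in> Y0" unfolding Y0_def using yk
      by (intro image_eqI[of _ _ "(y, k')"]) (auto simp: abs_less_iff)
  qed
  have mQ: "m \<in> Q" using Qin[of x k] BS(2) e(1) x(4) by simp
  have cQ: "cocycle_on (Q \<inter> X) t" "cocycle_on (Q \<inter> X) t'"
    using QW1 by (auto simp: W1_def intro: cocycle_on_subset[OF W0(3)] cocycle_on_subset[OF W0'(3)])
  \<comment> \<open>The value at \<open>m\<close> that the gauge identity between \<open>m\<close>
    and \<open>a\<close> would force. The identity between neighbouring points makes it independent
    of \<open>a\<close>.\<close>
  define \<psi> where "\<psi> a = t' m a + F a - t m a" for a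
  have "loc_const Y0 \<psi>"
    unfolding loc_const_def
  proof
    fix a assume a: "a \<in> Y0"
    then have "a \<in> Y" using Y0Y by blast
    then obtain W where W: "open W" "a \<in> W" "\<forall>p q. p \<in> W \<inter> X \<longrightarrow> q \<in> W \<inter> X \<longrightarrow> F p + t p q = t' p q + F q"
      using F by blast
    have "\<psi> b = \<psi> a" if b: "b \<in> W \<inter> Y0" for b
    proof -
      have mem: "a \<in> Q \<inter> X" "b \<in> Q \<inter> X" "m \<in> Q \<inter> X" "a \<in> W \<inter> X" "b \<in> W \<inter> X"
        using a b Y0Q Y0Y YX mQ mX W(2) by auto
      have 1: "F a + t a b = t' a b + F b" using W(3) mem by blast
      have 2: "t' m b = t' m a + t' a b" "t m b = t m a + t a b"
        using cocycle_onD[OF cQ(2) mem(3,1,2)] cocycle_onD[OF cQ(1) mem(3,1,2)] by simp_all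
      have "\<psi> b = (t' m a + (t' a b + F b)) - (t m a + t a b)" unfolding \<psi>_def 2 by (simp only: add.assoc)
      also have "\<dots> = ((t' m a + F a) + t a b) - (t m a + t a b)" unfolding 1[symmetric] by (simp only: add.assoc)
      finally show ?thesis unfolding \<psi>_def add_diff_add_cancel .
    qed
    then show "\<exists>W. open W \<and> a \<in> W \<and> (\<forall>b\<in>W \<inter> Y0. \<psi> b = \<psi> a)"
      by (intro exI[of _ W] conjI W(1,2) ballI)
  qed
  then obtain g where g: "\<forall>a\<in>Y0. \<psi> a = g" by (rule loc_const_const[OF \<open>connected Y0\<close> _ order_refl])
  have "g + t m a = t' m a + F a" if "a \<in> Q \<inter> Y" for a
  proof -
    have "\<psi> a = g" using g QY that by blast
    then show ?thesis unfolding \<psi>_def by (metis diff_add_cancel)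
  qed
  moreover have "Q \<inter> Q' \<inter> Y \<noteq> {}" if p: "p \<in> Q \<inter> X" "open Q'" "p \<in> Q'" for p Q'
  proof (cases "p \<in> Y")
    case False
    obtain y k' where yk: "y \<in> B" "\<bar>k' - k\<bar> < e" "p = at_height y k'" using Qout[of p] p(1) by auto
    define N where "N = B \<inter> (\<lambda>y. at_height y k') -` Q'"
    have "continuous_on UNIV (\<lambda>y. at_height y k')" by (intro continuous_at_height continuous_intros)
    then have "open ((\<lambda>y. at_height y k') -` Q')" using p(2) by (simp add: continuous_on_open_vimage)
    then have "openin (top_of_set S2) N" unfolding N_def by (rule openin_Int_open[OF BS(1)])
    moreover have "y \<in> N" using yk p(3) by (simp add: N_def)
    ultimately obtain w where w: "w \<in> N" "w \<notin> P" using off_P_dense by blast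
    have "x \<in> P" using i by (auto simp: P_def)
    then have "w \<noteq> x" "w \<in> B" "at_height w k' \<in> Q'" using w by (auto simp: N_def)
    then show ?thesis using offx[of w k'] Qin[of w k'] yk(2) by blast
  qed (use p in auto)
  ultimately show ?thesis
    by (intro exI[of _ Q] exI[of _ g] conjI Qo mQ cQ ballI allI impI)
qed

text \<open>On each region the difference of the two primitives is a gauge. Equal transitions make
  the two choices agree on the overlap, and points outside both regions receive the value forced by
  nearby points.\<close>

lemma gauge_extension:
  assumes coc: "local_cocycle X t" "local_cocycle X t'"
    and f: "primitive U t f" "primitive V t f'" and g: "primitive U t' g" "primitive V t' g'"
    and eq: "\<And>y. y \<in> S2 - P \<Longrightarrow> transition f f' y = transition g g' y"
  shows "gauge_equiv X t t'"
proof -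
  define Y where "Y = U \<union> V"
  define F where "F z = (if z \<in> U then - g z + f z else - g' z + f' z)" for z
  have FV: "F z = - g' z + f' z" if z: "z \<in> V" for z
  proof (cases "z \<in> U")
    case True
    obtain y k where y: "y \<in> S2 - P" "-1 < k" "k < 1" "z = at_height y k"
      by (rule above_below_off_P[OF True z])
    define q where "q = transition f f' y"
    have "f z - f' z = q" "g z - g' z = q"
      using transition_loc_const(2)[OF f y(1-3)] transition_loc_const(2)[OF g y(1-3)] eq[OF y(1)] y(4)
      by (simp_all add: transition_def q_def)
    then have "f z = q + f' z" "g z = q + g' z" by (simp_all add: diff_eq_eq)
    then show ?thesis using True by (simp only: F_def if_True minus_add_left_cancel)
  qed (simp add: F_def)
  have YX: "Y \<subseteq> X" unfolding Y_def using above_subset below_subset by blast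
  have YF: "\<exists>W. open W \<and> x \<in> W \<and> W \<inter> X \<subseteq> Y \<and> (\<forall>a b. a \<in> W \<inter> X \<longrightarrow> b \<in> W \<inter> X \<longrightarrow> F a + t a b = t' a b + F b)"
    if x: "x \<in> Y" for x
  proof -
    have aux: ?thesis if E: "openin (top_of_set S3) E" "x \<in> E" "E \<subseteq> Y" and p: "primitive E t p" "primitive E t' q"
      and Fe: "\<And>z. z \<in> E \<Longrightarrow> F z = - q z + p z" for E p q
    proof -
      obtain W where W: "open W" "E = S3 \<inter> W" using E(1) by (auto simp: openin_open)
      obtain W1 where W1[rule_format]: "open W1" "x \<in> W1" "\<forall>a b. a \<in> W1 \<longrightarrow> a \<in> E \<longrightarrow> b \<in> W1 \<longrightarrow> b \<in> E \<longrightarrow> t a b = - p a + p b"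
        by (rule primitiveE[OF p(1) E(2)])
      obtain W2 where W2[rule_format]: "open W2" "x \<in> W2" "\<forall>a b. a \<in> W2 \<longrightarrow> a \<in> E \<longrightarrow> b \<in> W2 \<longrightarrow> b \<in> E \<longrightarrow> t' a b = - q a + q b"
        by (rule primitiveE[OF p(2) E(2)])
      show ?thesis
      proof (intro exI[of _ "W \<inter> W1 \<inter> W2"] conjI allI impI)
        show "open (W \<inter> W1 \<inter> W2)" "x \<in> W \<inter> W1 \<inter> W2" using W W1(1,2) W2(1,2) E(2) by auto
        show "W \<inter> W1 \<inter> W2 \<inter> X \<subseteq> Y" using W(2) E(3) by auto
        fix a b assume "a \<in> W \<inter> W1 \<inter> W2 \<inter> X" "b \<in> W \<inter> W1 \<inter> W2 \<inter> X"
        then have "a \<in> E" "b \<in> E" "a \<in> W1" "b \<in> W1" "a \<in> W2" "b \<in> W2" using W(2) by auto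
        then show "F a + t a b = t' a b + F b" by (simp only: Fe W1(3) W2(3) add.assoc add_minus_cancel)
      qed
    qed
    show ?thesis
    proof (cases "x \<in> U")
      case True
      show ?thesis by (rule aux[OF above_openin True _ f(1) g(1)]) (auto simp: Y_def F_def)
    next
      case False
      then have xV: "x \<in> V" using x by (simp add: Y_def)
      show ?thesis by (rule aux[OF below_openin xV _ f(2) g(2) FV]) (auto simp: Y_def)
    qed
  qed
  have YF': "\<exists>W. open W \<and> x \<in> W \<and> (\<forall>a b. a \<in> W \<inter> X \<longrightarrow> b \<in> W \<inter> X \<longrightarrow> F a + t a b = t' a b + F b)"
    if x: "x \<in> Y" for x using YF[OF x] by (elim exE conjE) (intro exI conjI)
  define near where "near m Q g \<longleftrightarrow> open Q \<and> m \<in> Q \<and> cocycle_on (Q \<inter> X) t \<and> cocycle_on (Q \<inter> X) t' \<and>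
    (\<forall>a\<in>Q \<inter> Y. g + t m a = t' m a + F a) \<and>
    (\<forall>p Q'. p \<in> Q \<inter> X \<longrightarrow> open Q' \<longrightarrow> p \<in> Q' \<longrightarrow> Q \<inter> Q' \<inter> Y \<noteq> {})" for m Q g
  have "\<forall>m\<in>X - Y. \<exists>Q g. near m Q g"
    unfolding near_def by (intro ballI gauge_near_middle[OF coc Y_def YF'])
  then obtain Q G where near: "\<And>m. m \<in> X - Y \<Longrightarrow> near m (Q m) (G m)" by metis
  define F' where "F' z = (if z \<in> Y then F z else G z)" for z
  show ?thesis
    unfolding gauge_equiv_def
  proof (intro exI[of _ F'] ballI)
    fix x assume x: "x \<in> X"
    show "\<exists>W. open W \<and> x \<in> W \<and> (\<forall>a\<in>W \<inter> X. \<forall>b\<in>W \<inter> X. F' a + t a b = t' a b + F' b)"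
    proof (cases "x \<in> Y")
      case True
      obtain W where W: "open W" "x \<in> W" "W \<inter> X \<subseteq> Y" "\<forall>a b. a \<in> W \<inter> X \<longrightarrow> b \<in> W \<inter> X \<longrightarrow> F a + t a b = t' a b + F b"
        using YF[OF True] by (elim exE conjE)
      have "F' a + t a b = t' a b + F' b" if ab: "a \<in> W \<inter> X" "b \<in> W \<inter> X" for a b
      proof -
        have "a \<in> Y" "b \<in> Y" using W(3) ab by blast+
        then show ?thesis using W(4)[rule_format, OF ab] by (simp add: F'_def)
      qed
      then show ?thesis by (intro exI[of _ W] conjI W(1,2) ballI)
    next
      case False
      then have xm: "x \<in> X - Y" using x by blast
      have n: "open (Q x)" "x \<in> Q x" "cocycle_on (Q x \<inter> X) t" "cocycle_on (Q x \<inter> X) t'"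
        and nY: "\<And>a. a \<in> Q x \<inter> Y \<Longrightarrow> G x + t x a = t' x a + F a"
        and nd: "\<And>p Q'. p \<in> Q x \<inter> X \<Longrightarrow> open Q' \<Longrightarrow> p \<in> Q' \<Longrightarrow> Q x \<inter> Q' \<inter> Y \<noteq> {}"
        using near[OF xm] unfolding near_def by blast+
      have xQ: "x \<in> Q x \<inter> X" using n(2) x by blast
      \<comment> \<open>Two points outside both regions are compared at a common point
        \<open>b\<close> of the regions; it exists because every neighbourhood of a point of
        \<open>Q x\<close> in the complement meets the regions inside \<open>Q x\<close>.\<close>
      have key: "G x + t x a = t' x a + F' a" if a: "a \<in> Q x \<inter> X" for a
      proof (cases "a \<in> Y")
        case True
        then show ?thesis using nY[of a] a by (simp add: F'_def)
      next
        case aY: False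
        then have am: "a \<in> X - Y" using a by blast
        have na: "open (Q a)" "a \<in> Q a" and naY: "\<And>b. b \<in> Q a \<inter> Y \<Longrightarrow> G a + t a b = t' a b + F b"
          using near[OF am] unfolding near_def by simp_all
        obtain b where b: "b \<in> Q x" "b \<in> Q a" "b \<in> Y" using nd[OF a na] by blast
        then have bX: "b \<in> Q x \<inter> X" using YX by blast
        have "(G x + t x a) + t a b = G x + t x b"
          using cocycle_onD[OF n(3) xQ a bX] by (simp only: add.assoc)
        also have "\<dots> = t' x b + F b" using nY b by blast
        also have "\<dots> = t' x a + (t' a b + F b)" using cocycle_onD[OF n(4) xQ a bX] by (simp only: add.assoc[symmetric])
        also have "\<dots> = t' x a + (G a + t a b)" using naY[of b] b by simp
        finally have "(G x + t x a) + t a b = (t' x a + G a) + t a b" by (simp only: add.assoc)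
        then have "G x + t x a = t' x a + G a" by (rule add_right_imp_eq)
        then show ?thesis using aY by (simp add: F'_def)
      qed
      have "F' a + t a b = t' a b + F' b" if a: "a \<in> Q x \<inter> X" and b: "b \<in> Q x \<inter> X" for a b
      proof -
        have "t' x a + (F' a + t a b) = (G x + t x a) + t a b" unfolding key[OF a] by (simp only: add.assoc)
        also have "\<dots> = G x + t x b" using cocycle_onD[OF n(3) xQ a b] by (simp only: add.assoc)
        also have "\<dots> = t' x b + F' b" by (rule key[OF b])
        also have "\<dots> = t' x a + (t' a b + F' b)" using cocycle_onD[OF n(4) xQ a b] by (simp only: add.assoc[symmetric])
        finally show ?thesis by (rule add_left_imp_eq)
      qed
      then show ?thesis by (intro exI[of _ "Q x"] conjI n(1,2) ballI)
    qed
  qed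
qed

end

section \<open>Colourings by isometries\<close>

text \<open>\<open>Isom s v\<close> stands for \<open>x \<mapsto> (-1)\<^sup>s x + v\<close>; addition is composition.\<close>

datatype 'a isom = Isom (flip: bit) (shift: 'a)

definition signed :: "bit \<Rightarrow> 'a::ab_group_add \<Rightarrow> 'a" where
  "signed s v = (if s = 0 then v else - v)"

instantiation isom :: (ab_group_add) group_add
begin

definition zero_isom :: "'a isom" where "0 = Isom 0 0"
definition plus_isom :: "'a isom \<Rightarrow> 'a isom \<Rightarrow> 'a isom" where
  "p + q = Isom (flip p + flip q) (shift p + signed (flip p) (shift q))"
definition uminus_isom :: "'a isom \<Rightarrow> 'a isom" where
  "- p = Isom (flip p) (- signed (flip p) (shift p))"
definition minus_isom :: "'a isom \<Rightarrow> 'a isom \<Rightarrow> 'a isom" where "p - q = p + - (q :: 'a isom)"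

lemma bit_double: "(s :: bit) + s = 0" by (cases s) simp_all

instance
proof
  fix a b c :: "'a isom"
  have "flip a = 0 \<or> flip a = 1" "flip b = 0 \<or> flip b = 1" by (metis bit.exhaust)+
  then show "a + b + c = a + (b + c)"
    by (auto simp: plus_isom_def signed_def add.assoc)
  show "0 + a = a" "a + 0 = a" by (cases a; simp add: plus_isom_def zero_isom_def signed_def)+
  show "- a + a = 0" by (simp add: plus_isom_def zero_isom_def uminus_isom_def signed_def bit_double)
  show "a + - b = a - b" by (simp add: minus_isom_def)
qed

end

lemma flip_add: "flip (p + q) = flip p + flip q" and shift_add: "shift (p + q) = shift p + signed (flip p) (shift q)"
  by (simp_all add: plus_isom_def)

lemma flip_diff: "flip (p - q) = flip p + flip q"
  and shift_diff: "shift (p - q) = shift p - signed (flip p + flip q) (shift q)"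
  by (cases "flip p"; cases "flip q"; simp add: minus_isom_def uminus_isom_def plus_isom_def signed_def)+

text \<open>Two adjacent faces on the same side of the underpass share \<open>k1\<close> or
  \<open>k2\<close> with opposite signs, so its translation part drops out of their sum. Both sums
  equal \<open>shift g1 + shift g2\<close>.\<close>

lemma isom_crossing:
  fixes g1 g2 k1 k2 :: "'a::ab_group_add isom"
  assumes "flip g1 \<noteq> flip g2" "flip k1 \<noteq> flip k2"
  shows "shift (g1 - k1) + shift (g2 - k1) = shift (g2 - k2) + shift (g1 - k2)"
    "flip (g1 - k1) = flip (g2 - k2)" "flip (g2 - k1) = flip (g1 - k2)" "flip (g1 - k1) \<noteq> flip (g2 - k1)"
  using assms
  by (cases "flip g1"; cases "flip g2"; cases "flip k1"; cases "flip k2"; simp add: flip_diff shift_diff signed_def)+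

text \<open>Discrete fundamental theorem of calculus for a step function. The values of
  \<open>\<Psi>\<close> at the jump points themselves are arbitrary.\<close>

lemma jump_sum:
  fixes \<Psi> J :: "real \<Rightarrow> real"
  assumes A: "finite A" "A \<subseteq> {a<..<b}" and ab: "a \<le> b"
    and off: "\<And>x. x \<in> {a..b} - A \<Longrightarrow> \<exists>d>0. \<forall>y. \<bar>y - x\<bar> < d \<longrightarrow> \<Psi> y = \<Psi> x"
    and on: "\<And>x. x \<in> A \<Longrightarrow> \<exists>d>0. \<exists>l. (\<forall>y. x - d < y \<longrightarrow> y < x \<longrightarrow> \<Psi> y = l) \<and> (\<forall>y. x < y \<longrightarrow> y < x + d \<longrightarrow> \<Psi> y = l + J x)"
  shows "\<Psi> b - \<Psi> a = sum J A"
proof -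
  obtain l where l: "\<forall>x\<in>A. \<exists>d>0. (\<forall>y. x - d < y \<longrightarrow> y < x \<longrightarrow> \<Psi> y = l x) \<and> (\<forall>y. x < y \<longrightarrow> y < x + d \<longrightarrow> \<Psi> y = l x + J x)"
    using on by metis
  \<comment> \<open>Subtracting the jumps already passed removes all discontinuities; at a jump
    point the left limit \<open>l\<close> replaces the arbitrary value of
    \<open>\<Psi>\<close>.\<close>
  define \<Phi> where "\<Phi> y = (if y \<in> A then l y else \<Psi> y) - sum J {x \<in> A. x < y}" for y
  have "loc_const {a..b} \<Phi>"
    unfolding loc_const_def
  proof
    fix x assume x: "x \<in> {a..b}"
    obtain e where e: "0 < e" "\<forall>y\<in>A. y \<noteq> x \<longrightarrow> e \<le> dist x y"
      using finite_set_avoid[OF A(1), of x] by (elim exE conjE)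
    have eA: "y \<notin> A" if "\<bar>y - x\<bar> < e" "y \<noteq> x" for y
      using e(2) that by (auto simp: dist_real_def abs_minus_commute)
    show "\<exists>W. open W \<and> x \<in> W \<and> (\<forall>y\<in>W \<inter> {a..b}. \<Phi> y = \<Phi> x)"
    proof (cases "x \<in> A")
      case False
      then obtain d where d: "d > 0" "\<forall>y. \<bar>y - x\<bar> < d \<longrightarrow> \<Psi> y = \<Psi> x" using off x by blast
      have eq: "\<Phi> y = \<Phi> x" if "y \<in> ball x (min d e)" for y
      proof -
        have y: "\<bar>y - x\<bar> < d" "\<bar>y - x\<bar> < e" using that by (auto simp: dist_real_def abs_minus_commute)
        have "y \<notin> A" using eA[OF y(2)] False by (cases "y = x") auto
        moreover have "{z \<in> A. z < y} = {z \<in> A. z < x}"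
        proof (intro Collect_cong conj_cong refl)
          fix z assume "z \<in> A"
          then have "e \<le> \<bar>z - x\<bar>" using e(2) False by (auto simp: dist_real_def abs_minus_commute)
          then show "z < y \<longleftrightarrow> z < x" using y(2) by linarith
        qed
        moreover have "\<Psi> y = \<Psi> x" using d(2) y(1) by blast
        ultimately show ?thesis using False by (simp add: \<Phi>_def)
      qed
      have xb: "x \<in> ball x (min d e)" using d(1) e(1) by simp
      show ?thesis by (rule exI[of _ "ball x (min d e)"]) (intro conjI open_ball xb ballI eq, erule IntD1)
    next
      case True
      then obtain d where d: "d > 0" "\<forall>y. x - d < y \<longrightarrow> y < x \<longrightarrow> \<Psi> y = l x" "\<forall>y. x < y \<longrightarrow> y < x + d \<longrightarrow> \<Psi> y = l x + J x"
        using l by blast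
      have eq: "\<Phi> y = \<Phi> x" if "y \<in> ball x (min d e)" for y
      proof -
        have y: "\<bar>y - x\<bar> < d" "\<bar>y - x\<bar> < e" using that by (auto simp: dist_real_def abs_minus_commute)
        have zA: "e \<le> \<bar>z - x\<bar>" if "z \<in> A" "z \<noteq> x" for z
          using e(2) that by (auto simp: dist_real_def abs_minus_commute)
        consider "y = x" | "y < x" | "x < y" by linarith
        then show ?thesis
        proof cases
          case 2
          have "{z \<in> A. z < y} = {z \<in> A. z < x}"
          proof (intro Collect_cong conj_cong refl)
            fix z assume "z \<in> A"
            then show "z < y \<longleftrightarrow> z < x" using y(2) zA[of z] 2 by (cases "z = x") auto
          qed
          then show ?thesis using d(2) y eA[OF y(2)] 2 True by (simp add: \<Phi>_def)
        next
          case 3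
          have "{z \<in> A. z < y} = insert x {z \<in> A. z < x}"
          proof (intro set_eqI)
            fix z
            show "z \<in> {z \<in> A. z < y} \<longleftrightarrow> z \<in> insert x {z \<in> A. z < x}"
              using y(2) zA[of z] 3 True by (cases "z = x") auto
          qed
          then show ?thesis using d(3) y eA[OF y(2)] 3 True A(1) by (simp add: \<Phi>_def)
        qed simp
      qed
      have xb: "x \<in> ball x (min d e)" using d(1) e(1) by simp
      show ?thesis by (rule exI[of _ "ball x (min d e)"]) (intro conjI open_ball xb ballI eq, erule IntD1)
    qed
  qed
  then have "\<Phi> a = \<Phi> b" using ab by (intro loc_const_connected[of "{a..b}"]) auto
  moreover have "a \<notin> A" "b \<notin> A" using A(2) by auto
  moreover have "{x \<in> A. x < a} = {}" "{x \<in> A. x < b} = A" using A(2) by auto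
  ultimately show ?thesis by (simp add: \<Phi>_def)
qed

section \<open>Colours along a strand and its passages through crossings\<close>

context diagram_lift
begin

definition passage where "passage i s \<longleftrightarrow> strand D i s \<in> crossings D"

lemma passage_meet:
  assumes "i < ncomps D" "passage i s"
  obtains j t where "meet D i s j t"
proof -
  obtain k s0 j0 t0 where m: "meet D k s0 j0 t0" "strand D i s = strand D k s0"
    using assms(2) crossing_meet unfolding passage_def by metis
  show thesis
  proof (cases "k = i \<and> s0 - s \<in> \<int>")
    case False
    then have "meet D i s k s0" using m assms(1) meet_facts(1)[OF m(1)] unfolding meet_def
      by (metis Ints_minus minus_diff_eq)
    then show thesis by (rule that)
  next
    case True
    have "\<not> (i = j0 \<and> s - t0 \<in> \<int>)"
    proof
      assume "i = j0 \<and> s - t0 \<in> \<int>"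
      then have "k = j0" "s0 - t0 \<in> \<int>" using True Ints_add[of "s0 - s" "s - t0"] by auto
      then show False using m(1) by (simp add: meet_def)
    qed
    then have "meet D i s j0 t0" using m assms(1) meet_facts(2,3)[OF m(1)] unfolding meet_def by simp
    then show thesis by (rule that)
  qed
qed

lemma finite_translates: "finite {s \<in> {a..b}. s - c \<in> \<int>}" for a b c :: real
proof -
  have "{s \<in> {a..b}. s - c \<in> \<int>} \<subseteq> (\<lambda>k. c + of_int k) ` {\<lfloor>a - c\<rfloor>..\<lceil>b - c\<rceil>}"
  proof
    fix s assume "s \<in> {s \<in> {a..b}. s - c \<in> \<int>}"
    then obtain k where k: "s - c = of_int k" "a \<le> s" "s \<le> b" by (auto elim: Ints_cases)
    then have "\<lfloor>a - c\<rfloor> \<le> k" "k \<le> \<lceil>b - c\<rceil>" by linarith+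
    then show "s \<in> (\<lambda>k. c + of_int k) ` {\<lfloor>a - c\<rfloor>..\<lceil>b - c\<rceil>}"
      using k(1) by (intro image_eqI[of _ _ k]) auto
  qed
  then show ?thesis by (rule finite_subset) simp
qed

lemma finite_passages:
  assumes i: "i < ncomps D"
  shows "finite {s \<in> {a..b}. passage i s}"
proof -
  have fin: "finite (crossings D)" using diagram unfolding is_diagram_def by simp
  have "finite {s \<in> {a..b}. strand D i s = x}" if x: "x \<in> crossings D" for x
  proof -
    obtain k s0 j t0 where m: "meet D k s0 j t0" "x = strand D k s0" using x crossing_meet by metis
    have "{s \<in> {a..b}. strand D i s = x} \<subseteq> {s \<in> {a..b}. s - s0 \<in> \<int>} \<union> {s \<in> {a..b}. s - t0 \<in> \<int>}"
      using meet_fiber[OF m(1) i] m(2) by auto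
    then show ?thesis by (rule finite_subset) (intro finite_UnI finite_translates)
  qed
  then have "finite (\<Union>x\<in>crossings D. {s \<in> {a..b}. strand D i s = x})" using fin by blast
  moreover have "{s \<in> {a..b}. passage i s} \<subseteq> (\<Union>x\<in>crossings D. {s \<in> {a..b}. strand D i s = x})"
    by (auto simp: passage_def)
  ultimately show ?thesis by (rule finite_subset[rotated])
qed

lemma passages_isolated:
  assumes i: "i < ncomps D"
  obtains e where "0 < e" "\<forall>y. \<bar>y - s\<bar> < e \<longrightarrow> y \<noteq> s \<longrightarrow> \<not> passage i y"
proof -
  obtain e where e: "0 < e" "\<forall>y\<in>{y \<in> {s-1..s+1}. passage i y}. y \<noteq> s \<longrightarrow> e \<le> dist s y"
    using finite_set_avoid[OF finite_passages[OF i, of "s-1" "s+1"], of s] by (elim exE conjE)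
  have "\<not> passage i y" if y: "\<bar>y - s\<bar> < min e 1" "y \<noteq> s" for y
  proof
    assume "passage i y"
    moreover have "y \<in> {s-1..s+1}" "dist s y < e" using y(1) by (auto simp: dist_real_def)
    ultimately show False using e(2) y(2) by force
  qed
  then show thesis using that[of "min e 1"] e(1) by auto
qed

lemma edge_vals_const:
  assumes "i < ncomps D" "\<not> passage i s0" "loc_const (S2 - P) c"
  shows "\<exists>\<delta>>0. \<forall>s. \<bar>s - s0\<bar> < \<delta> \<longrightarrow> vals P c (strand D i s) = vals P c (strand D i s0)"
proof -
  have nc: "strand D i s0 \<notin> crossings D" using assms(2) by (simp add: passage_def)
  obtain W \<delta> a b where W: "strand D i s0 \<in> W" "0 < \<delta>" "\<forall>y\<in>W \<inter> P. vals P c y = {a, b}"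
    "\<forall>s. \<bar>s - s0\<bar> < \<delta> \<longrightarrow> strand D i s \<in> W"
    using edge_vals[OF assms(1) nc assms(3)] by (elim exE conjE)
  have inP: "strand D i s \<in> P" for s using assms(1) by (auto simp: P_def)
  show ?thesis using W inP by (intro exI[of _ \<delta>]) simp
qed

text \<open>Whether the two sides of the strand differ depends only on \<open>g1 = g2\<close> for
  the overpass and on \<open>k1 = k2\<close> for the underpass, while the passage changes the other
  letter.\<close>

lemma passage_vals:
  assumes coc: "local_cocycle X t" and f: "primitive U t f" and f': "primitive V t f'"
    and i: "i < ncomps D" and s0: "passage i s0"
  defines "c \<equiv> transition f f'"
  shows "\<exists>\<delta>>0. \<exists>a1 a2 b1 b2. (\<forall>s. s0 < s \<longrightarrow> s < s0 + \<delta> \<longrightarrow> vals P c (strand D i s) = {a1, a2}) \<and>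
    (\<forall>s. s0 - \<delta> < s \<longrightarrow> s < s0 \<longrightarrow> vals P c (strand D i s) = {b1, b2}) \<and> (a1 = a2 \<longleftrightarrow> b1 = b2)"
proof -
  obtain j t0 where m: "meet D i s0 j t0" by (rule passage_meet[OF i s0])
  show ?thesis
  proof (cases "over D i s0")
    case True
    obtain \<delta> g1 g2 k1 k2 where "0 < \<delta>"
      "\<forall>s. s0 < s \<longrightarrow> s < s0 + \<delta> \<longrightarrow> vals P c (strand D i s) = {g1 - k1, g2 - k1}"
      "\<forall>s. s0 - \<delta> < s \<longrightarrow> s < s0 \<longrightarrow> vals P c (strand D i s) = {g1 - k2, g2 - k2}"
      using crossing_vals[OF coc f f' m True] unfolding c_def by (elim exE conjE)
    moreover have "g1 - k1 = g2 - k1 \<longleftrightarrow> g1 - k2 = g2 - k2"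
      by (simp only: diff_conv_add_uminus add_right_cancel)
    ultimately show ?thesis
      by (intro exI[of _ \<delta>] conjI exI[of _ "g1 - k1"] exI[of _ "g2 - k1"] exI[of _ "g1 - k2"] exI[of _ "g2 - k2"])
  next
    case False
    then have ov: "over D j t0" using meet_facts(5)[OF m] by simp
    obtain \<delta> g1 g2 k1 k2 where "0 < \<delta>"
      "\<forall>s. s0 < s \<longrightarrow> s < s0 + \<delta> \<longrightarrow> vals P c (strand D i s) = {g1 - k1, g1 - k2}"
      "\<forall>s. s0 - \<delta> < s \<longrightarrow> s < s0 \<longrightarrow> vals P c (strand D i s) = {g2 - k1, g2 - k2}"
      using crossing_vals[OF coc f f' meet_sym[OF m] ov] unfolding c_def by (elim exE conjE)
    moreover have "g1 - k1 = g1 - k2 \<longleftrightarrow> g2 - k1 = g2 - k2"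
      by (simp only: diff_conv_add_uminus add_left_cancel neg_equal_iff_equal)
    ultimately show ?thesis
      by (intro exI[of _ \<delta>] conjI exI[of _ "g1 - k1"] exI[of _ "g1 - k2"] exI[of _ "g2 - k1"] exI[of _ "g2 - k2"])
  qed
qed

text \<open>At a point that is no crossing one or two colours are seen, so this says that the colour
  changes across the strand. It survives passages and does not depend on the choice of
  primitives.\<close>

definition two_sided where "two_sided c i s \<longleftrightarrow> \<not> (\<exists>g. vals P c (strand D i s) = {g})"

text \<open>The indicator of this property is a step function along the strand all of whose jumps
  are 0.\<close>

lemma two_sided_const:
  assumes coc: "local_cocycle X t" and f: "primitive U t f" and f': "primitive V t f'"
    and i: "i < ncomps D" and s: "\<not> passage i s" "\<not> passage i s'"
  shows "two_sided (transition f f') i s \<longleftrightarrow> two_sided (transition f f') i s'"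
proof -
  let ?c = "transition f f'"
  have lc: "loc_const (S2 - P) ?c" using transition_loc_const(1)[OF f f'] by (simp add: transition_def[abs_def])
  have *: "two_sided ?c i a \<longleftrightarrow> two_sided ?c i b" if ab: "a \<le> b" "\<not> passage i a" "\<not> passage i b" for a b
  proof -
    define \<Psi> :: "real \<Rightarrow> real" where "\<Psi> s = of_bool (two_sided ?c i s)" for s
    have "\<Psi> b - \<Psi> a = sum (\<lambda>_. 0) {s \<in> {a..b}. passage i s}"
    proof (rule jump_sum[OF finite_passages[OF i] _ ab(1)])
      show "{s \<in> {a..b}. passage i s} \<subseteq> {a<..<b}" using ab by (auto simp: order.order_iff_strict)
    next
      fix x assume "x \<in> {a..b} - {s \<in> {a..b}. passage i s}"
      then have "\<not> passage i x" by auto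
      obtain d where "d > 0" "\<forall>s. \<bar>s - x\<bar> < d \<longrightarrow> vals P ?c (strand D i s) = vals P ?c (strand D i x)"
        using edge_vals_const[OF i \<open>\<not> passage i x\<close> lc] by (elim exE conjE)
      then have d: "d > 0" "\<And>y. \<bar>y - x\<bar> < d \<Longrightarrow> vals P ?c (strand D i y) = vals P ?c (strand D i x)" by blast+
      have "\<Psi> y = \<Psi> x" if "\<bar>y - x\<bar> < d" for y
        unfolding \<Psi>_def two_sided_def by (rule arg_cong[OF d(2)[OF that], of "\<lambda>v. of_bool (\<not> (\<exists>g. v = {g}))"])
      then show "\<exists>d>0. \<forall>y. \<bar>y - x\<bar> < d \<longrightarrow> \<Psi> y = \<Psi> x" using d(1) by blast
    next
      fix x assume "x \<in> {s \<in> {a..b}. passage i s}"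
      then have "passage i x" by simp
      obtain \<delta> a1 a2 b1 b2 where v: "\<delta> > 0" "\<forall>s. x < s \<longrightarrow> s < x + \<delta> \<longrightarrow> vals P ?c (strand D i s) = {a1, a2}"
        "\<forall>s. x - \<delta> < s \<longrightarrow> s < x \<longrightarrow> vals P ?c (strand D i s) = {b1, b2}" "a1 = a2 \<longleftrightarrow> b1 = b2"
        using passage_vals[OF coc f f' i \<open>passage i x\<close>] by (elim exE conjE)
      have "(\<exists>g. {a1, a2} = {g}) \<longleftrightarrow> a1 = a2" "(\<exists>g. {b1, b2} = {g}) \<longleftrightarrow> b1 = b2" by auto
      then show "\<exists>d>0. \<exists>l. (\<forall>y. x - d < y \<longrightarrow> y < x \<longrightarrow> \<Psi> y = l) \<and> (\<forall>y. x < y \<longrightarrow> y < x + d \<longrightarrow> \<Psi> y = l + 0)"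
        using v by (intro exI[of _ \<delta>] conjI exI[of _ "of_bool (b1 \<noteq> b2)"]) (auto simp: \<Psi>_def two_sided_def)
    qed
    then have "\<Psi> b = \<Psi> a" by simp
    then show ?thesis unfolding \<Psi>_def of_bool_eq_iff by (rule sym)
  qed
  show ?thesis
  proof (cases "s \<le> s'")
    case True
    show ?thesis by (rule *[OF True s])
  next
    case False
    then have "s' \<le> s" by simp
    show ?thesis by (rule *[OF \<open>s' \<le> s\<close> s(2,1), symmetric])
  qed
qed

lemma nonpassage_between:
  assumes i: "i < ncomps D" and "a < b"
  obtains s where "a < s" "s < b" "\<not> passage i s"
proof -
  have "infinite {a<..<b}" using assms(2) by (rule infinite_Ioo)
  then have "infinite ({a<..<b} - {s \<in> {a..b}. passage i s})" using finite_passages[OF i] by (metis Diff_infinite_finite)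
  then obtain s where "s \<in> {a<..<b} - {s \<in> {a..b}. passage i s}" by (metis ex_in_conv finite.emptyI)
  then show thesis using that by auto
qed

end

section \<open>Energy of a colouring of an alternating diagram\<close>

text \<open>Such a pair on the two sides of a strand means that the meridian of the strand acts as a
  point reflection. At a crossing of such strands it means that opposite faces have equal
  colours.\<close>

definition reflection_pair :: "'a isom set \<Rightarrow> bool" where
  "reflection_pair E \<longleftrightarrow> (\<exists>a b. E = {Isom 0 a, Isom 1 b})"

lemma reflection_pair_insert: "reflection_pair {g, g'} \<longleftrightarrow> flip g \<noteq> flip g'"
proof
  assume "reflection_pair {g, g'}"
  then obtain a b where "{g, g'} = {Isom 0 a, Isom 1 b}" unfolding reflection_pair_def by (elim exE)
  then show "flip g \<noteq> flip g'" by (auto simp: doubleton_eq_iff)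
next
  assume ne: "flip g \<noteq> flip g'"
  have "flip g = 0 \<and> flip g' = 1 \<or> flip g = 1 \<and> flip g' = 0"
  proof -
    have "b = 0 \<or> b = 1" for b :: bit by (metis bit.exhaust)
    then show ?thesis using ne by metis
  qed
  then show "reflection_pair {g, g'}"
  proof (elim disjE conjE)
    assume "flip g = 0" "flip g' = 1"
    then have "{g, g'} = {Isom 0 (shift g), Isom 1 (shift g')}" by (metis isom.collapse)
    then show ?thesis unfolding reflection_pair_def by blast
  next
    assume "flip g = 1" "flip g' = 0"
    then have "{g, g'} = {Isom 0 (shift g'), Isom 1 (shift g)}" by (metis insert_commute isom.collapse)
    then show ?thesis unfolding reflection_pair_def by blast
  qed
qed

lemma reflection_pair_subset_eq:
  assumes "reflection_pair E" "{g, g'} \<subseteq> E" "flip g \<noteq> flip g'"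
  shows "{g, g'} = E"
proof -
  obtain a b where E: "E = {Isom 0 a, Isom 1 b}" using assms(1) unfolding reflection_pair_def by (elim exE)
  then have "g = Isom 0 a \<or> g = Isom 1 b" "g' = Isom 0 a \<or> g' = Isom 1 b" using assms(2) by auto
  then show ?thesis using E assms(3) by auto
qed

text \<open>The colouring belongs to \<open>D\<close>, whereas alternation holds after changing
  \<open>p\<close>. The assumption \<open>at_p\<close> is what the choice of the functional
  achieves: opposite faces at \<open>p\<close> agree, so this crossing has no energy.\<close>

locale alternating_colouring = diagram_lift D h for D h +
  fixes t :: "(real^3) \<times> real \<Rightarrow> (real^3) \<times> real \<Rightarrow> real isom" and f f' p
  assumes coc: "local_cocycle X t" and prim: "primitive U t f" "primitive V t f'"
    and p: "p \<in> crossings D" and alternating: "alternating (change_crossing D p)"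
    and flips: "\<And>i s. i < ncomps D \<Longrightarrow> \<not> passage i s \<Longrightarrow> reflection_pair (vals P (transition f f') (strand D i s))"
    and at_p: "reflection_pair (vals P (transition f f') p)"
begin

abbreviation c where "c \<equiv> transition f f'"

lemma c_loc_const: "loc_const (S2 - P) c"
  using transition_loc_const(1)[OF prim] by (simp add: transition_def[abs_def])

text \<open>Over and under as in the changed diagram. It governs the signs in the sum; the colours
  still obey the relation of \<open>D\<close> at \<open>p\<close>.\<close>

definition overpass where "overpass i s \<longleftrightarrow> (if strand D i s = p then \<not> over D i s else over D i s)"

lemma overpass_alternates:
  assumes "i < ncomps D" "s < u" "passage i s" "passage i u" "\<And>y. s < y \<Longrightarrow> y < u \<Longrightarrow> \<not> passage i y"
  shows "overpass i s \<longleftrightarrow> \<not> overpass i u"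
proof -
  have [simp]: "ncomps (change_crossing D p) = ncomps D" "strand (change_crossing D p) = strand D"
    by (simp_all add: change_crossing_def)
  have cr: "crossings (change_crossing D p) = crossings D"
    by (simp add: crossings_def meet_def)
  have ov: "over (change_crossing D p) = overpass"
    by (simp add: change_crossing_def overpass_def fun_eq_iff)
  have "\<forall>i<ncomps D. \<forall>s t. s < t \<and> passage i s \<and> passage i t \<and> (\<forall>u. s < u \<and> u < t \<longrightarrow> \<not> passage i u) \<longrightarrow>
      overpass i s \<noteq> overpass i t"
    using alternating unfolding alternating_def ov cr by (simp add: passage_def)
  then show ?thesis using assms by blast
qed

text \<open>Defined at every parameter, this determines the sign with which the product at that parameter
  enters the telescoping sum.\<close>

definition next_over where
  "next_over i s \<longleftrightarrow> (\<exists>u>s. passage i u \<and> (\<forall>y. s < y \<longrightarrow> y < u \<longrightarrow> \<not> passage i y) \<and> overpass i u)"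

lemma next_over_iff:
  assumes "s < u" "passage i u" "\<And>y. s < y \<Longrightarrow> y < u \<Longrightarrow> \<not> passage i y"
  shows "next_over i s \<longleftrightarrow> overpass i u"
proof
  assume "next_over i s"
  then obtain w where w: "s < w" "passage i w" "\<forall>y. s < y \<longrightarrow> y < w \<longrightarrow> \<not> passage i y" "overpass i w"
    unfolding next_over_def by (elim exE conjE)
  have "\<not> u < w" using w(3) assms(1,2) by blast
  moreover have "\<not> w < u" using assms(3) w(1,2) by blast
  ultimately show "overpass i u" using w(4) by (simp add: antisym_conv3)
next
  assume "overpass i u"
  then show "next_over i s" unfolding next_over_def using assms by blast
qed

lemma next_over_near:
  assumes "next_over i a" "\<bar>a - s\<bar> < e" "\<bar>b - s\<bar> < e" "\<forall>y. \<bar>y - s\<bar> < e \<longrightarrow> \<not> passage i y"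
  shows "next_over i b"
proof -
  obtain u where u: "a < u" "passage i u" "\<forall>y. a < y \<longrightarrow> y < u \<longrightarrow> \<not> passage i y" "overpass i u"
    using assms(1) unfolding next_over_def by (elim exE conjE)
  have "\<not> \<bar>u - s\<bar> < e" using assms(4) u(2) by blast
  then have bu: "s + e \<le> u" using u(1) assms(2) by linarith
  have "\<not> passage i y" if y: "b < y" "y < u" for y
  proof (cases "a < y")
    case True then show ?thesis using u(3) y by blast
  next
    case False
    then have "\<bar>y - s\<bar> < e" using y assms(2,3) by linarith
    then show ?thesis using assms(4) by blast
  qed
  moreover have "b < u" using bu assms(3) by linarith
  ultimately show ?thesis unfolding next_over_def using u(2,4) by blast
qed

lemma next_passage:
  assumes i: "i < ncomps D" and x: "passage i x"
  obtains u where "x < u" "passage i u" "\<forall>y. x < y \<longrightarrow> y < u \<longrightarrow> \<not> passage i y"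
proof -
  \<comment> \<open>\<open>x + 1\<close> is a passage again, so one period contains a later passage,
    and finiteness singles out the first.\<close>
  define S where "S = {y \<in> {x..x+1}. passage i y} - {x}"
  have fin: "finite S" unfolding S_def using finite_passages[OF i] by blast
  have "passage i (x + 1)" using x strand_facts(2)[OF i] by (simp add: passage_def)
  then have "x + 1 \<in> S" by (simp add: S_def)
  then have ne: "S \<noteq> {}" by blast
  have "Min S \<in> S" by (rule Min_in[OF fin ne])
  then have 1: "x < Min S" "passage i (Min S)" "Min S \<le> x + 1" by (auto simp: S_def)
  have "\<not> passage i y" if y: "x < y" "y < Min S" for y
  proof
    assume "passage i y"
    then have "y \<in> S" using y 1(3) by (auto simp: S_def)
    then show False using Min_le[OF fin] y by fastforce
  qed
  then show thesis using that 1 by blast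
qed

text \<open>For a reflection pair the product over the set is the product over the two sides: the
  flips differ, so equal weights are not merged.\<close>

definition side_product where "side_product i s = (\<Prod>g\<in>vals P c (strand D i s). shift g)"

definition one_sided where
  "one_sided i x q q' \<longleftrightarrow> (\<exists>\<delta>>0. (\<forall>s. x < s \<longrightarrow> s < x + \<delta> \<longrightarrow> side_product i s = q) \<and>
     (\<forall>s. x - \<delta> < s \<longrightarrow> s < x \<longrightarrow> side_product i s = q'))"

text \<open>The products just after and just before the passage are added, not subtracted, because
  the sign of the product in the telescoping sum changes at the passage.\<close>

definition side_sum where "side_sum i x = (THE r. \<exists>q q'. one_sided i x q q' \<and> r = q + q')"

lemma side_sum_eq:
  assumes "one_sided i x q q'"
  shows "side_sum i x = q + q'"
proof -
  have "w = q \<and> w' = q'" if "one_sided i x w w'" for w w'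
  proof -
    obtain \<delta> where d: "\<delta> > 0" "\<forall>s. x < s \<longrightarrow> s < x + \<delta> \<longrightarrow> side_product i s = q"
      "\<forall>s. x - \<delta> < s \<longrightarrow> s < x \<longrightarrow> side_product i s = q'"
      using assms unfolding one_sided_def by (elim exE conjE)
    obtain \<epsilon> where e: "\<epsilon> > 0" "\<forall>s. x < s \<longrightarrow> s < x + \<epsilon> \<longrightarrow> side_product i s = w"
      "\<forall>s. x - \<epsilon> < s \<longrightarrow> s < x \<longrightarrow> side_product i s = w'"
      using \<open>one_sided i x w w'\<close> unfolding one_sided_def by (elim exE conjE)
    define r where "r = min \<delta> \<epsilon> / 2"
    have "0 < r" "r < \<delta>" "r < \<epsilon>" using d(1) e(1) by (auto simp: r_def)
    then show ?thesis using d(2)[rule_format, of "x + r"] d(3)[rule_format, of "x - r"]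
        e(2)[rule_format, of "x + r"] e(3)[rule_format, of "x - r"] by simp
  qed
  then show ?thesis unfolding side_sum_def using assms by (intro the_equality) blast+
qed

lemma one_sided_exists:
  assumes i: "i < ncomps D" and x: "passage i x"
  shows "\<exists>q q'. one_sided i x q q'"
proof -
  obtain \<delta> a1 a2 b1 b2 where v: "0 < \<delta>"
      "\<forall>s. x < s \<longrightarrow> s < x + \<delta> \<longrightarrow> vals P c (strand D i s) = {a1, a2}"
      "\<forall>s. x - \<delta> < s \<longrightarrow> s < x \<longrightarrow> vals P c (strand D i s) = {b1, b2}"
    using passage_vals[OF coc prim i x] by (elim exE conjE)
  have "one_sided i x (\<Prod>g\<in>{a1, a2}. shift g) (\<Prod>g\<in>{b1, b2}. shift g)"
    unfolding one_sided_def side_product_def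
  proof (intro exI[of _ \<delta>] conjI v(1) allI impI)
    fix s
    show "(\<Prod>g\<in>vals P c (strand D i s). shift g) = (\<Prod>g\<in>{a1, a2}. shift g)" if "x < s" "s < x + \<delta>"
      by (rule arg_cong[OF v(2)[rule_format, OF that]])
    show "(\<Prod>g\<in>vals P c (strand D i s). shift g) = (\<Prod>g\<in>{b1, b2}. shift g)" if "x - \<delta> < s" "s < x"
      by (rule arg_cong[OF v(3)[rule_format, OF that]])
  qed
  then show ?thesis by blast
qed

definition sign where "sign i s = (if overpass i s then 1 else - 1 :: real)"

text \<open>The product of the two side weights gets a sign according to whether the next passage is
  over or under. Alternation reverses this sign at every passage, so the jump there is minus the
  signed side sum, and over one period the jumps of a periodic function cancel.\<close>

lemma strand_sum_zero:
  assumes i: "i < ncomps D" and r: "\<not> passage i r"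
  shows "(\<Sum>x\<in>{x \<in> {r..r+1}. passage i x}. sign i x * side_sum i x) = 0"
proof -
  define \<Psi> where "\<Psi> s = (if next_over i s then side_product i s else - side_product i s)" for s
  have sh: "strand D i (s + 1) = strand D i s" for s by (rule strand_facts(2)[OF i])
  have psh: "passage i (s + 1) \<longleftrightarrow> passage i s" for s by (simp add: passage_def sh)
  have osh: "overpass i (s + 1) \<longleftrightarrow> overpass i s" for s by (simp add: overpass_def sh strand_facts(5)[OF i])
  have r1: "\<not> passage i (r + 1)" using r psh by simp
  have nsh: "next_over i (r + 1) \<longleftrightarrow> next_over i r"
  proof
    assume "next_over i (r + 1)"
    then obtain u where u: "r + 1 < u" "passage i u" "\<forall>y. r + 1 < y \<longrightarrow> y < u \<longrightarrow> \<not> passage i y" "overpass i u"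
      unfolding next_over_def by (elim exE conjE)
    show "next_over i r"
      unfolding next_over_def
    proof (intro exI[of _ "u - 1"] conjI allI impI)
      show "passage i (u - 1)" using psh[of "u - 1"] u(2) by simp
      show "overpass i (u - 1)" using osh[of "u - 1"] u(4) by simp
      fix y assume "r < y" "y < u - 1"
      then have "\<not> passage i (y + 1)" using u(3)[rule_format, of "y + 1"] by simp
      then show "\<not> passage i y" using psh by simp
    qed (use u in simp)
  next
    assume "next_over i r"
    then obtain u where u: "r < u" "passage i u" "\<forall>y. r < y \<longrightarrow> y < u \<longrightarrow> \<not> passage i y" "overpass i u"
      unfolding next_over_def by (elim exE conjE)
    show "next_over i (r + 1)"
      unfolding next_over_def
    proof (intro exI[of _ "u + 1"] conjI allI impI)
      fix y assume "r + 1 < y" "y < u + 1"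
      then have "\<not> passage i (y - 1)" using u(3)[rule_format, of "y - 1"] by simp
      then show "\<not> passage i y" using psh[of "y - 1"] by simp
    qed (use u psh osh in simp_all)
  qed
  have "\<Psi> (r + 1) - \<Psi> r = (\<Sum>x\<in>{x \<in> {r..r+1}. passage i x}. - (sign i x * side_sum i x))"
  proof (rule jump_sum[where \<Psi> = \<Psi> and a = r and b = "r + 1" and J = "\<lambda>x. - (sign i x * side_sum i x)"])
    show "finite {x \<in> {r..r+1}. passage i x}" by (rule finite_passages[OF i])
    show "{x \<in> {r..r+1}. passage i x} \<subseteq> {r<..<r+1}"
    proof
      fix x assume x: "x \<in> {x \<in> {r..r+1}. passage i x}"
      then have "x \<noteq> r" "x \<noteq> r + 1" using r r1 by auto
      then show "x \<in> {r<..<r+1}" using x by auto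
    qed
  next
    fix x assume "x \<in> {r..r+1} - {x \<in> {r..r+1}. passage i x}"
    then have x: "\<not> passage i x" by auto
    obtain d where d: "d > 0" "\<forall>s. \<bar>s - x\<bar> < d \<longrightarrow> vals P c (strand D i s) = vals P c (strand D i x)"
      using edge_vals_const[OF i x c_loc_const] by (elim exE conjE)
    obtain e where e: "0 < e" "\<forall>y. \<bar>y - x\<bar> < e \<longrightarrow> y \<noteq> x \<longrightarrow> \<not> passage i y" by (rule passages_isolated[OF i])
    have none: "\<forall>y. \<bar>y - x\<bar> < e \<longrightarrow> \<not> passage i y" using e(2) x by metis
    have "\<Psi> y = \<Psi> x" if y: "\<bar>y - x\<bar> < min d e" for y
    proof -
      have "\<bar>y - x\<bar> < d" using y by simp
      then have "side_product i y = side_product i x"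
        unfolding side_product_def by (rule arg_cong[OF d(2)[rule_format]])
      moreover have "next_over i y \<longleftrightarrow> next_over i x"
        using next_over_near[of i y x e x] next_over_near[of i x x e y] none y e(1) by auto
      ultimately show ?thesis unfolding \<Psi>_def by argo
    qed
    moreover have "0 < min d e" using d(1) e(1) by simp
    ultimately show "\<exists>d>0. \<forall>y. \<bar>y - x\<bar> < d \<longrightarrow> \<Psi> y = \<Psi> x" by blast
  next
    fix x assume "x \<in> {x \<in> {r..r+1}. passage i x}"
    then have x: "passage i x" by simp
    obtain q q' where q: "one_sided i x q q'" using one_sided_exists[OF i x] by (elim exE)
    obtain \<delta> where d: "\<delta> > 0" "\<forall>s. x < s \<longrightarrow> s < x + \<delta> \<longrightarrow> side_product i s = q"
      "\<forall>s. x - \<delta> < s \<longrightarrow> s < x \<longrightarrow> side_product i s = q'"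
      using q unfolding one_sided_def by (elim exE conjE)
    obtain e where e: "0 < e" "\<forall>y. \<bar>y - x\<bar> < e \<longrightarrow> y \<noteq> x \<longrightarrow> \<not> passage i y" by (rule passages_isolated[OF i])
    obtain u where u: "x < u" "passage i u" "\<forall>y. x < y \<longrightarrow> y < u \<longrightarrow> \<not> passage i y" by (rule next_passage[OF i x])
    have alt: "overpass i x \<longleftrightarrow> \<not> overpass i u" by (rule overpass_alternates[OF i u(1) x u(2)]) (use u(3) in blast)
    \<comment> \<open>Just before \<open>x\<close> the next passage is \<open>x\<close> itself, just
      after it is \<open>u\<close>; these are of opposite type by alternation.\<close>
    have left: "\<Psi> y = sign i x * q'" if y: "x - min \<delta> e < y" "y < x" for y
    proof -
      have "next_over i y \<longleftrightarrow> overpass i x" by (rule next_over_iff[OF y(2) x]) (use e(2) y in auto)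
      then show ?thesis using d(3)[rule_format, of y] y by (simp add: \<Psi>_def sign_def)
    qed
    have right: "\<Psi> y = - (sign i x * q)" if y: "x < y" "y < x + min \<delta> e" for y
    proof -
      have "\<bar>y - x\<bar> < e" using y by auto
      then have "\<not> passage i z" if "x < z" "z \<le> y" for z using e(2) that by auto
      then have "\<not> u \<le> y" using u(1,2) by blast
      then have "y < u" by simp
      then have "next_over i y \<longleftrightarrow> overpass i u" by (rule next_over_iff[OF _ u(2)]) (use u(3) y in auto)
      then show ?thesis using d(2)[rule_format, of y] y alt by (simp add: \<Psi>_def sign_def)
    qed
    show "\<exists>d>0. \<exists>l. (\<forall>y. x - d < y \<longrightarrow> y < x \<longrightarrow> \<Psi> y = l) \<and>
        (\<forall>y. x < y \<longrightarrow> y < x + d \<longrightarrow> \<Psi> y = l + - (sign i x * side_sum i x))"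
    proof (rule exI[of _ "min \<delta> e"], intro conjI exI[of _ "sign i x * q'"] allI impI)
      fix y assume "x < y" "y < x + min \<delta> e"
      then show "\<Psi> y = sign i x * q' + - (sign i x * side_sum i x)"
        unfolding side_sum_eq[OF q] by (simp add: right algebra_simps)
    qed (use left d(1) e(1) in auto)
  qed simp
  moreover have "\<Psi> (r + 1) = \<Psi> r" unfolding \<Psi>_def side_product_def sh nsh by (rule refl)
  ultimately show ?thesis by (simp add: sum_negf)
qed

text \<open>With the faces in cyclic order A, B, C, D the difference of the two sums is
  \<open>(wA - wC) * (wB - wD)\<close>, and the crossing relation turns this into minus a square.
  The square vanishes iff opposite faces have equal weights.\<close>

lemma crossing_energy:
  assumes m: "meet D i s0 j t0" and ov: "over D i s0"
  shows "side_sum i s0 \<le> side_sum j t0"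
    "side_sum i s0 = side_sum j t0 \<longleftrightarrow> reflection_pair (vals P c (strand D i s0))"
proof -
  note mf = meet_facts[OF m]
  obtain \<delta> g1 g2 k1 k2 where \<delta>: "0 < \<delta>"
    and vx: "vals P c (strand D i s0) = {g1 - k1, g1 - k2, g2 - k1, g2 - k2}"
    and v1: "\<forall>s. s0 < s \<longrightarrow> s < s0 + \<delta> \<longrightarrow> vals P c (strand D i s) = {g1 - k1, g2 - k1}"
    and v2: "\<forall>s. s0 - \<delta> < s \<longrightarrow> s < s0 \<longrightarrow> vals P c (strand D i s) = {g1 - k2, g2 - k2}"
    and v3: "\<forall>s. t0 < s \<longrightarrow> s < t0 + \<delta> \<longrightarrow> vals P c (strand D j s) = {g1 - k1, g1 - k2}"
    and v4: "\<forall>s. t0 - \<delta> < s \<longrightarrow> s < t0 \<longrightarrow> vals P c (strand D j s) = {g2 - k1, g2 - k2}"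
    using crossing_vals[OF coc prim m ov] by (elim exE conjE)
  obtain s where s: "s0 < s" "s < s0 + \<delta>" "\<not> passage i s"
    by (rule nonpassage_between[OF mf(1), of s0 "s0 + \<delta>"]) (use \<delta> in auto)
  have "flip (g1 - k1) \<noteq> flip (g2 - k1)"
    using flips[OF mf(1) s(3)] v1 s(1,2) by (simp only: reflection_pair_insert simp_thms)
  then have fg: "flip g1 \<noteq> flip g2" by (auto simp: flip_diff)
  obtain u where u: "t0 < u" "u < t0 + \<delta>" "\<not> passage j u"
    by (rule nonpassage_between[OF mf(2), of t0 "t0 + \<delta>"]) (use \<delta> in auto)
  have "flip (g1 - k1) \<noteq> flip (g1 - k2)"
    using flips[OF mf(2) u(3)] v3 u(1,2) by (simp only: reflection_pair_insert simp_thms)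
  then have fk: "flip k1 \<noteq> flip k2" by (auto simp: flip_diff)
  note ic = isom_crossing[OF fg fk]
  define wA wB wC wD where "wA = shift (g1 - k1)" and "wB = shift (g2 - k1)" and "wC = shift (g2 - k2)" and "wD = shift (g1 - k2)"
  have prod2: "(\<Prod>g\<in>{a, b}. shift g) = shift a * shift b" if "flip a \<noteq> flip b" for a b :: "real isom"
    using that by (subst prod.insert) auto
  have fl: "flip (g1 - k1) \<noteq> flip (g2 - k1)" "flip (g1 - k2) \<noteq> flip (g2 - k2)"
    "flip (g1 - k1) \<noteq> flip (g1 - k2)" "flip (g2 - k1) \<noteq> flip (g2 - k2)"
    using fg fk by (auto simp: flip_diff)
  have os1: "one_sided i s0 (wA * wB) (wD * wC)"
    unfolding one_sided_def
  proof (intro exI[of _ \<delta>] conjI \<delta> allI impI)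
    fix s
    show "side_product i s = wA * wB" if "s0 < s" "s < s0 + \<delta>"
      unfolding side_product_def v1[rule_format, OF that] prod2[OF fl(1)] wA_def wB_def by (rule refl)
    show "side_product i s = wD * wC" if "s0 - \<delta> < s" "s < s0"
      unfolding side_product_def v2[rule_format, OF that] prod2[OF fl(2)] wC_def wD_def by (rule refl)
  qed
  have os2: "one_sided j t0 (wA * wD) (wB * wC)"
    unfolding one_sided_def
  proof (intro exI[of _ \<delta>] conjI \<delta> allI impI)
    fix s
    show "side_product j s = wA * wD" if "t0 < s" "s < t0 + \<delta>"
      unfolding side_product_def v3[rule_format, OF that] prod2[OF fl(3)] wA_def wD_def by (rule refl)
    show "side_product j s = wB * wC" if "t0 - \<delta> < s" "s < t0"
      unfolding side_product_def v4[rule_format, OF that] prod2[OF fl(4)] wC_def wB_def by (rule refl)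
  qed
  have rel: "wA - wC = wD - wB" using ic(1) by (simp add: wA_def wB_def wC_def wD_def)
  have diff: "side_sum i s0 - side_sum j t0 = - (wA - wC)\<^sup>2"
  proof -
    have "side_sum i s0 - side_sum j t0 = (wA - wC) * (wB - wD)"
      unfolding side_sum_eq[OF os1] side_sum_eq[OF os2] by (simp add: algebra_simps)
    also have "wB - wD = - (wA - wC)" using rel by simp
    finally show ?thesis by (simp only: power2_eq_square mult_minus_right)
  qed
  then show "side_sum i s0 \<le> side_sum j t0" using zero_le_power2[of "wA - wC"] by linarith
  have "side_sum i s0 = side_sum j t0 \<longleftrightarrow> wA = wC" using diff by auto
  also have "\<dots> \<longleftrightarrow> reflection_pair (vals P c (strand D i s0))"
  proof
    assume "wA = wC"
    then have "g1 - k1 = g2 - k2" "g2 - k1 = g1 - k2"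
      using ic(2,3) rel by (simp_all add: isom.expand wA_def wB_def wC_def wD_def)
    then have "{g1 - k1, g1 - k2, g2 - k1, g2 - k2} = {g1 - k1, g2 - k1}" by auto
    then show "reflection_pair (vals P c (strand D i s0))" using fl(1) vx by (simp only: reflection_pair_insert simp_thms)
  next
    assume "reflection_pair (vals P c (strand D i s0))"
    then obtain a b where ab: "{g1 - k1, g1 - k2, g2 - k1, g2 - k2} = {Isom 0 a, Isom 1 b}"
      unfolding reflection_pair_def vx by (elim exE)
    then have "g1 - k1 \<in> {Isom 0 a, Isom 1 b}" "g2 - k2 \<in> {Isom 0 a, Isom 1 b}" by (simp_all flip: ab)
    then have "g1 - k1 = g2 - k2" using ic(2) by auto
    then show "wA = wC" by (simp add: wA_def wC_def)
  qed
  finally show "side_sum i s0 = side_sum j t0 \<longleftrightarrow> reflection_pair (vals P c (strand D i s0))" .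
qed


lemma common_nonpassage: "\<exists>r. \<forall>i<ncomps D. \<not> passage i r"
proof -
  have "finite (\<Union>i<ncomps D. {s \<in> {0..1}. passage i s})" using finite_passages by blast
  moreover have "infinite {0<..<(1::real)}" by (rule infinite_Ioo) simp
  ultimately have "infinite ({0<..<1} - (\<Union>i<ncomps D. {s \<in> {0..1}. passage i s}))" by (metis Diff_infinite_finite)
  then obtain r where "r \<in> {0<..<1} - (\<Union>i<ncomps D. {s \<in> {0..1}. passage i s})" by (metis ex_in_conv finite.emptyI)
  then show ?thesis by (intro exI[of _ r]) auto
qed

lemma meet_shift:
  assumes "meet D i s j u"
  shows "meet D i (s + of_int m) j (u + of_int m')"
proof -
  note mf = meet_facts[OF assms]
  have "s - u \<in> \<int>" if "s + of_int m - (u + of_int m') \<in> \<int>"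
  proof -
    have "s - u = (s + of_int m - (u + of_int m')) + of_int (m' - m)" by simp
    then show ?thesis using that by (metis Ints_add Ints_of_int)
  qed
  then show ?thesis using assms strand_shift[OF mf(1)] strand_shift[OF mf(2)] unfolding meet_def by auto
qed

text \<open>A half-open window of length 1 contains each parameter modulo 1 once, so every crossing
  can be counted as exactly two passages.\<close>

lemma meet_in_window:
  assumes "x \<in> crossings D"
  obtains i s j u where "meet D i s j u" "over D i s" "\<not> over D j u" "x = strand D i s"
    "s \<in> {r..<r+1}" "u \<in> {r..<r+1}"
proof -
  obtain i s j u where m: "meet D i s j u" "over D i s" "\<not> over D j u" "x = strand D i s"
    by (rule crossing_meet[OF assms])
  note mf = meet_facts[OF m(1)]
  define s' u' where "s' = s + of_int (- \<lfloor>s - r\<rfloor>)" and "u' = u + of_int (- \<lfloor>u - r\<rfloor>)"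
  have "meet D i s' j u'" unfolding s'_def u'_def by (rule meet_shift[OF m(1)])
  moreover have "over D i s'" "\<not> over D j u'"
    unfolding s'_def u'_def over_shift[OF mf(1)] over_shift[OF mf(2)] by (rule m(2), rule m(3))
  moreover have "x = strand D i s'" unfolding s'_def strand_shift[OF mf(1)] by (rule m(4))
  moreover have "s' \<in> {r..<r+1}" "u' \<in> {r..<r+1}" unfolding s'_def u'_def by (auto simp: algebra_simps) linarith+
  ultimately show thesis by (rule that)
qed

lemma window_unique:
  assumes "s \<in> {r..<r+1}" "u \<in> {r..<r+1}" "s - u \<in> \<int>"
  shows "s = (u::real)"
proof -
  obtain k where k: "s - u = of_int k" using assms(3) by (auto elim: Ints_cases)
  have "\<bar>s - u\<bar> < 1" using assms(1,2) by auto
  then have "k = 0" using k by linarith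
  then show ?thesis using k by simp
qed

text \<open>Regrouped by crossings, the vanishing total has terms of one sign: overpass minus
  underpass, at most 0 by the energy formula. At \<open>p\<close> the signs are reversed, but there
  \<open>at_p\<close> makes the term 0. So every term is 0.\<close>

lemma crossing_reflection_pair:
  assumes x: "x \<in> crossings D"
  shows "reflection_pair (vals P c x)"
proof -
  obtain r where r: "\<forall>i<ncomps D. \<not> passage i r" using common_nonpassage by (elim exE)
  define \<P> where "\<P> = (SIGMA i:{..<ncomps D}. {s \<in> {r..r+1}. passage i s})"
  define S where "S x = (\<Sum>z\<in>{z \<in> \<P>. strand D (fst z) (snd z) = x}. sign (fst z) (snd z) * side_sum (fst z) (snd z))" for x
  have fin: "finite \<P>" unfolding \<P>_def using finite_passages by (intro finite_SigmaI) auto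
  have fc: "finite (crossings D)" using diagram unfolding is_diagram_def by simp
  have "(\<Sum>z\<in>\<P>. sign (fst z) (snd z) * side_sum (fst z) (snd z)) =
      (\<Sum>i<ncomps D. \<Sum>s\<in>{s \<in> {r..r+1}. passage i s}. sign i s * side_sum i s)"
    unfolding \<P>_def by (subst sum.Sigma) (use finite_passages in \<open>auto simp: case_prod_unfold\<close>)
  also have "\<dots> = 0" using strand_sum_zero r by (intro sum.neutral) blast
  finally have total0: "(\<Sum>z\<in>\<P>. sign (fst z) (snd z) * side_sum (fst z) (snd z)) = 0" .
  have "(\<lambda>z. strand D (fst z) (snd z)) ` \<P> \<subseteq> crossings D" by (auto simp: \<P>_def passage_def)
  then have total: "sum S (crossings D) = 0"
    unfolding S_def
    using sum.group[OF fin fc, where g = "\<lambda>z. strand D (fst z) (snd z)"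
        and h = "\<lambda>z. sign (fst z) (snd z) * side_sum (fst z) (snd z)"] total0 by simp
  have local: "S y \<le> 0 \<and> (S y = 0 \<longrightarrow> reflection_pair (vals P c y))" if y: "y \<in> crossings D" for y
  proof -
    obtain i s j t where m: "meet D i s j t" "over D i s" "\<not> over D j t" "y = strand D i s"
      "s \<in> {r..<r+1}" "t \<in> {r..<r+1}" by (rule meet_in_window[OF y])
    note mf = meet_facts[OF m(1)]
    have pas: "passage i s" "passage j t" using y m(4) mf(3) by (simp_all add: passage_def)
    have ne: "(i, s) \<noteq> (j, t)" using m(2,3) by auto
    have inP: "(i, s) \<in> \<P>" "(j, t) \<in> \<P>" using mf(1,2) m(5,6) pas by (auto simp: \<P>_def)
    have "{z \<in> \<P>. strand D (fst z) (snd z) = y} = {(i, s), (j, t)}"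
    proof (intro equalityI subsetI)
      fix z assume z: "z \<in> {z \<in> \<P>. strand D (fst z) (snd z) = y}"
      obtain k u where ku: "z = (k, u)" by (cases z)
      then have k: "k < ncomps D" "u \<in> {r..r+1}" "passage k u" "strand D k u = strand D i s"
        using z m(4) by (auto simp: \<P>_def)
      \<comment> \<open>The closed window of the telescoping sum and the half-open one of the
        counting contain the same passages, since neither \<open>r\<close> nor \<open>r + 1\<close>
        is one.\<close>
      have "passage k (u - 1)" if "u = r + 1"
        using k(3) strand_facts(2)[OF k(1), of "u - 1"] by (simp add: passage_def)
      then have "u \<noteq> r + 1" using r k(1) by auto
      then have "u \<in> {r..<r+1}" using k(2) by auto
      then show "z \<in> {(i, s), (j, t)}"
        using meet_fiber[OF m(1) k(1,4)] window_unique[of u r s] window_unique[of u r t] m(5,6) ku by auto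
    next
      fix z assume "z \<in> {(i, s), (j, t)}"
      then show "z \<in> {z \<in> \<P>. strand D (fst z) (snd z) = y}" using inP m(4) mf(3) by auto
    qed
    then have S: "S y = sign i s * side_sum i s + sign j t * side_sum j t"
      unfolding S_def using ne by simp
    show ?thesis
    proof (cases "y = p")
      case True
      then have "side_sum i s = side_sum j t" using crossing_energy(2)[OF m(1,2)] at_p m(4) by simp
      moreover have "sign i s = - 1" "sign j t = 1"
        using m(2,3) m(4)[symmetric] mf(3)[symmetric] True unfolding sign_def overpass_def by simp_all
      ultimately show ?thesis using S at_p True by simp
    next
      case False
      then have "sign i s = 1" "sign j t = - 1"
        using m(2,3,4) mf(3) by (simp_all add: sign_def overpass_def)
      then show ?thesis using S crossing_energy[OF m(1,2)] m(4) by simp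
    qed
  qed
  have "S x = 0"
  proof -
    have "sum (\<lambda>y. - S y) (crossings D) = 0" using total by (simp add: sum_negf)
    then have "\<forall>y\<in>crossings D. - S y = 0"
      using local by (subst (asm) sum_nonneg_eq_0_iff[OF fc]) auto
    then show ?thesis using x by simp
  qed
  then show ?thesis using local[OF x] by blast
qed

text \<open>An edge near a crossing shows two colours of different flip among the two colours of the
  crossing, hence both. So the pair of colours is locally constant along the projection.\<close>

lemma edge_reflection_pair:
  assumes "x \<in> P"
  shows "\<exists>W. openin (top_of_set S2) W \<and> x \<in> W \<and> reflection_pair (vals P c x) \<and>
    (\<forall>y\<in>W - P. c y \<in> vals P c x) \<and> (\<forall>y\<in>W \<inter> P. vals P c y = vals P c x)"
proof -
  obtain i s0 where i: "i < ncomps D" "x = strand D i s0" using assms by (auto simp: P_def)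
  show ?thesis
  proof (cases "passage i s0")
    case False
    then have nc: "strand D i s0 \<notin> crossings D" by (simp add: passage_def)
    obtain W \<delta> a b where W: "openin (top_of_set S2) W" "strand D i s0 \<in> W" "0 < \<delta>"
      "\<forall>y\<in>W - P. c y \<in> {a, b}" "\<forall>y\<in>W \<inter> P. vals P c y = {a, b}"
      "\<forall>s. \<bar>s - s0\<bar> < \<delta> \<longrightarrow> strand D i s \<in> W"
      using edge_vals[OF i(1) nc c_loc_const] by (elim exE conjE)
    have "vals P c x = {a, b}" using W(2,5) assms i(2) by blast
    then show ?thesis using W(1,2,4,5) flips[OF i(1) False] i(2) by (intro exI[of _ W]) simp
  next
    case True
    then have x: "x \<in> crossings D" using i(2) by (simp add: passage_def)
    obtain k s j u where m: "meet D k s j u" "over D k s" "x = strand D k s" by (rule crossing_meet[OF x])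
    obtain W \<delta> g1 g2 k1 k2 where W: "openin (top_of_set S2) W" "strand D k s \<in> W" "0 < \<delta>"
      and off: "\<forall>y\<in>W - P. c y \<in> {g1 - k1, g1 - k2, g2 - k1, g2 - k2}"
      and vx: "vals P c (strand D k s) = {g1 - k1, g1 - k2, g2 - k1, g2 - k2}"
      and vy: "\<forall>y\<in>W \<inter> P. y = strand D k s \<or>
       vals P c y \<in> {{g1 - k1, g2 - k1}, {g1 - k2, g2 - k2}, {g1 - k1, g1 - k2}, {g2 - k1, g2 - k2}}"
      and "\<forall>v. s < v \<longrightarrow> v < s + \<delta> \<longrightarrow> vals P c (strand D k v) = {g1 - k1, g2 - k1}"
      and "\<forall>v. s - \<delta> < v \<longrightarrow> v < s \<longrightarrow> vals P c (strand D k v) = {g1 - k2, g2 - k2}"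
      and "\<forall>v. u < v \<longrightarrow> v < u + \<delta> \<longrightarrow> vals P c (strand D j v) = {g1 - k1, g1 - k2}"
      and "\<forall>v. u - \<delta> < v \<longrightarrow> v < u \<longrightarrow> vals P c (strand D j v) = {g2 - k1, g2 - k2}"
      using crossing_vals[OF coc prim m(1,2)] by (elim exE conjE)
    have rp: "reflection_pair (vals P c x)" by (rule crossing_reflection_pair[OF x])
    have "vals P c y = vals P c x" if y: "y \<in> W \<inter> P" for y
    proof (cases "y = x")
      case False
      then have mem: "vals P c y \<in> {{g1 - k1, g2 - k1}, {g1 - k2, g2 - k2}, {g1 - k1, g1 - k2}, {g2 - k1, g2 - k2}}"
        using vy y m(3) by blast
      obtain l v where l: "l < ncomps D" "y = strand D l v" using y by (auto simp: P_def)
      have "reflection_pair (vals P c y)"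
      proof (cases "passage l v")
        case True
        then show ?thesis using crossing_reflection_pair l(2) by (simp add: passage_def)
      next
        case False
        then show ?thesis using flips[OF l(1)] l(2) by simp
      qed
      moreover obtain g g' where g: "vals P c y = {g, g'}" "{g, g'} \<subseteq> vals P c x"
        using mem vx m(3) by auto
      ultimately have "flip g \<noteq> flip g'" by (simp only: reflection_pair_insert simp_thms)
      then show ?thesis using reflection_pair_subset_eq[OF rp g(2)] g(1) by simp
    qed simp
    then show ?thesis using W(1,2) off vx rp m(3) by (intro exI[of _ W]) simp
  qed
qed

text \<open>Connectedness of the projection makes the pair constant on it. It spreads to every face,
  since near the projection no other colours occur.\<close>

lemma two_valued:
  assumes conn: "connected P"
  shows "\<exists>a b. \<forall>y\<in>S2 - P. c y \<in> {Isom 0 a, Isom 1 b}"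
proof -
  have "strand D 0 0 \<in> P" using ncomps_pos by (auto simp: P_def)
  then obtain x0 where x0: "x0 \<in> P" by blast
  have lc: "loc_const P (vals P c)"
    unfolding loc_const_def
  proof
    fix x assume "x \<in> P"
    obtain W where W: "openin (top_of_set S2) W" "x \<in> W" "\<forall>y\<in>W \<inter> P. vals P c y = vals P c x"
      using edge_reflection_pair[OF \<open>x \<in> P\<close>] by (elim exE conjE)
    obtain W' where W': "open W'" "W = S2 \<inter> W'" using W(1) by (auto simp: openin_open)
    have "W' \<inter> P \<subseteq> W \<inter> P" using W'(2) P_sub by blast
    then have "\<forall>y\<in>W' \<inter> P. vals P c y = vals P c x" using W(3) by blast
    moreover have "x \<in> W'" using W(2) W'(2) by blast
    ultimately show "\<exists>W. open W \<and> x \<in> W \<and> (\<forall>y\<in>W \<inter> P. vals P c y = vals P c x)" using W'(1) by blast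
  qed
  have same: "vals P c x = vals P c x0" if "x \<in> P" for x by (rule loc_const_connected[OF conn lc that x0])
  have rp: "reflection_pair (vals P c x0)" using edge_reflection_pair[OF x0] by (elim exE conjE)
  then obtain a b where ab: "vals P c x0 = {Isom 0 a, Isom 1 b}" unfolding reflection_pair_def by (elim exE)
  have oS: "openin (top_of_set S2) S2" by simp
  have "Isom 0 a \<in> vals P c x0" using ab by simp
  from vals_meets[OF this oS] obtain y0 where y0: "y0 \<in> S2 - P" "c y0 = Isom 0 a" using x0 P_sub by blast
  have y0E: "c y0 \<in> {Isom 0 a, Isom 1 b}" using y0(2) by simp
  have "c y \<in> {Isom 0 a, Isom 1 b}" if y: "y \<in> S2 - P" for y
  proof (rule transition_spread[OF c_loc_const y0(1) y0E _ y])
    fix x assume "x \<in> P"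
    obtain W where W: "openin (top_of_set S2) W" "x \<in> W" "\<forall>y\<in>W - P. c y \<in> vals P c x"
      using edge_reflection_pair[OF \<open>x \<in> P\<close>] by (elim exE conjE)
    have "\<forall>y\<in>W - P. c y \<in> {Isom 0 a, Isom 1 b}" using W(3) unfolding same[OF \<open>x \<in> P\<close>] ab .
    then show "\<exists>W. openin (top_of_set S2) W \<and> x \<in> W \<and>
       ((\<forall>y\<in>W - P. c y \<in> {Isom 0 a, Isom 1 b}) \<or> (\<forall>y\<in>W - P. c y \<notin> {Isom 0 a, Isom 1 b}))"
      using W(1,2) by blast
  qed
  then show ?thesis by blast
qed

lemma gauge_equiv_sign:
  assumes conn: "connected P"
  shows "gauge_equiv X t (\<lambda>a b. Isom (flip (t a b)) 0)"
proof -
  obtain a b where ab: "\<forall>y\<in>S2 - P. c y \<in> {Isom 0 a, Isom 1 b}" using two_valued[OF conn] by (elim exE)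
  define \<phi> :: "real isom \<Rightarrow> real isom" where "\<phi> g = Isom (flip g) 0" for g
  have hom: "\<phi> (g + g') = \<phi> g + \<phi> g'" for g g' by (simp add: \<phi>_def plus_isom_def signed_def)
  \<comment> \<open>One translation above the diagram and one below are free. Their shifts
    \<open>g\<close>, \<open>k\<close> solve \<open>g + a - k = 0\<close> and
    \<open>g + b + k = 0\<close>; the flip of the second colour reverses the sign of
    \<open>k\<close>.\<close>
  define g0 k0 :: "real isom" where "g0 = Isom 0 (- (a + b) / 2)" and "k0 = Isom 0 ((a - b) / 2)"
  have "gauge_equiv X t (\<lambda>a b. \<phi> (t a b))"
  proof (rule gauge_extension)
    show "local_cocycle X (\<lambda>a b. \<phi> (t a b))" by (rule local_cocycle_hom[OF coc hom])
    show "primitive U t (\<lambda>z. g0 + f z)" "primitive V t (\<lambda>z. k0 + f' z)"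
      by (intro primitive_add_const prim)+
    show "primitive U (\<lambda>a b. \<phi> (t a b)) (\<lambda>z. \<phi> (f z))" "primitive V (\<lambda>a b. \<phi> (t a b)) (\<lambda>z. \<phi> (f' z))"
      by (rule primitive_hom[OF prim(1) hom], rule primitive_hom[OF prim(2) hom])
    fix y assume y: "y \<in> S2 - P"
    have \<phi>diff: "\<phi> (p - q) = \<phi> p - \<phi> q" for p q
      using hom[of "p - q" q] by (simp add: eq_diff_eq)
    have "c y \<in> {Isom 0 a, Isom 1 b}" using ab y by blast
    then have "g0 + (c y - k0) = \<phi> (c y)"
      by (auto simp: g0_def k0_def \<phi>_def plus_isom_def minus_isom_def uminus_isom_def signed_def field_simps)
    moreover have "transition (\<lambda>z. g0 + f z) (\<lambda>z. k0 + f' z) y = g0 + (c y - k0)"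
      unfolding transition_def by (simp only: diff_conv_add_uminus minus_add add.assoc)
    moreover have "\<phi> (c y) = transition (\<lambda>z. \<phi> (f z)) (\<lambda>z. \<phi> (f' z)) y" unfolding transition_def \<phi>diff by (rule refl)
    ultimately show "transition (\<lambda>z. g0 + f z) (\<lambda>z. k0 + f' z) y = transition (\<lambda>z. \<phi> (f z)) (\<lambda>z. \<phi> (f' z)) y"
      by (simp only:)
  qed (rule coc)
  then show ?thesis by (simp only: \<phi>_def)
qed

end

section \<open>Signs\<close>

lemma primitive_diff:
  fixes t t' :: "'a::topological_space \<Rightarrow> 'a \<Rightarrow> 'g::ab_group_add"
  assumes "primitive X t f" "primitive X t' f'"
  shows "primitive X (\<lambda>a b. t a b - t' a b) (\<lambda>a. f a - f' a)"
proof (rule primitiveI)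
  fix x assume x: "x \<in> X"
  obtain W where W[rule_format]: "open W" "x \<in> W" "\<forall>a b. a \<in> W \<longrightarrow> a \<in> X \<longrightarrow> b \<in> W \<longrightarrow> b \<in> X \<longrightarrow> t a b = - f a + f b"
    by (rule primitiveE[OF assms(1) x])
  obtain W' where W'[rule_format]: "open W'" "x \<in> W'" "\<forall>a b. a \<in> W' \<longrightarrow> a \<in> X \<longrightarrow> b \<in> W' \<longrightarrow> b \<in> X \<longrightarrow> t' a b = - f' a + f' b"
    by (rule primitiveE[OF assms(2) x])
  show "\<exists>W. open W \<and> x \<in> W \<and> (\<forall>a b. a \<in> W \<longrightarrow> a \<in> X \<longrightarrow> b \<in> W \<longrightarrow> b \<in> X \<longrightarrow>
      t a b - t' a b = - (f a - f' a) + (f b - f' b))"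
  proof (intro exI[of _ "W \<inter> W'"] conjI allI impI)
    fix a b assume "a \<in> W \<inter> W'" "a \<in> X" "b \<in> W \<inter> W'" "b \<in> X"
    then have "t a b = - f a + f b" "t' a b = - f' a + f' b" by (simp_all add: W(3) W'(3))
    then show "t a b - t' a b = - (f a - f' a) + (f b - f' b)" by simp
  qed (use W(1,2) W'(1,2) in auto)
qed

lemma local_cocycle_diff:
  fixes t t' :: "'a::topological_space \<Rightarrow> 'a \<Rightarrow> 'g::ab_group_add"
  assumes "local_cocycle X t" "local_cocycle X t'"
  shows "local_cocycle X (\<lambda>a b. t a b - t' a b)"
  unfolding local_cocycle_def
proof
  fix x assume x: "x \<in> X"
  obtain W where W: "open W" "x \<in> W" "cocycle_on (W \<inter> X) t" by (rule local_cocycleE[OF assms(1) x])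
  obtain W' where W': "open W'" "x \<in> W'" "cocycle_on (W' \<inter> X) t'" by (rule local_cocycleE[OF assms(2) x])
  have "cocycle_on ((W \<inter> W') \<inter> X) (\<lambda>a b. t a b - t' a b)"
    unfolding cocycle_on_def
  proof (intro ballI)
    fix a b c assume "a \<in> (W \<inter> W') \<inter> X" "b \<in> (W \<inter> W') \<inter> X" "c \<in> (W \<inter> W') \<inter> X"
    then have "t a b + t b c = t a c" "t' a b + t' b c = t' a c"
      using cocycle_onD[OF W(3), of a b c] cocycle_onD[OF W'(3), of a b c] by auto
    then show "t a b - t' a b + (t b c - t' b c) = t a c - t' a c" by (simp add: algebra_simps)
  qed
  then show "\<exists>W. open W \<and> x \<in> W \<and> cocycle_on (W \<inter> X) (\<lambda>a b. t a b - t' a b)"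
    using W(1,2) W'(1,2) by (intro exI[of _ "W \<inter> W'"]) auto
qed

lemma vals_image_subset:
  assumes "\<And>y. y \<in> S2 - P \<Longrightarrow> c' y = \<phi> (c y)"
  shows "\<phi> ` vals P c x \<subseteq> vals P c' x"
proof
  fix g assume "g \<in> \<phi> ` vals P c x"
  then obtain e where e: "e \<in> vals P c x" "g = \<phi> e" by blast
  show "g \<in> vals P c' x"
    unfolding vals_def
  proof (intro CollectI allI impI)
    fix W assume W: "openin (top_of_set S2) W" "x \<in> W"
    obtain y where "y \<in> W - P" "c y = e" using vals_meets[OF e(1) W] by blast
    then show "\<exists>y\<in>W - P. c' y = g" using assms[of y] e(2) openin_imp_subset[OF W(1)] by blast
  qed
qed

lemma vals_translate:
  assumes "\<And>y. y \<in> S2 - P \<Longrightarrow> c' y = q + c y - (r::'g::group_add)"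
  shows "vals P c' x = (\<lambda>g. q + g - r) ` vals P c x"
proof
  show "(\<lambda>g. q + g - r) ` vals P c x \<subseteq> vals P c' x" by (rule vals_image_subset) (rule assms)
  have inv: "- q + (q + g - r) + r = g" for g
    by (simp only: diff_conv_add_uminus add.assoc minus_add_cancel left_minus add_0_right)
  have inv': "q + (- q + g + r) - r = g" for g
    by (simp only: diff_conv_add_uminus add.assoc add_minus_cancel right_minus add_0_right)
  have "(\<lambda>g. - q + g + r) ` vals P c' x \<subseteq> vals P c x"
    by (rule vals_image_subset) (simp only: assms inv)
  then have "(\<lambda>g. q + g - r) ` ((\<lambda>g. - q + g + r) ` vals P c' x) \<subseteq> (\<lambda>g. q + g - r) ` vals P c x"
    by (rule image_mono)
  then show "vals P c' x \<subseteq> (\<lambda>g. q + g - r) ` vals P c x" by (simp only: image_image inv' image_ident)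
qed

context diagram_lift
begin

lemma loc_const_transition:
  "primitive U t f \<Longrightarrow> primitive V t f' \<Longrightarrow> loc_const (S2 - P) (transition f f')"
  using transition_loc_const(1) by (simp add: transition_def[abs_def])

text \<open>Other primitives differ by constants on the connected regions, so all colours are moved
  by one injective map, which preserves the number of colours at a point.\<close>

lemma two_sided_primitive_indep:
  assumes "primitive U t f" "primitive V t f'" "primitive U t g" "primitive V t g'"
  shows "two_sided (transition f f') i s \<longleftrightarrow> two_sided (transition g g') i s"
proof -
  obtain q where q: "\<forall>x\<in>U. f x = q + g x" using primitive_unique[OF above_connected assms(1,3)] by blast
  obtain r where r: "\<forall>x\<in>V. f' x = r + g' x" using primitive_unique[OF below_connected assms(2,4)] by blast
  have "transition f f' y = q + transition g g' y - r" if "y \<in> S2 - P" for y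
  proof -
    have "at_height y 0 \<in> U" "at_height y 0 \<in> V" using off_P_above_below[OF that, of 0] by auto
    then have "f (at_height y 0) = q + g (at_height y 0)" "f' (at_height y 0) = r + g' (at_height y 0)" using q r by blast+
    then show ?thesis unfolding transition_def by (simp only: diff_conv_add_uminus minus_add add.assoc)
  qed
  then have v: "vals P (transition f f') x = (\<lambda>g. q + g - r) ` vals P (transition g g') x" for x by (rule vals_translate)
  have inj: "inj (\<lambda>g. q + g - r)" by (rule injI) (simp only: diff_conv_add_uminus add_right_cancel add_left_cancel)
  have "(\<exists>g. (\<lambda>g. q + g - r) ` S = {g}) \<longleftrightarrow> (\<exists>g. S = {g})" for S
  proof
    assume "\<exists>g. (\<lambda>g. q + g - r) ` S = {g}"
    then obtain w where w: "(\<lambda>g. q + g - r) ` S = {w}" by blast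
    then obtain z where z: "z \<in> S" by blast
    have "S = {z}"
    proof (rule equalityI)
      show "S \<subseteq> {z}"
      proof
        fix y assume "y \<in> S"
        then have "q + y - r = w" "q + z - r = w" using w z by blast+
        then show "y \<in> {z}" using injD[OF inj, of y z] by simp
      qed
    qed (use z in simp)
    then show "\<exists>g. S = {g}" by blast
  qed auto
  then show ?thesis unfolding two_sided_def v by simp
qed

lemma diff_diff_swap: "(a - b) - (c - d) = (a - c) - (b - d :: 'g::ab_group_add)"
  by (simp add: algebra_simps)

lemma bit_diff: "a - b = a + (b :: bit)"
  by (cases a; cases b; simp)

lemma bit_diff_eq: "(a \<noteq> b \<longleftrightarrow> a' \<noteq> b') \<Longrightarrow> a - a' = b - (b'::bit)"
  by (cases a; cases b; cases a'; cases b'; simp)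

text \<open>A class with coefficients in \<open>\<int>/2\<close> is determined by which strands change the colour.\<close>

lemma sign_gauge:
  fixes t t' :: "_ \<Rightarrow> _ \<Rightarrow> bit"
  assumes coc: "local_cocycle X t" "local_cocycle X t'"
    and f: "primitive U t f" "primitive V t f'" and g: "primitive U t' g" "primitive V t' g'"
    and eq: "\<And>i s. i < ncomps D \<Longrightarrow> \<not> passage i s \<Longrightarrow>
        two_sided (transition f f') i s \<longleftrightarrow> two_sided (transition g g') i s"
  shows "gauge_equiv X t t'"
proof -
  define c where "c = transition (\<lambda>z. f z - g z) (\<lambda>z. f' z - g' z)"
  have ceq: "c y = transition f f' y - transition g g' y" for y
    unfolding c_def transition_def by (rule diff_diff_swap)
  have prim: "primitive U (\<lambda>a b. t a b - t' a b) (\<lambda>z. f z - g z)" "primitive V (\<lambda>a b. t a b - t' a b) (\<lambda>z. f' z - g' z)"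
    by (rule primitive_diff[OF f(1) g(1)], rule primitive_diff[OF f(2) g(2)])
  have lc: "loc_const (S2 - P) c" unfolding c_def by (rule loc_const_transition[OF prim])
  \<comment> \<open>Modulo 2 there is only one way to change: where both colourings change or
    neither does, their difference does not.\<close>
  have single: "\<exists>v. vals P c (strand D i s) = {v}" if i: "i < ncomps D" and s: "\<not> passage i s" for i s
  proof -
    have nc: "strand D i s \<notin> crossings D" using s by (simp add: passage_def)
    obtain W A B \<delta> where W: "0 < \<delta>" "openin (top_of_set S2) W" "strand D i s \<in> W" "splits W P A B"
      "\<forall>u. \<bar>u - s\<bar> < \<delta> \<longrightarrow> strand D i u \<in> W"
      using edge_chart[OF i nc] by (elim exE conjE)
    have xP: "strand D i s \<in> W \<inter> P" using W(3) i by (auto simp: P_def)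
    obtain a b where a: "\<forall>y\<in>A. transition f f' y = a" "\<forall>y\<in>B. transition f f' y = b"
      "\<forall>y\<in>W \<inter> P. vals P (transition f f') y = {a, b}"
      using splits_vals[OF W(4,2) loc_const_transition[OF f]] by (elim exE conjE)
    obtain a' b' where a': "\<forall>y\<in>A. transition g g' y = a'" "\<forall>y\<in>B. transition g g' y = b'"
      "\<forall>y\<in>W \<inter> P. vals P (transition g g') y = {a', b'}"
      using splits_vals[OF W(4,2) loc_const_transition[OF g]] by (elim exE conjE)
    obtain u v where uv: "\<forall>y\<in>A. c y = u" "\<forall>y\<in>B. c y = v" "\<forall>y\<in>W \<inter> P. vals P c y = {u, v}"
      using splits_vals[OF W(4,2) lc] by (elim exE conjE)
    have cl: "strand D i s \<in> closure A" "strand D i s \<in> closure B" using splitsD(11)[OF W(4)] xP by auto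
    then obtain y z where yz: "y \<in> A" "z \<in> B" by (metis closure_empty empty_iff ex_in_conv)
    have sing: "(\<exists>g. {p, q} = {g}) \<longleftrightarrow> p = q" for p q :: bit by auto
    have "a \<noteq> b \<longleftrightarrow> a' \<noteq> b'"
      using eq[OF i s] a(3)[rule_format, OF xP] a'(3)[rule_format, OF xP] unfolding two_sided_def by (simp only: sing)
    then have "a - a' = b - b'" by (rule bit_diff_eq)
    moreover have "u = a - a'" "v = b - b'" using uv(1,2) a(1,2) a'(1,2) yz ceq by metis+
    ultimately show ?thesis using uv(3)[rule_format, OF xP] by simp
  qed
  have loc: "\<exists>W v. openin (top_of_set S2) W \<and> x \<in> W \<and> (\<forall>y\<in>W - P. c y = v)" if x: "x \<in> P" for x
  proof -
    obtain i s0 where i: "i < ncomps D" "x = strand D i s0" using x by (auto simp: P_def)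
    show ?thesis
    proof (cases "passage i s0")
      case False
      then have nc: "strand D i s0 \<notin> crossings D" by (simp add: passage_def)
      obtain W \<delta> a b where W: "openin (top_of_set S2) W" "strand D i s0 \<in> W" "0 < \<delta>"
        "\<forall>y\<in>W - P. c y \<in> {a, b}" "\<forall>y\<in>W \<inter> P. vals P c y = {a, b}"
        "\<forall>s. \<bar>s - s0\<bar> < \<delta> \<longrightarrow> strand D i s \<in> W"
        using edge_vals[OF i(1) nc lc] by (elim exE conjE)
      have "vals P c (strand D i s0) = {a, b}" using W(2,5) x i(2) by blast
      then have "a = b" using single[OF i(1) False] by auto
      then show ?thesis using W(1,2,4) i(2) by (intro exI[of _ W] exI[of _ b]) simp
    next
      case True
      then have xc: "x \<in> crossings D" using i(2) by (simp add: passage_def)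
      obtain k s j u where m: "meet D k s j u" "over D k s" "\<not> over D j u" "x = strand D k s" by (rule crossing_meet[OF xc])
      note mf = meet_facts[OF m(1)]
      obtain W \<delta> g1 g2 k1 k2 where W: "openin (top_of_set S2) W" "strand D k s \<in> W" "0 < \<delta>"
        and off: "\<forall>y\<in>W - P. c y \<in> {g1 - k1, g1 - k2, g2 - k1, g2 - k2}"
        and vx: "vals P c (strand D k s) = {g1 - k1, g1 - k2, g2 - k1, g2 - k2}"
        and vy: "\<forall>y\<in>W \<inter> P. y = strand D k s \<or>
         vals P c y \<in> {{g1 - k1, g2 - k1}, {g1 - k2, g2 - k2}, {g1 - k1, g1 - k2}, {g2 - k1, g2 - k2}}"
        and v1: "\<forall>v. s < v \<longrightarrow> v < s + \<delta> \<longrightarrow> vals P c (strand D k v) = {g1 - k1, g2 - k1}"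
        and v2: "\<forall>v. s - \<delta> < v \<longrightarrow> v < s \<longrightarrow> vals P c (strand D k v) = {g1 - k2, g2 - k2}"
        and v3: "\<forall>v. u < v \<longrightarrow> v < u + \<delta> \<longrightarrow> vals P c (strand D j v) = {g1 - k1, g1 - k2}"
        and v4: "\<forall>v. u - \<delta> < v \<longrightarrow> v < u \<longrightarrow> vals P c (strand D j v) = {g2 - k1, g2 - k2}"
        using crossing_vals[OF local_cocycle_diff[OF coc] prim m(1,2)] unfolding c_def by (elim exE conjE)
      obtain w where w: "s < w" "w < s + \<delta>" "\<not> passage k w"
        by (rule nonpassage_between[OF mf(1), of s "s + \<delta>"]) (use W(3) in auto)
      obtain w' where w': "u < w'" "w' < u + \<delta>" "\<not> passage j w'"
        by (rule nonpassage_between[OF mf(2), of u "u + \<delta>"]) (use W(3) in auto)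
      have "g1 - k1 = g2 - k1" using single[OF mf(1) w(3)] v1 w(1,2) by auto
      moreover have "g1 - k1 = g1 - k2" using single[OF mf(2) w'(3)] v3 w'(1,2) by auto
      ultimately have eqs: "g1 = g2" "k1 = k2"
        by (simp_all only: diff_conv_add_uminus add_right_cancel add_left_cancel neg_equal_iff_equal)
      show ?thesis
      proof (intro exI[of _ W] exI[of _ "g1 - k1"] conjI W(1) ballI)
        show "x \<in> W" using W(2) m(4) by simp
        fix y assume "y \<in> W - P"
        then show "c y = g1 - k1" using off eqs by auto
      qed
    qed
  qed
  obtain y0 where y0: "y0 \<in> S2 - P"
  proof -
    have "strand D 0 0 \<in> S2" using strand_facts(1)[OF ncomps_pos] by simp
    then obtain y where "y \<in> S2" "y \<notin> P" using off_P_dense[OF openin_subtopology_self] by blast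
    then show thesis using that by blast
  qed
  have const: "c y = c y0" if y: "y \<in> S2 - P" for y
  proof -
    have "c y \<in> {c y0}"
    proof (rule transition_spread[OF lc y0 _ _ y])
      fix x assume "x \<in> P"
      obtain W v where "openin (top_of_set S2) W" "x \<in> W" "\<forall>y\<in>W - P. c y = v" using loc[OF \<open>x \<in> P\<close>] by (elim exE conjE)
      then show "\<exists>W. openin (top_of_set S2) W \<and> x \<in> W \<and> ((\<forall>y\<in>W - P. c y \<in> {c y0}) \<or> (\<forall>y\<in>W - P. c y \<notin> {c y0}))"
        by (intro exI[of _ W] conjI) (cases "v = c y0"; simp)+
    qed simp
    then show ?thesis by simp
  qed
  show ?thesis
  \<comment> \<open>The two colourings differ by the constant \<open>c y0\<close>, which is absorbed
    into the primitive above.\<close>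
  proof (rule gauge_extension[OF coc f primitive_add_const[OF g(1)] g(2)])
    fix y assume y: "y \<in> S2 - P"
    have "transition f f' y = c y0 + transition g g' y" using const[OF y] ceq[of y] by (metis diff_add_cancel)
    then show "transition f f' y = transition (\<lambda>x. c y0 + g x) g' y" by (simp only: transition_def add_diff_eq)
  qed
qed

text \<open>The flips of the colours form the colouring of the sign cocycle. A change of the sign
  across the strand is therefore a difference of flips between its two sides.\<close>

lemma flips_reflection_pair:
  fixes t :: "_ \<Rightarrow> _ \<Rightarrow> 'b::ab_group_add isom"
  assumes f: "primitive U t f" "primitive V t f'" and i: "i < ncomps D" and s: "\<not> passage i s"
    and ts: "two_sided (transition (\<lambda>z. flip (f z)) (\<lambda>z. flip (f' z))) i s"
  shows "reflection_pair (vals P (transition f f') (strand D i s))"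
proof -
  let ?c = "transition f f'" and ?e = "transition (\<lambda>z. flip (f z)) (\<lambda>z. flip (f' z))"
  have nc: "strand D i s \<notin> crossings D" using s by (simp add: passage_def)
  have e: "?e y = flip (?c y)" for y
    unfolding transition_def flip_diff by (rule bit_diff)
  obtain W A B \<delta> where W: "0 < \<delta>" "openin (top_of_set S2) W" "strand D i s \<in> W" "splits W P A B"
    "\<forall>u. \<bar>u - s\<bar> < \<delta> \<longrightarrow> strand D i u \<in> W"
    using edge_chart[OF i nc] by (elim exE conjE)
  have xP: "strand D i s \<in> W \<inter> P" using W(3) i by (auto simp: P_def)
  obtain a b where a: "\<forall>y\<in>A. ?c y = a" "\<forall>y\<in>B. ?c y = b" "\<forall>y\<in>W \<inter> P. vals P ?c y = {a, b}"
    using splits_vals[OF W(4,2) loc_const_transition[OF f]] by (elim exE conjE)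
  have pe: "primitive U (\<lambda>a b. flip (t a b)) (\<lambda>z. flip (f z))" "primitive V (\<lambda>a b. flip (t a b)) (\<lambda>z. flip (f' z))"
    by (rule primitive_hom[OF f(1) flip_add], rule primitive_hom[OF f(2) flip_add])
  obtain u v where uv: "\<forall>y\<in>A. ?e y = u" "\<forall>y\<in>B. ?e y = v" "\<forall>y\<in>W \<inter> P. vals P ?e y = {u, v}"
    using splits_vals[OF W(4,2) loc_const_transition[OF pe]] by (elim exE conjE)
  have cl: "strand D i s \<in> closure A" "strand D i s \<in> closure B" using splitsD(11)[OF W(4)] xP by auto
  then obtain y z where yz: "y \<in> A" "z \<in> B" by (metis closure_empty empty_iff ex_in_conv)
  have "u = flip a" "v = flip b" using uv(1,2) a(1,2) yz e by metis+
  moreover have "u \<noteq> v"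
  proof
    assume "u = v"
    then show False using ts uv(3)[rule_format, OF xP] unfolding two_sided_def by simp
  qed
  ultimately show ?thesis using a(3)[rule_format, OF xP] by (simp add: reflection_pair_insert)
qed

text \<open>Formulated for arbitrary translation parts because it is applied to complex ones, before
  the functional is chosen. The four colours are listed in cyclic order around the crossing.\<close>

lemma crossing_flips:
  fixes t :: "_ \<Rightarrow> _ \<Rightarrow> 'b::ab_group_add isom"
  assumes coc: "local_cocycle X t" and f: "primitive U t f" "primitive V t f'"
    and flips: "\<And>i s. i < ncomps D \<Longrightarrow> \<not> passage i s \<Longrightarrow> reflection_pair (vals P (transition f f') (strand D i s))"
    and x: "x \<in> crossings D"
  shows "\<exists>W gA gB gC gD. openin (top_of_set S2) W \<and> x \<in> W \<and> vals P (transition f f') x = {gA, gB, gC, gD} \<and>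
     (\<forall>y\<in>W - P. transition f f' y \<in> {gA, gB, gC, gD}) \<and>
     flip gA = flip gC \<and> flip gB = flip gD \<and> flip gA \<noteq> flip gB \<and> shift gA + shift gB = shift gC + shift gD"
proof -
  let ?c = "transition f f'"
  obtain k s j u where m: "meet D k s j u" "over D k s" "\<not> over D j u" "x = strand D k s" by (rule crossing_meet[OF x])
  note mf = meet_facts[OF m(1)]
  obtain W \<delta> g1 g2 k1 k2 where W: "openin (top_of_set S2) W" "strand D k s \<in> W" "0 < \<delta>"
    and off: "\<forall>y\<in>W - P. ?c y \<in> {g1 - k1, g1 - k2, g2 - k1, g2 - k2}"
    and vx: "vals P ?c (strand D k s) = {g1 - k1, g1 - k2, g2 - k1, g2 - k2}"
    and vy: "\<forall>y\<in>W \<inter> P. y = strand D k s \<or>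
     vals P ?c y \<in> {{g1 - k1, g2 - k1}, {g1 - k2, g2 - k2}, {g1 - k1, g1 - k2}, {g2 - k1, g2 - k2}}"
    and v1: "\<forall>v. s < v \<longrightarrow> v < s + \<delta> \<longrightarrow> vals P ?c (strand D k v) = {g1 - k1, g2 - k1}"
    and v2: "\<forall>v. s - \<delta> < v \<longrightarrow> v < s \<longrightarrow> vals P ?c (strand D k v) = {g1 - k2, g2 - k2}"
    and v3: "\<forall>v. u < v \<longrightarrow> v < u + \<delta> \<longrightarrow> vals P ?c (strand D j v) = {g1 - k1, g1 - k2}"
    and v4: "\<forall>v. u - \<delta> < v \<longrightarrow> v < u \<longrightarrow> vals P ?c (strand D j v) = {g2 - k1, g2 - k2}"
    using crossing_vals[OF coc f m(1,2)] by (elim exE conjE)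
  obtain w where w: "s < w" "w < s + \<delta>" "\<not> passage k w"
    by (rule nonpassage_between[OF mf(1), of s "s + \<delta>"]) (use W(3) in auto)
  obtain w' where w': "u < w'" "w' < u + \<delta>" "\<not> passage j w'"
    by (rule nonpassage_between[OF mf(2), of u "u + \<delta>"]) (use W(3) in auto)
  have "flip (g1 - k1) \<noteq> flip (g2 - k1)"
    using flips[OF mf(1) w(3)] v1 w(1,2) by (simp only: reflection_pair_insert simp_thms)
  then have fg: "flip g1 \<noteq> flip g2" by (auto simp: flip_diff)
  have "flip (g1 - k1) \<noteq> flip (g1 - k2)"
    using flips[OF mf(2) w'(3)] v3 w'(1,2) by (simp only: reflection_pair_insert simp_thms)
  then have fk: "flip k1 \<noteq> flip k2" by (auto simp: flip_diff)
  note ic = isom_crossing[OF fg fk]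
  have set: "{g1 - k1, g1 - k2, g2 - k1, g2 - k2} = {g1 - k1, g2 - k1, g2 - k2, g1 - k2}" by auto
  show ?thesis
    by (rule exI[of _ W], rule exI[of _ "g1 - k1"], rule exI[of _ "g2 - k1"], rule exI[of _ "g2 - k2"], rule exI[of _ "g1 - k2"])
      (use W(1,2) off vx m(4) ic in \<open>simp add: set\<close>)
qed

end

section \<open>Crossingless diagrams\<close>

definition direction :: "(real^3) \<times> real \<Rightarrow> real^3" where "direction z = sgn (fst z)"

text \<open>The graph of a function \<open>H\<close> extending the heights of the strands is a wall that contains the
  link. Crossing it from above through the face of \<open>x\<close> contributes \<open>c x\<close>. The value 0 at the poles
  only serves to separate them.\<close>

definition over_wall :: "(real^3 \<Rightarrow> real) \<Rightarrow> (real^3) \<times> real \<Rightarrow> bool" where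
  "over_wall H z \<longleftrightarrow> (if fst z = 0 then 0 else H (direction z)) < snd z"

definition wall_cocycle :: "(real^3 \<Rightarrow> real) \<Rightarrow> (real^3 \<Rightarrow> 'g::group_add) \<Rightarrow> (real^3) \<times> real \<Rightarrow> (real^3) \<times> real \<Rightarrow> 'g" where
  "wall_cocycle H c a b =
     (if over_wall H a \<and> \<not> over_wall H b then c (direction a)
      else if \<not> over_wall H a \<and> over_wall H b then - c (direction a) else 0)"

lemma over_wall_at_height:
  "norm y = 1 \<Longrightarrow> -1 < k \<Longrightarrow> k < 1 \<Longrightarrow> over_wall H (at_height y k) \<longleftrightarrow> H y < k"
  by (simp add: over_wall_def direction_def at_height_fst)

locale crossingless_lift = diagram_lift D h for D h +
  assumes no_crossings: "crossings D = {}"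
begin

text \<open>Without crossings the height is a function of the point of the projection, continuous
  because its graph is compact. Tietze's theorem extends it to the sphere with values in the open
  interval, so the wall avoids the poles.\<close>

lemma wall_exists:
  obtains H where "continuous_on S2 H" "\<forall>x\<in>S2. -1 < H x \<and> H x < 1"
    "\<forall>i s. i < ncomps D \<longrightarrow> H (strand D i s) = h i s"
proof -
  define G where "G = (\<Union>i<ncomps D. range (\<lambda>s. (strand D i s, h i s)))"
  have "range (\<lambda>s. (strand D i s, h i s)) = (\<lambda>s. (strand D i s, h i s)) ` {0..1}" if "i < ncomps D" for i
  proof -
    have "(strand D i s, h i s) \<in> (\<lambda>s. (strand D i s, h i s)) ` {0..1}" for s
      by (rule image_eqI[of _ _ "frac s"])
        (simp_all add: periodic_frac[of "strand D i"] periodic_frac[of "h i"] curve_periodic height_periodic that frac_lt_1 less_imp_le)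
    then show ?thesis by auto
  qed
  moreover have "compact ((\<lambda>s. (strand D i s, h i s)) ` {0..1})" if "i < ncomps D" for i
    using curve_cont[OF that] height_cont[OF that]
    by (intro compact_continuous_image continuous_on_Pair) (auto intro: continuous_on_subset)
  ultimately have cG: "compact G" unfolding G_def by (intro compact_UN) auto
  have same: "h i s = h j t" if "i < ncomps D" "j < ncomps D" "strand D i s = strand D j t" for i j s t
  proof -
    have "i = j \<and> s - t \<in> \<int>" using noncrossing_fiber[of j t i s] no_crossings that by auto
    then obtain q where "i = j" "s - t = of_int q" by (auto elim: Ints_cases)
    then have "s = t + of_int q" by simp
    then show ?thesis using h_shift[of j t q] that(2) \<open>i = j\<close> by simp
  qed
  define \<eta> where "\<eta> x = (SOME k. (x, k) \<in> G)" for x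
  have \<eta>: "\<eta> x = k" if xk: "(x, k) \<in> G" for x k
  proof -
    have "(x, \<eta> x) \<in> G" unfolding \<eta>_def by (rule someI[of "\<lambda>k. (x, k) \<in> G", OF xk])
    then obtain i s where 1: "i < ncomps D" "x = strand D i s" "\<eta> x = h i s" unfolding G_def by auto
    obtain j t where 2: "j < ncomps D" "x = strand D j t" "k = h j t" using xk unfolding G_def by auto
    show ?thesis using same[of i j s t] 1 2 by simp
  qed
  have "continuous_on (fst ` G) (\<lambda>x. (x, \<eta> x))"
    by (rule continuous_on_inv[OF continuous_on_fst[OF continuous_on_id] cG]) (auto simp: \<eta>)
  then have "continuous_on (fst ` G) (\<lambda>x. snd (x, \<eta> x))" by (rule continuous_on_snd)
  moreover have "fst ` G = P" unfolding G_def P_def by (simp add: image_UN image_image)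
  ultimately have c\<eta>: "continuous_on P \<eta>" by simp
  have \<eta>s: "\<eta> (strand D i s) = h i s" if "i < ncomps D" for i s
    by (rule \<eta>) (use that in \<open>auto simp: G_def\<close>)
  have bd: "\<eta> x \<in> box (-1) 1" if x: "x \<in> P" for x
  proof -
    obtain i s where "i < ncomps D" "x = strand D i s" using x by (auto simp: P_def)
    then show ?thesis using \<eta>s[of i s] h_bounds[of i s] by (simp add: box_real)
  qed
  have cl: "closedin (top_of_set S2) P"
    by (rule closed_subset[OF P_sub compact_imp_closed[OF P_compact]])
  have "box (-1) (1::real) \<noteq> {}" by simp
  then obtain H where H: "continuous_on S2 H" "\<And>x. x \<in> P \<Longrightarrow> H x = \<eta> x" "\<And>x. x \<in> S2 \<Longrightarrow> H x \<in> box (-1) 1"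
    using Tietze_open_interval_1[OF c\<eta> cl _ bd] by (metis neg_less_iff_less less_trans zero_less_one neg_less_0_iff_less)
  show thesis
  proof (rule that[OF H(1)])
    show "\<forall>x\<in>S2. -1 < H x \<and> H x < 1" using H(3) by (simp add: box_real)
    show "\<forall>i s. i < ncomps D \<longrightarrow> H (strand D i s) = h i s"
    proof (intro allI impI)
      fix i s assume i: "i < ncomps D"
      then have "strand D i s \<in> P" by (auto simp: P_def)
      then show "H (strand D i s) = h i s" using H(2) \<eta>s[OF i] by simp
    qed
  qed
qed

end

locale walled_lift = crossingless_lift D h for D h +
  fixes H :: "real^3 \<Rightarrow> real"
  assumes H_cont: "continuous_on S2 H" and H_bounds: "\<And>x. norm x = 1 \<Longrightarrow> -1 < H x \<and> H x < 1"
    and H_strand: "\<And>i s. i < ncomps D \<Longrightarrow> H (strand D i s) = h i s"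
begin

abbreviation top where "top \<equiv> over_wall H"

lemma at_height_X_iff:
  assumes "norm y = 1" "-1 < k" "k < 1"
  shows "at_height y k \<in> X \<longleftrightarrow> \<not> (y \<in> P \<and> k = H y)"
proof -
  have "at_height y k \<in> K \<longleftrightarrow> y \<in> P \<and> k = H y"
    unfolding at_height_in_K_iff[OF assms] P_def
  proof (intro iffI)
    assume "\<exists>i s. i < ncomps D \<and> strand D i s = y \<and> h i s = k"
    then obtain i s where "i < ncomps D" "strand D i s = y" "h i s = k" by (elim exE conjE)
    then show "y \<in> (\<Union>i<ncomps D. range (strand D i)) \<and> k = H y" using H_strand[of i s] by auto
  next
    assume a: "y \<in> (\<Union>i<ncomps D. range (strand D i)) \<and> k = H y"
    then obtain i s where "i < ncomps D" "y = strand D i s" by auto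
    then show "\<exists>i s. i < ncomps D \<and> strand D i s = y \<and> h i s = k" using H_strand[of i s] a by (intro exI[of _ i] exI[of _ s]) auto
  qed
  moreover have "at_height y k \<in> S3" using assms by (intro at_height_in_S3) auto
  ultimately show ?thesis by blast
qed

lemma off_wall_near:
  assumes z: "z \<in> X" and "snd z \<noteq> H (direction z)" "fst z \<noteq> 0"
  shows "\<exists>W. open W \<and> z \<in> W \<and> (\<forall>y\<in>W. fst y \<noteq> 0 \<and> (top y \<longleftrightarrow> top z))"
proof -
  have o: "open {z :: (real^3) \<times> real. fst z \<noteq> 0}" by (intro open_Collect_neq continuous_intros)
  have "continuous_on {z :: (real^3) \<times> real. fst z \<noteq> 0} (\<lambda>z. sgn (fst z))"
    unfolding sgn_div_norm by (intro continuous_intros) auto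
  then have c: "continuous_on {z :: (real^3) \<times> real. fst z \<noteq> 0} (\<lambda>z. snd z - H (direction z))"
    unfolding direction_def
    by (intro continuous_intros continuous_on_compose2[OF H_cont]) (auto simp: norm_sgn)
  have op: "open ({z. fst z \<noteq> 0} \<inter> (\<lambda>z. snd z - H (direction z)) -` E)" if "open E" for E
    using c o that by (intro continuous_open_preimage)
  show ?thesis
  proof (cases "top z")
    case True
    then show ?thesis using assms(3) op[of "{0<..}"]
      by (intro exI[of _ "{z. fst z \<noteq> 0} \<inter> (\<lambda>z. snd z - H (direction z)) -` {0<..}"]) (auto simp: over_wall_def)
  next
    case False
    then show ?thesis using assms(2,3) op[of "{..<0}"]
      by (intro exI[of _ "{z. fst z \<noteq> 0} \<inter> (\<lambda>z. snd z - H (direction z)) -` {..<0}"]) (auto simp: over_wall_def)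
  qed
qed

lemma pole_near:
  assumes z: "z = (0, 1) \<or> z = (0, -1)"
  shows "\<exists>W. open W \<and> z \<in> W \<and> (\<forall>y\<in>W. top y \<longleftrightarrow> top z)"
proof -
  have "compact (H ` S2)" by (intro compact_continuous_image H_cont compact_sphere)
  moreover have "H ` S2 \<noteq> {}" using strand_facts(1)[OF ncomps_pos] by fastforce
  ultimately obtain x1 x2 where x: "x1 \<in> S2" "x2 \<in> S2" "\<forall>x\<in>S2. H x \<le> H x1" "\<forall>x\<in>S2. H x2 \<le> H x"
    using compact_attains_sup[of "H ` S2"] compact_attains_inf[of "H ` S2"] by auto
  define e where "e = max 0 (max (H x1) (- H x2))"
  have e: "e < 1" "0 \<le> e" "\<forall>x\<in>S2. - e \<le> H x \<and> H x \<le> e"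
    using x H_bounds[of x1] H_bounds[of x2] unfolding e_def by fastforce+
  have b: "- e \<le> (if fst y = 0 then 0 else H (direction y))" "(if fst y = 0 then 0 else H (direction y)) \<le> e" for y :: "(real^3) \<times> real"
    using e(2,3) by (auto simp: direction_def norm_sgn)
  have o: "open {y :: (real^3) \<times> real. e < snd y}" "open {y :: (real^3) \<times> real. snd y < - e}"
    by (intro open_Collect_less continuous_intros)+
  have t: "top y" if "e < snd y" for y using b(2)[of y] that unfolding over_wall_def by linarith
  have nt: "\<not> top y" if "snd y < - e" for y using b(1)[of y] that unfolding over_wall_def by linarith
  from z show ?thesis
  proof
    assume "z = (0, 1)"
    then show ?thesis using o(1) t e(1) by (intro exI[of _ "{y. e < snd y}"]) auto
  next
    assume "z = (0, -1)"
    then show ?thesis using o(2) nt e(1) by (intro exI[of _ "{y. snd y < - e}"]) auto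
  qed
qed

text \<open>Away from the wall the cocycle vanishes locally. A point of the complement on the wall
  lies over a face, where \<open>c\<close> is locally constant. The points of the wall over the
  strands, where \<open>c\<close> is uncontrolled, belong to the link.\<close>

lemma wall_cocycle_local:
  fixes c :: "real^3 \<Rightarrow> 'g::group_add"
  assumes c: "loc_const (S2 - P) c"
  shows "local_cocycle X (wall_cocycle H c)"
  unfolding local_cocycle_def
proof
  fix z assume z: "z \<in> X"
  have same: "\<exists>W. open W \<and> z \<in> W \<and> cocycle_on (W \<inter> X) (wall_cocycle H c)"
    if ex: "\<exists>W. open W \<and> z \<in> W \<and> (\<forall>y\<in>W. top y \<longleftrightarrow> top z)"
  proof -
    obtain W where W: "open W" "z \<in> W" "\<forall>y\<in>W. top y \<longleftrightarrow> top z" using ex by (elim exE conjE)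
    have "cocycle_on (W \<inter> X) (wall_cocycle H c)"
      using W(3) unfolding cocycle_on_def wall_cocycle_def by simp
    then show ?thesis using W(1,2) by blast
  qed
  show "\<exists>W. open W \<and> z \<in> W \<and> cocycle_on (W \<inter> X) (wall_cocycle H c)"
  proof (cases "fst z = 0")
    case True
    then have "z = (0, 1) \<or> z = (0, -1)" using z by (intro S3_pole) auto
    then show ?thesis by (intro same pole_near)
  next
    case nz: False
    show ?thesis
    proof (cases "snd z = H (direction z)")
      case False
      obtain W where "open W" "z \<in> W" "\<forall>y\<in>W. fst y \<noteq> 0 \<and> (top y \<longleftrightarrow> top z)"
        using off_wall_near[OF z False nz] by (elim exE conjE)
      then show ?thesis by (intro same) blast
    next
      case True
      define y where "y = direction z"
      have zS: "z \<in> S3" using z by blast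
      note ah = at_height_sgn[OF zS nz]
      have "y \<notin> P"
        using at_height_X_iff[OF ah(4,2,3)] z True unfolding ah(1) y_def direction_def by blast
      then have yS: "y \<in> S2 - P" using ah(4) by (simp add: y_def direction_def)
      obtain W1 where W1[rule_format]: "open W1" "y \<in> W1" "\<forall>x. x \<in> W1 \<longrightarrow> x \<in> S2 - P \<longrightarrow> c x = c y"
        by (rule loc_constD[OF c yS])
      define W where "W = {z :: (real^3) \<times> real. fst z \<noteq> 0 \<and> sgn (fst z) \<in> W1 \<inter> - P}"
      have "open W" unfolding W_def
        by (intro open_fst_direction open_Int W1(1) open_Compl compact_imp_closed P_compact)
      moreover have "z \<in> W" using nz W1(2) yS by (simp add: W_def y_def direction_def)
      moreover have "cocycle_on (W \<inter> X) (wall_cocycle H c)"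
      proof -
        have "c (direction a) = c y" if "a \<in> W" for a
          using that W1(3) by (auto simp: W_def direction_def norm_sgn)
        then show ?thesis unfolding cocycle_on_def wall_cocycle_def by simp
      qed
      ultimately show ?thesis by blast
    qed
  qed
qed

lemma above_wall_meridian:
  assumes z: "z \<in> X" "top z" and s: "s \<in> {0..1}"
  shows "meridian z s \<in> X \<and> top (meridian z s)" "snd z \<noteq> -1" "meridian z 0 = (0, 1)" "meridian z 1 = z"
proof -
  have N: "(0, 1) \<in> X" "top (0, 1)" using north_above above_subset by (auto simp: over_wall_def)
  have S: "\<not> top (0, -1)" by (simp add: over_wall_def)
  have "z \<in> S3" using z by blast
  then have "(meridian z s \<in> X \<and> top (meridian z s)) \<and> snd z \<noteq> -1 \<and> meridian z 0 = (0, 1) \<and> meridian z 1 = z"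
  proof (cases rule: S3_cases)
    case 1
    then show ?thesis using N by (simp add: meridian_pole)
  next
    case 2
    then show ?thesis using S z by simp
  next
    case (3 x k)
    have Hk: "H x < k" using z(2) 3 over_wall_at_height by simp
    have e: "meridian z 0 = (0, 1)" "meridian z 1 = z" using 3 by (simp_all add: meridian_at_height at_height_poles)
    have "s * (1 - k) \<le> 1 * (1 - k)" using s 3 by (intro mult_right_mono) auto
    then have le: "k \<le> 1 - s * (1 - k)" by simp
    show ?thesis
    proof (cases "s = 0")
      case True
      then show ?thesis using N e 3 by simp
    next
      case False
      then have lt: "1 - s * (1 - k) < 1" "-1 < 1 - s * (1 - k)" using s 3 le by auto
      have m: "meridian z s = at_height x (1 - s * (1 - k))" using 3 s by (simp add: meridian_at_height)
      show ?thesis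
        unfolding m at_height_X_iff[OF 3(1) lt(2,1)] over_wall_at_height[OF 3(1) lt(2,1)]
        using Hk le e 3 by auto
    qed
  qed
  then show "meridian z s \<in> X \<and> top (meridian z s)" "snd z \<noteq> -1" "meridian z 0 = (0, 1)" "meridian z 1 = z" by blast+
qed

text \<open>The wall counts as lying below, so descending points satisfy a weak inequality. The link
  could be hit only in the case of equality, which would place \<open>z\<close> itself in the
  link.\<close>

lemma below_wall_meridian:
  assumes z: "z \<in> X" "\<not> top z" and s: "s \<in> {0..1}"
  defines "m \<equiv> \<lambda>s. flip_height (meridian (flip_height z) s)"
  shows "m s \<in> X \<and> \<not> top (m s)" "snd z \<noteq> 1" "m 0 = (0, -1)" "m 1 = z"
proof -
  have N: "top (0, 1)" by (simp add: over_wall_def)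
  have S: "(0, -1) \<in> X" "\<not> top (0, -1)" using south_below below_subset by (auto simp: over_wall_def)
  have f: "flip_height (0, -1) = (0, 1)" "flip_height (0, 1) = (0, -1)" by (simp_all add: flip_height_def)
  have "z \<in> S3" using z by blast
  then have "(m s \<in> X \<and> \<not> top (m s)) \<and> snd z \<noteq> 1 \<and> m 0 = (0, -1) \<and> m 1 = z"
  proof (cases rule: S3_cases)
    case 1
    then show ?thesis using N z by simp
  next
    case 2
    then show ?thesis using S by (simp add: m_def f meridian_pole)
  next
    case (3 x k)
    have Hk: "k \<le> H x" using z(2) 3 over_wall_at_height by simp
    have fz: "flip_height z = at_height x (- k)" using 3 by (simp add: flip_height_at_height)
    have mm: "m u = at_height x (- (1 - u * (1 + k)))" if "0 \<le> u" "u \<le> 1" for u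
      unfolding m_def fz using 3 that by (simp add: meridian_at_height flip_height_at_height)
    have e: "m 0 = (0, -1)" "m 1 = z" using 3 mm[of 0] mm[of 1] by (simp_all add: at_height_poles)
    have "s * (1 + k) \<le> 1 * (1 + k)" using s 3 by (intro mult_right_mono) auto
    then have le: "- (1 - s * (1 + k)) \<le> k" by simp
    show ?thesis
    proof (cases "s = 0")
      case True
      then show ?thesis using S e 3 by simp
    next
      case False
      then have "0 < s * (1 + k)" using s 3 by simp
      then have lt: "-1 < - (1 - s * (1 + k))" "- (1 - s * (1 + k)) < 1" using 3 le by auto
      have m: "m s = at_height x (- (1 - s * (1 + k)))" using s mm by simp
      have "\<not> (x \<in> P \<and> - (1 - s * (1 + k)) = H x)"
      proof
        assume a: "x \<in> P \<and> - (1 - s * (1 + k)) = H x"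
        then have "k = H x" using le Hk by simp
        then show False using a z(1) 3 at_height_X_iff[OF 3(1-3)] by simp
      qed
      then show ?thesis
        unfolding m at_height_X_iff[OF 3(1) lt] over_wall_at_height[OF 3(1) lt]
        using Hk le e 3 by auto
    qed
  qed
  then show "m s \<in> X \<and> \<not> top (m s)" "snd z \<noteq> 1" "m 0 = (0, -1)" "m 1 = z" by blast+
qed

text \<open>Both cocycles vanish between points on the same side of the wall, so the gauge is
  constant along meridians and takes one value above and one below. Comparing a wall point over a
  face with a slightly higher point relates \<open>c\<close> to \<open>c'\<close> by these two
  values.\<close>

lemma wall_gauge:
  fixes c c' :: "real^3 \<Rightarrow> 'g::group_add"
  assumes "gauge_equiv X (wall_cocycle H c) (wall_cocycle H c')"
  shows "\<exists>T B. \<forall>y\<in>S2 - P. T + c y = c' y + B"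
proof -
  obtain F where "\<forall>x\<in>X. \<exists>W. open W \<and> x \<in> W \<and>
     (\<forall>a\<in>W \<inter> X. \<forall>b\<in>W \<inter> X. F a + wall_cocycle H c a b = wall_cocycle H c' a b + F b)"
    using assms unfolding gauge_equiv_def by (elim exE)
  then have F: "\<exists>W. open W \<and> x \<in> W \<and>
     (\<forall>a\<in>W \<inter> X. \<forall>b\<in>W \<inter> X. F a + wall_cocycle H c a b = wall_cocycle H c' a b + F b)" if "x \<in> X" for x
    using that by (rule bspec)
  have lc: "loc_const {z \<in> X. top z = q} F" for q
    unfolding loc_const_def
  proof
    fix z assume z: "z \<in> {z \<in> X. top z = q}"
    then have zX: "z \<in> X" by blast
    obtain W where W: "open W" "z \<in> W" and
      WF: "\<forall>a\<in>W \<inter> X. \<forall>b\<in>W \<inter> X. F a + wall_cocycle H c a b = wall_cocycle H c' a b + F b"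
      using F[OF zX] by (elim exE conjE)
    have "F y = F z" if y: "y \<in> W \<inter> {z \<in> X. top z = q}" for y
    proof -
      have "wall_cocycle H c y z = 0" "wall_cocycle H c' y z = 0"
        using y z by (auto simp: wall_cocycle_def)
      moreover have "y \<in> W \<inter> X" "z \<in> W \<inter> X" using y zX W(2) by auto
      ultimately show ?thesis using WF by force
    qed
    then show "\<exists>W. open W \<and> z \<in> W \<and> (\<forall>y\<in>W \<inter> {z \<in> X. top z = q}. F y = F z)" by (intro exI[of _ W] conjI W ballI)
  qed
  have topF: "F z = F (0, 1)" if z: "z \<in> X" "top z" for z
  proof (rule loc_const_connected)
    have "continuous_on ({z} \<times> {0..1}) (\<lambda>(x, s). meridian x s)"
      using above_wall_meridian(2)[OF z, of 0] by (intro continuous_meridian) auto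
    then have "connected ((\<lambda>(x, s). meridian x s) ` ({z} \<times> {0..1}))"
      by (intro connected_continuous_image connected_Times) auto
    moreover have "(\<lambda>(x, s). meridian x s) ` ({z} \<times> {0..1}) = meridian z ` {0..1}" by force
    ultimately show "connected (meridian z ` {0..1})" by simp
    show "loc_const (meridian z ` {0..1}) F"
      by (rule loc_const_subset[OF lc[of True]]) (use above_wall_meridian(1)[OF z] in auto)
    show "z \<in> meridian z ` {0..1}" using above_wall_meridian(4)[OF z, of 0] by (intro image_eqI[of _ _ 1]) auto
    show "(0, 1) \<in> meridian z ` {0..1}" using above_wall_meridian(3)[OF z, of 0] by (intro image_eqI[of _ _ 0]) auto
  qed
  have botF: "F z = F (0, -1)" if z: "z \<in> X" "\<not> top z" for z
  proof (rule loc_const_connected)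
    let ?m = "\<lambda>s. flip_height (meridian (flip_height z) s)"
    have "snd (flip_height z) \<noteq> -1" using below_wall_meridian(2)[OF z, of 0] by (simp add: flip_height_def)
    then have "continuous_on ({flip_height z} \<times> {0..1}) (\<lambda>(x, s). meridian x s)"
      by (intro continuous_meridian) auto
    then have "connected ((\<lambda>(x, s). meridian x s) ` ({flip_height z} \<times> {0..1}))"
      by (intro connected_continuous_image connected_Times) auto
    then have "connected (flip_height ` (\<lambda>(x, s). meridian x s) ` ({flip_height z} \<times> {0..1}))"
      by (rule connected_continuous_image[OF continuous_flip_height])
    moreover have "flip_height ` (\<lambda>(x, s). meridian x s) ` ({flip_height z} \<times> {0..1}) = ?m ` {0..1}" by force
    ultimately show "connected (?m ` {0..1})" by simp
    show "loc_const (?m ` {0..1}) F"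
      by (rule loc_const_subset[OF lc[of False]]) (use below_wall_meridian(1)[OF z] in auto)
    show "z \<in> ?m ` {0..1}" using below_wall_meridian(4)[OF z, of 0] by (intro image_eqI[of _ _ 1]) auto
    show "(0, -1) \<in> ?m ` {0..1}" using below_wall_meridian(3)[OF z, of 0] by (intro image_eqI[of _ _ 0]) auto
  qed
  have "F (0, 1) + c y = c' y + F (0, -1)" if y: "y \<in> S2 - P" for y
  proof -
    have y1: "norm y = 1" "y \<notin> P" using y by auto
    note b = H_bounds[OF y1(1)]
    define z where "z = at_height y (H y)"
    have zX: "z \<in> X" unfolding z_def using at_height_X_iff[OF y1(1)] b y1(2) by blast
    obtain W where W: "open W" "z \<in> W" and
      WF: "\<forall>a\<in>W \<inter> X. \<forall>b\<in>W \<inter> X. F a + wall_cocycle H c a b = wall_cocycle H c' a b + F b"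
      using F[OF zX] by (elim exE conjE)
    have "continuous_on UNIV (\<lambda>k. at_height y k)" by (intro continuous_at_height continuous_intros)
    then have "open ((\<lambda>k. at_height y k) -` W)" using W(1) by (simp add: continuous_on_open_vimage)
    moreover have "H y \<in> (\<lambda>k. at_height y k) -` W" using W(2) by (simp add: z_def)
    ultimately obtain e where e: "0 < e" "ball (H y) e \<subseteq> (\<lambda>k. at_height y k) -` W" by (metis openE)
    \<comment> \<open>A height above the wall, below 1 and within \<open>e\<close> of the wall. The
      wall point \<open>z\<close> serves as the lower partner.\<close>
    define k where "k = min (H y + e / 2) ((H y + 1) / 2)"
    have k: "H y < k" "k < 1" "-1 < k" "k < H y + e" using e(1) b by (auto simp: k_def min_def)
    have "k \<in> ball (H y) e" using k by (simp add: dist_real_def)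
    then have aW: "at_height y k \<in> W" using e(2) by auto
    have aX: "at_height y k \<in> X" using at_height_X_iff[OF y1(1) k(3,2)] y1(2) by blast
    have ta: "top (at_height y k)" using over_wall_at_height[OF y1(1) k(3,2)] k(1) by simp
    have tz: "\<not> top z" using over_wall_at_height[OF y1(1), of "H y" H] b by (simp add: z_def)
    have d: "direction (at_height y k) = y" unfolding direction_def by (rule at_height_fst(2)[OF y1(1) k(3,2)])
    have "F (at_height y k) + wall_cocycle H c (at_height y k) z = wall_cocycle H c' (at_height y k) z + F z"
      using WF aW aX W(2) zX by blast
    then show ?thesis using topF[OF aX ta] botF[OF zX tz] ta tz d by (simp add: wall_cocycle_def)
  qed
  then show ?thesis by blast
qed

end

text \<open>The last loop lies in one component \<open>F\<close> of the complement of the others,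
  and by the Jordan curve theorem it separates two points of \<open>F\<close> close to it. At most
  one old representative lies in \<open>F\<close>; replacing it by these two gains at least
  one.\<close>

lemma disjoint_loops_faces:
  fixes p :: "nat \<Rightarrow> real \<Rightarrow> complex"
  assumes "\<And>i. i < n \<Longrightarrow> simple_path (p i) \<and> pathfinish (p i) = pathstart (p i)"
    and "\<And>i j. i < n \<Longrightarrow> j < n \<Longrightarrow> i \<noteq> j \<Longrightarrow> path_image (p i) \<inter> path_image (p j) = {}"
  shows "\<exists>Z. finite Z \<and> Suc n \<le> card Z \<and> Z \<inter> (\<Union>i<n. path_image (p i)) = {} \<and>
    (\<forall>z\<in>Z. \<forall>w\<in>Z. z \<noteq> w \<longrightarrow> \<not> connected_component (- (\<Union>i<n. path_image (p i))) z w)"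
  using assms
proof (induction n)
  case 0
  show ?case by (rule exI[of _ "{0}"]) simp
next
  case (Suc n)
  define S where "S = (\<Union>i<n. path_image (p i))"
  define C where "C = path_image (p n)"
  have "\<exists>Z. finite Z \<and> Suc n \<le> card Z \<and> Z \<inter> (\<Union>i<n. path_image (p i)) = {} \<and>
    (\<forall>z\<in>Z. \<forall>w\<in>Z. z \<noteq> w \<longrightarrow> \<not> connected_component (- (\<Union>i<n. path_image (p i))) z w)"
    by (rule Suc.IH) (use Suc.prems in auto)
  then obtain Z where Z: "finite Z" "Suc n \<le> card Z" "Z \<inter> S = {}"
      "\<forall>z\<in>Z. \<forall>w\<in>Z. z \<noteq> w \<longrightarrow> \<not> connected_component (- S) z w"
    unfolding S_def by (elim exE conjE)
  have S': "(\<Union>i<Suc n. path_image (p i)) = S \<union> C" unfolding S_def C_def by (auto simp: less_Suc_eq)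
  have pn: "simple_path (p n)" "pathfinish (p n) = pathstart (p n)" using Suc.prems(1)[of n] by auto
  have "closed S" unfolding S_def
    using Suc.prems(1) by (intro closed_UN) (auto intro: closed_simple_path_image)
  then have oS: "open (- S)" by auto
  have "C \<inter> path_image (p i) = {}" if "i < n" for i
    using Suc.prems(2)[of n i] that unfolding C_def by simp
  then have CS: "C \<inter> S = {}" unfolding S_def by blast
  have "pathstart (p n) \<in> C" unfolding C_def by (rule pathstart_in_path_image)
  then obtain x0 where x0: "x0 \<in> C" by blast
  define F where "F = connected_component_set (- S) x0"
  have oF: "open F" unfolding F_def by (rule open_connected_component[OF oS])
  have "connected C" unfolding C_def by (rule connected_simple_path_image[OF pn(1)])
  then have CF: "C \<subseteq> F" unfolding F_def using CS x0 by (intro connected_component_maximal) auto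
  have FS: "F \<subseteq> - S" unfolding F_def by (rule connected_component_subset)
  note J = Jordan_inside_outside[OF pn, folded C_def]
  have fr: "frontier (inside C) = C" "frontier (outside C) = C" "inside C \<inter> outside C = {}" "inside C \<union> outside C = - C"
    using J by simp_all
  have "x0 \<in> closure (inside C)" "x0 \<in> closure (outside C)" using fr(1,2) x0 by (auto simp: frontier_def)
  moreover have "x0 \<in> F" using CF x0 by blast
  ultimately obtain a b where a: "a \<in> F" "a \<in> inside C" and b: "b \<in> F" "b \<in> outside C"
    using open_Int_closure_eq_empty[OF oF, of "inside C"] open_Int_closure_eq_empty[OF oF, of "outside C"] by blast
  define Z0 where "Z0 = Z - F"
  define Z' where "Z' = insert a (insert b Z0)"
  have "card (Z \<inter> F) \<le> Suc 0"
  proof (rule card_le_Suc0_iff_eq[THEN iffD2])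
    show "finite (Z \<inter> F)" using Z(1) by blast
    show "\<forall>z\<in>Z \<inter> F. \<forall>w\<in>Z \<inter> F. z = w"
    proof (intro ballI)
      fix z w assume zw: "z \<in> Z \<inter> F" "w \<in> Z \<inter> F"
      then have "connected_component (- S) x0 z" "connected_component (- S) x0 w" unfolding F_def by auto
      then have "connected_component (- S) z w" by (metis connected_component_sym connected_component_trans)
      then show "z = w" using Z(4) zw by blast
    qed
  qed
  moreover have "card Z = card (Z \<inter> F) + card Z0"
    unfolding Z0_def using Z(1) by (metis card_Int_Diff)
  ultimately have cz: "n \<le> card Z0" using Z(2) by linarith
  have f0: "finite Z0" using Z(1) by (simp add: Z0_def)
  have ab: "a \<noteq> b" "a \<notin> Z0" "b \<notin> Z0" using a b fr(3) unfolding Z0_def by blast+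
  then have "card Z' = Suc (Suc (card Z0))" unfolding Z'_def using f0 by simp
  then have c1: "Suc (Suc n) \<le> card Z'" using cz by simp
  have mono: "connected_component (- S) z w" "connected_component (- C) z w" if "connected_component (- (S \<union> C)) z w" for z w
    using connected_component_of_subset[OF that] by auto
  have nab: "\<not> connected_component (- (S \<union> C)) a b"
    using inside_same_component[of C a b] mono(2) a(2) b(2) fr(3) by blast
  have naz: "\<not> connected_component (- (S \<union> C)) y z" if "y \<in> F" "z \<in> Z0" for y z
  proof
    assume "connected_component (- (S \<union> C)) y z"
    then have "connected_component (- S) y z" by (rule mono)
    moreover have "connected_component (- S) x0 y" using that(1) by (simp add: F_def)
    ultimately have "z \<in> F" unfolding F_def by (metis connected_component_trans mem_Collect_eq)
    then show False using that(2) by (simp add: Z0_def)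
  qed
  have nzz: "\<not> connected_component (- (S \<union> C)) z w" if "z \<in> Z0" "w \<in> Z0" "z \<noteq> w" for z w
    using mono(1)[of z w] Z(4) that by (auto simp: Z0_def)
  have sep: "\<not> connected_component (- (S \<union> C)) z w" if zw: "z \<in> Z'" "w \<in> Z'" "z \<noteq> w" for z w
  proof -
    consider "z = a" "w = b" | "z = b" "w = a" | "z \<in> F" "w \<in> Z0" | "z \<in> Z0" "w \<in> F" | "z \<in> Z0" "w \<in> Z0"
      using zw a(1) b(1) unfolding Z'_def by blast
    then show ?thesis
    proof cases
      case 2 then show ?thesis using nab connected_component_sym by metis
    next
      case 4 then show ?thesis using naz connected_component_sym by metis
    qed (use nab naz nzz zw(3) in auto)
  qed
  have off: "Z' \<inter> (S \<union> C) = {}"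
    using a b FS CF Z(3) fr(4) unfolding Z'_def Z0_def by blast
  show ?case unfolding S'
    by (rule exI[of _ Z']) (use f0 c1 off sep in \<open>auto simp: Z'_def\<close>)
qed

text \<open>Projection from a point off the diagram turns the strands into disjoint loops in the
  plane. A locally constant function with different values certifies that the chosen faces are
  different, without an exact count of all faces.\<close>

lemma (in crossingless_lift) face_index:
  shows "\<exists>z ind. (\<forall>k\<le>ncomps D. z k \<in> S2 - P \<and> ind (z k) = k) \<and> loc_const (S2 - P) (ind :: real^3 \<Rightarrow> nat)"
proof -
  let ?n = "ncomps D"
  have "strand D 0 0 \<in> S2" using strand_facts(1)[OF ncomps_pos] by simp
  then obtain x\<^sub>0 where x0: "x\<^sub>0 \<in> S2" "x\<^sub>0 \<notin> P" using off_P_dense[OF openin_subtopology_self] by blast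
  have "(S2 - {x\<^sub>0}) homeomorphic (UNIV :: complex set)"
    using x0(1) by (intro homeomorphic_punctured_sphere_affine) (auto simp: aff_dim_UNIV)
  then obtain \<psi> \<phi> where hom: "homeomorphism (S2 - {x\<^sub>0}) (UNIV :: complex set) \<psi> \<phi>"
    unfolding homeomorphic_def by (elim exE)
  have \<psi>: "continuous_on (S2 - {x\<^sub>0}) \<psi>" "\<And>x. x \<in> S2 - {x\<^sub>0} \<Longrightarrow> \<phi> (\<psi> x) = x"
    and \<phi>: "continuous_on UNIV \<phi>" "\<And>w. \<psi> (\<phi> w) = w" and ran: "range \<phi> = S2 - {x\<^sub>0}"
    using hom unfolding homeomorphism_def by auto
  have \<phi>3: "\<phi> w \<in> S2 - {x\<^sub>0}" for w using rangeI[of \<phi> w] unfolding ran .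
  define p where "p i = \<psi> \<circ> strand D i" for i
  have sin: "strand D i s \<in> S2 - {x\<^sub>0}" if "i < ?n" for i s
    using strand_facts(1)[OF that] x0(2) that by (auto simp: P_def)
  have inj: "i = j \<and> s - t \<in> \<int>" if "i < ?n" "j < ?n" "p i s = p j t" for i j s t
  proof -
    have "\<phi> (p i s) = \<phi> (p j t)" using that(3) by simp
    then have "strand D i s = strand D j t" using \<psi>(2)[OF sin[OF that(1)]] \<psi>(2)[OF sin[OF that(2)]] by (simp add: p_def)
    then show ?thesis using noncrossing_fiber[of j t i s] no_crossings that by auto
  qed
  have loops: "simple_path (p i) \<and> pathfinish (p i) = pathstart (p i)" if i: "i < ?n" for i
  proof
    have "continuous_on {0..1} (p i)"
      unfolding p_def by (intro continuous_on_compose continuous_on_subset[OF curve_cont[OF i]] continuous_on_subset[OF \<psi>(1)])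
        (use sin[OF i] in auto)
    moreover have "loop_free (p i)"
      unfolding loop_free_def
    proof (intro ballI impI)
      fix s t :: real assume st: "s \<in> {0..1}" "t \<in> {0..1}" "p i s = p i t"
      obtain k where k: "s - t = of_int k" using inj[OF i i st(3)] by (auto elim: Ints_cases)
      have "\<bar>s - t\<bar> \<le> 1" using st by auto
      then have "k = 0 \<or> k = 1 \<or> k = -1" using k by linarith
      then show "s = t \<or> s = 0 \<and> t = 1 \<or> s = 1 \<and> t = 0" using k st(1,2) by auto
    qed
    ultimately show "simple_path (p i)" by (simp add: simple_path_def path_def)
    show "pathfinish (p i) = pathstart (p i)"
      using strand_facts(2)[OF i, of 0] by (simp add: pathfinish_def pathstart_def p_def)
  qed
  have disj: "path_image (p i) \<inter> path_image (p j) = {}" if ij: "i < ?n" "j < ?n" "i \<noteq> j" for i j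
    using inj[OF ij(1,2)] ij(3) by (auto simp: path_image_def)
  define S where "S = (\<Union>i<?n. path_image (p i))"
  obtain Z where Z: "finite Z" "Suc ?n \<le> card Z" "Z \<inter> S = {}"
      "\<forall>z\<in>Z. \<forall>w\<in>Z. z \<noteq> w \<longrightarrow> \<not> connected_component (- S) z w"
  proof -
    have "\<exists>Z. finite Z \<and> Suc ?n \<le> card Z \<and> Z \<inter> S = {} \<and>
        (\<forall>z\<in>Z. \<forall>w\<in>Z. z \<noteq> w \<longrightarrow> \<not> connected_component (- S) z w)"
      unfolding S_def by (rule disjoint_loops_faces) (rule loops disj; assumption)+
    then show thesis by (elim exE conjE) (rule that)
  qed
  have SP: "\<psi> x \<notin> S" if x: "x \<in> S2 - P" "x \<noteq> x\<^sub>0" for x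
  proof
    assume "\<psi> x \<in> S"
    then obtain i s where i: "i < ?n" "\<psi> x = \<psi> (strand D i s)" by (auto simp: S_def path_image_def p_def)
    then have "\<phi> (\<psi> x) = \<phi> (\<psi> (strand D i s))" by simp
    then have "x = strand D i s" using \<psi>(2)[of x] \<psi>(2)[OF sin[OF i(1)]] x by simp
    then show False using x(1) i(1) by (auto simp: P_def)
  qed
  have PS: "\<phi> w \<in> S2 - P" if w: "w \<notin> S" for w
  proof -
    have "\<phi> w \<notin> P"
    proof
      assume "\<phi> w \<in> P"
      then obtain i s where i: "i < ?n" "\<phi> w = strand D i s" by (auto simp: P_def)
      have "strand D i s = strand D i (frac s)" using periodic_frac[of "strand D i" s] strand_facts(2)[OF i(1)] by simp
      then have "w = p i (frac s)" using i(2) \<phi>(2)[of w] by (simp add: p_def)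
      moreover have "frac s \<in> {0..1}" by (simp add: frac_lt_1 less_imp_le)
      ultimately have "w \<in> path_image (p i)" unfolding path_image_def by blast
      then show False using w i(1) by (auto simp: S_def)
    qed
    then show ?thesis using \<phi>3 by blast
  qed
  have cS: "compact S" unfolding S_def using loops by (intro compact_UN) (auto intro: compact_simple_path_image)
  then have oS: "open (- S)" by (simp add: compact_imp_closed open_Compl)
  obtain e where e: "bij_betw e {0..<card Z} Z" using ex_bij_betw_nat_finite[OF Z(1)] by (elim exE)
  have eZ: "e k \<in> Z" if "k \<le> ?n" for k using e that Z(2) by (auto simp: bij_betw_def)
  have einj: "k = l" if kl: "k \<le> ?n" "l \<le> ?n" "connected_component (- S) (e k) (e l)" for k l
  proof -
    have "e k = e l" using Z(4) eZ[OF kl(1)] eZ[OF kl(2)] kl(3) by blast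
    then show ?thesis using e kl(1,2) Z(2) by (auto simp: bij_betw_def inj_on_def)
  qed
  \<comment> \<open>Components without a representative get the number 0. This is harmless, as only
    local constancy and the values at the representatives matter.\<close>
  define g where "g w = (if \<exists>k\<le>?n. connected_component (- S) (e k) w then THE k. k \<le> ?n \<and> connected_component (- S) (e k) w else 0)" for w
  have lcg: "loc_const (- S) g"
    unfolding loc_const_def
  proof
    fix w assume w: "w \<in> - S"
    have gy: "g y = g w" if y: "y \<in> connected_component_set (- S) w" for y
    proof -
      have "connected_component (- S) w y" using y by simp
      then have "connected_component (- S) (e k) y \<longleftrightarrow> connected_component (- S) (e k) w" for k
        by (metis connected_component_sym connected_component_trans)
      then show ?thesis unfolding g_def by (simp only:)
    qed
    have ww: "w \<in> connected_component_set (- S) w" using w by simp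
    show "\<exists>W. open W \<and> w \<in> W \<and> (\<forall>y\<in>W \<inter> - S. g y = g w)"
      by (rule exI[of _ "connected_component_set (- S) w"])
        (intro conjI open_connected_component[OF oS] ww ballI gy, erule IntD1)
  qed
  have ge: "g (e k) = k" if k: "k \<le> ?n" for k
  proof -
    have "e k \<in> - S" using eZ[OF k] Z(3) by blast
    then have c: "connected_component (- S) (e k) (e k)" by simp
    have "(THE l. l \<le> ?n \<and> connected_component (- S) (e l) (e k)) = k"
      by (rule the_equality) (use k c einj in auto)
    then show ?thesis unfolding g_def using k c by auto
  qed
  obtain r where "\<forall>w\<in>S. norm w \<le> r" using compact_imp_bounded[OF cS] unfolding bounded_iff by (elim exE)
  then have r: "S \<subseteq> cball 0 r" by auto
  have conn: "connected (- cball (0::complex) r)" by (intro connected_complement_bounded_convex) auto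
  have far: "loc_const (- cball 0 r) g" by (rule loc_const_subset[OF lcg]) (use r in blast)
  \<comment> \<open>The exterior of a large disc is connected and misses the loops, so
    \<open>g\<close> has one value there. Assigned to the centre \<open>x\<^sub>0\<close> of the
    projection it keeps the numbering locally constant.\<close>
  obtain v where v: "\<forall>w\<in>- cball 0 r. g w = v" by (rule loc_const_const[OF conn far order_refl])
  define ind where "ind x = (if x = x\<^sub>0 then v else g (\<psi> x))" for x
  have "loc_const (S2 - P) ind"
    unfolding loc_const_def
  proof
    fix x assume x: "x \<in> S2 - P"
    show "\<exists>W. open W \<and> x \<in> W \<and> (\<forall>y\<in>W \<inter> (S2 - P). ind y = ind x)"
    proof (cases "x = x\<^sub>0")
      case True
      define W where "W = - \<phi> ` cball 0 r"
      have "compact (\<phi> ` cball 0 r)" by (intro compact_continuous_image continuous_on_subset[OF \<phi>(1)]) auto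
      then have "open W" unfolding W_def by (simp add: compact_imp_closed open_Compl)
      moreover have "x \<in> W" using \<phi>3 True by (auto simp: W_def)
      moreover have "ind y = ind x" if y: "y \<in> W \<inter> (S2 - P)" for y
      proof (cases "y = x\<^sub>0")
        case False
        have "\<psi> y \<notin> cball 0 r"
        proof
          assume "\<psi> y \<in> cball 0 r"
          then have "\<phi> (\<psi> y) \<in> \<phi> ` cball 0 r" by blast
          then show False using y \<psi>(2)[of y] False by (simp add: W_def)
        qed
        then show ?thesis using v False True by (simp add: ind_def)
      qed (simp add: True)
      ultimately show ?thesis by (intro exI[of _ W] conjI ballI)
    next
      case False
      have "loc_const (S2 - P - {x\<^sub>0}) (\<lambda>y. g (\<psi> y))"
        by (rule loc_const_compose[OF lcg]) (use SP in \<open>auto intro: continuous_on_subset[OF \<psi>(1)]\<close>)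
      moreover have xx: "x \<in> S2 - P - {x\<^sub>0}" using x False by blast
      ultimately obtain W where W: "open W" "x \<in> W" "\<forall>y. y \<in> W \<longrightarrow> y \<in> S2 - P - {x\<^sub>0} \<longrightarrow> g (\<psi> y) = g (\<psi> x)"
        by (rule loc_constD)
      have "ind y = ind x" if y: "y \<in> (W - {x\<^sub>0}) \<inter> (S2 - P)" for y
        using W(3)[rule_format, of y] y False by (simp add: ind_def)
      then show ?thesis using W(1,2) False
        by (intro exI[of _ "W - {x\<^sub>0}"] conjI ballI) (auto intro: open_delete)
    qed
  qed
  moreover have "\<phi> (e k) \<in> S2 - P \<and> ind (\<phi> (e k)) = k" if k: "k \<le> ?n" for k
  proof -
    have "e k \<notin> S" using eZ[OF k] Z(3) by blast
    then show ?thesis using PS \<phi>(2)[of "e k"] \<phi>3[of "e k"] ge[OF k] by (auto simp: ind_def)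
  qed
  ultimately show ?thesis by (intro exI[of _ "\<lambda>k. \<phi> (e k)"] exI[of _ ind]) blast
qed

section \<open>Comparison of two diagrams\<close>

lemma card_components_homeomorphism:
  assumes "homeomorphism A B f g"
  shows "card (components A) = card (components B)"
proof -
  have fA: "B = f ` A" "inj_on f A"
    using assms unfolding homeomorphism_def by (auto intro: inj_on_inverseI)
  have "components B = (\<lambda>C. f ` C) ` components A"
    unfolding components_def fA(1)[symmetric] image_image
    using connected_component_set_homeomorphism[OF assms] fA(1) by (auto simp: image_iff)
  moreover have "inj_on (\<lambda>C. f ` C) (components A)"
    by (rule inj_on_subset[OF inj_on_image_Pow[OF fA(2)]]) (use in_components_subset in auto)
  ultimately show ?thesis by (simp add: card_image)
qed

text \<open>Lifts of different strands are disjoint because the heights at a crossing differ, so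
  these compact connected sets are the components.\<close>

lemma (in diagram_lift) card_components_K: "card (components K) = ncomps D"
proof -
  define k where "k i = range (\<lambda>s. at_height (strand D i s) (h i s))" for i
  have K: "K = (\<Union>i<ncomps D. k i)" by (simp add: K_def k_def)
  have ne: "k i \<noteq> {}" for i by (simp add: k_def)
  have conn: "connected (k i)" if "i < ncomps D" for i
    unfolding k_def using curve_cont[OF that] h_cont[OF that]
    by (intro connected_continuous_image continuous_at_height) auto
  have comp: "compact (k i)" if i: "i < ncomps D" for i
  proof -
    have "at_height (strand D i s) (h i s) \<in> (\<lambda>s. at_height (strand D i s) (h i s)) ` {0..1}" for s
      by (rule image_eqI[of _ _ "frac s"])
        (simp_all add: periodic_frac[of "strand D i"] periodic_frac[of "h i"] curve_periodic height_periodic i frac_lt_1 less_imp_le)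
    then have "k i = (\<lambda>s. at_height (strand D i s) (h i s)) ` {0..1}" unfolding k_def by auto
    moreover have "compact ((\<lambda>s. at_height (strand D i s) (h i s)) ` {0..1})"
      using curve_cont[OF i] height_cont[OF i]
      by (intro compact_continuous_image continuous_at_height) (auto intro: continuous_on_subset)
    ultimately show ?thesis by simp
  qed
  have disj: "k i \<inter> k j = {}" if ij: "i < ncomps D" "j < ncomps D" "i \<noteq> j" for i j
  proof (rule ccontr)
    assume "k i \<inter> k j \<noteq> {}"
    then obtain x where x: "x \<in> k i" "x \<in> k j" by (metis Int_iff all_not_in_conv)
    obtain s where s: "x = at_height (strand D i s) (h i s)" using x(1) unfolding k_def by (rule imageE)
    obtain t where t: "x = at_height (strand D j t) (h j t)" using x(2) unfolding k_def by (rule imageE)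
    have "at_height (strand D i s) (h i s) = at_height (strand D j t) (h j t)" using s t by metis
    then have st: "strand D i s = strand D j t" "h i s = h j t"
      using at_height_eq_iff[OF strand_facts(1)[OF ij(1)] strand_facts(1)[OF ij(2)], of "h i s" s t "h j t"] h_bounds[OF ij(1), of s] by auto
    then have m: "meet D i s j t" using ij by (simp add: meet_def)
    show False
      using h_over[OF m] h_over[OF meet_sym[OF m]] meet_facts(5)[OF m] st(2) by fastforce
  qed
  have comps: "connected_component_set K x = k i" if i: "i < ncomps D" and x: "x \<in> k i" for i x
  proof
    show "k i \<subseteq> connected_component_set K x"
      by (rule connected_component_maximal[OF x conn[OF i]]) (use i K in blast)
    define R where "R = (\<Union>j\<in>{..<ncomps D} - {i}. k j)"
    let ?C = "connected_component_set K x"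
    have "closed R" unfolding R_def using comp by (intro closed_UN) (auto intro: compact_imp_closed)
    moreover have "closed (k i)" using comp[OF i] by (rule compact_imp_closed)
    moreover have "?C \<subseteq> k i \<union> R" using connected_component_subset[of K x] K by (auto simp: R_def)
    moreover have "k i \<inter> R \<inter> ?C = {}" using disj[OF i] by (auto simp: R_def)
    moreover have "k i \<inter> ?C \<noteq> {}"
    proof -
      have "x \<in> K" using x i K by blast
      then have "x \<in> k i \<inter> ?C" using x by simp
      then show ?thesis by blast
    qed
    ultimately have "R \<inter> ?C = {}"
      using connected_connected_component[of K x] unfolding connected_closed by blast
    then show "?C \<subseteq> k i" using \<open>?C \<subseteq> k i \<union> R\<close> by blast
  qed
  have "components K = k ` {..<ncomps D}"
  proof
    show "components K \<subseteq> k ` {..<ncomps D}"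
    proof
      fix C assume "C \<in> components K"
      then obtain x where x: "x \<in> K" "C = connected_component_set K x" by (auto simp: components_def)
      then obtain i where "i < ncomps D" "x \<in> k i" using K by auto
      then show "C \<in> k ` {..<ncomps D}" using comps x(2) by blast
    qed
    show "k ` {..<ncomps D} \<subseteq> components K"
    proof
      fix C assume "C \<in> k ` {..<ncomps D}"
      then obtain i where i: "i < ncomps D" "C = k i" by auto
      then obtain x where x: "x \<in> k i" using ne by blast
      then show "C \<in> components K" using comps[OF i(1) x] i K by (auto simp: components_def image_iff)
    qed
  qed
  moreover have "inj_on k {..<ncomps D}"
    by (rule inj_onI) (metis disj ne Int_absorb lessThan_iff)
  ultimately show ?thesis by (simp add: card_image)
qed

lemma gauge_equiv_cong:
  assumes "gauge_equiv X t t'" "\<And>a b. a \<in> X \<Longrightarrow> b \<in> X \<Longrightarrow> t a b = u a b \<and> t' a b = u' a b"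
  shows "gauge_equiv X u u'"
proof -
  obtain F where F: "\<forall>x\<in>X. \<exists>W. open W \<and> x \<in> W \<and> (\<forall>a\<in>W \<inter> X. \<forall>b\<in>W \<inter> X. F a + t a b = t' a b + F b)"
    using assms(1) unfolding gauge_equiv_def by (elim exE)
  show ?thesis
    unfolding gauge_equiv_def
  proof (intro exI[of _ F] ballI)
    fix x assume "x \<in> X"
    from bspec[OF F this] obtain W where W: "open W" "x \<in> W"
      "\<forall>a\<in>W \<inter> X. \<forall>b\<in>W \<inter> X. F a + t a b = t' a b + F b" by (elim exE conjE)
    have "F a + u a b = u' a b + F b" if "a \<in> W \<inter> X" "b \<in> W \<inter> X" for a b
    proof -
      have "F a + t a b = t' a b + F b" using W(3) that by blast
      moreover have "t a b = u a b \<and> t' a b = u' a b" using assms(2)[of a b] that by blast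
      ultimately show ?thesis by metis
    qed
    then show "\<exists>W. open W \<and> x \<in> W \<and> (\<forall>a\<in>W \<inter> X. \<forall>b\<in>W \<inter> X. F a + u a b = u' a b + F b)"
      using W(1,2) by (intro exI[of _ W] conjI ballI)
  qed
qed

text \<open>\<open>A\<close> is the diagram under study and \<open>B\<close> a crossingless one with
  equally many strands; \<open>\<psi>\<close> carries the complement for \<open>B\<close> to that
  for \<open>A\<close>. The function \<open>ind\<close> tells the chosen faces of \<open>B\<close>
  apart.\<close>

locale link_comparison =
  A: diagram_lift D h + B: walled_lift D' h' H for D h D' h' H +
  fixes \<psi> \<kappa> :: "(real^3) \<times> real \<Rightarrow> (real^3) \<times> real" and z :: "nat \<Rightarrow> real^3" and ind :: "real^3 \<Rightarrow> nat"
  assumes same_ncomps: "ncomps D' = ncomps D"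
    and hom: "homeomorphism S3 S3 \<psi> \<kappa>" and maps_K: "\<psi> ` B.K = A.K"
    and faces: "\<And>k. k \<le> ncomps D \<Longrightarrow> z k \<in> S2 - B.P \<and> ind (z k) = k"
    and ind: "loc_const (S2 - B.P) ind"
begin

text \<open>Any weights on the numbered faces of the crossingless diagram give a class there, which
  is transported to the complement that the other diagram describes.\<close>

definition pull where "pull b u v = wall_cocycle H (\<lambda>x. b (ind x)) (\<kappa> u) (\<kappa> v)"

lemma \<psi>_maps: "\<psi> ` B.X \<subseteq> A.X" "continuous_on B.X \<psi>" "\<And>u. u \<in> B.X \<Longrightarrow> \<kappa> (\<psi> u) = u"
  and \<kappa>_maps: "\<kappa> ` A.X \<subseteq> B.X" "continuous_on A.X \<kappa>"
proof -
  have h1: "\<And>x. x \<in> S3 \<Longrightarrow> \<kappa> (\<psi> x) = x" "\<And>x. x \<in> S3 \<Longrightarrow> \<psi> (\<kappa> x) = x"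
    "\<And>x. x \<in> S3 \<Longrightarrow> \<psi> x \<in> S3" "\<And>x. x \<in> S3 \<Longrightarrow> \<kappa> x \<in> S3" "continuous_on S3 \<psi>" "continuous_on S3 \<kappa>"
    using hom unfolding homeomorphism_def by blast+
  have KB: "B.K \<subseteq> S3"
  proof -
    have "at_height (strand D' i s) (h' i s) \<in> S3" if "i < ncomps D'" for i s
      using B.h_bounds[OF that, of s] by (intro at_height_in_S3 B.strand_facts(1)[OF that]) auto
    then show ?thesis unfolding B.K_def by blast
  qed
  show "\<psi> ` B.X \<subseteq> A.X"
  proof
    fix y assume "y \<in> \<psi> ` B.X"
    then obtain x where x: "x \<in> S3" "x \<notin> B.K" "y = \<psi> x" by blast
    have "y \<notin> A.K"
    proof
      assume "y \<in> A.K"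
      then obtain w where "w \<in> B.K" "\<psi> x = \<psi> w" using maps_K x(3) by blast
      then have "x = w" using h1(1)[of x] h1(1)[of w] x(1) KB by force
      then show False using x(2) \<open>w \<in> B.K\<close> by simp
    qed
    then show "y \<in> A.X" using h1(3)[OF x(1)] x(3) by blast
  qed
  show "\<kappa> ` A.X \<subseteq> B.X"
  proof
    fix y assume "y \<in> \<kappa> ` A.X"
    then obtain x where x: "x \<in> S3" "x \<notin> A.K" "y = \<kappa> x" by blast
    have "y \<notin> B.K"
    proof
      assume "y \<in> B.K"
      then have "\<psi> y \<in> A.K" unfolding maps_K[symmetric] by (rule imageI)
      then show False using h1(2)[OF x(1)] x(2,3) by simp
    qed
    then show "y \<in> B.X" using h1(4)[OF x(1)] x(3) by blast
  qed
  show "continuous_on B.X \<psi>" "continuous_on A.X \<kappa>"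
    by (rule continuous_on_subset[OF h1(5)], blast, rule continuous_on_subset[OF h1(6)], blast)
  show "\<And>u. u \<in> B.X \<Longrightarrow> \<kappa> (\<psi> u) = u" using h1(1) by blast
qed

lemma pull_local_cocycle: "local_cocycle A.X (pull b)"
  unfolding pull_def[abs_def]
  by (rule local_cocycle_compose[OF B.wall_cocycle_local \<kappa>_maps(2,1)])
    (rule loc_const_combine[OF ind ind, where q = "\<lambda>x _. b x"])

lemma pull_hom:
  assumes "\<And>g g'. \<phi> (g + g') = \<phi> g + \<phi> (g' :: 'g::group_add)"
  shows "\<phi> (pull b u v) = (pull (\<lambda>k. \<phi> (b k)) u v :: 'h::group_add)"
proof -
  have "\<phi> 0 + \<phi> 0 = \<phi> 0 + 0" using assms[of 0 0] by simp
  then have 0: "\<phi> 0 = 0" by (rule add_left_imp_eq)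
  have "\<phi> (- g) = - \<phi> g" for g
    using assms[of g "- g"] 0 by (metis add.right_inverse minus_unique)
  then show ?thesis using 0 by (simp add: pull_def wall_cocycle_def)
qed

text \<open>At the chosen points of the faces the equivalence becomes an equation between weights
  with only two unknown constants, one from above the wall and one from below.\<close>

lemma pull_gauge:
  assumes "gauge_equiv A.X (pull b) (pull b')"
  shows "\<exists>T E. \<forall>k\<le>ncomps D. T + b k = b' k + E"
proof -
  have "gauge_equiv B.X (\<lambda>u v. pull b (\<psi> u) (\<psi> v)) (\<lambda>u v. pull b' (\<psi> u) (\<psi> v))"
    by (rule gauge_equiv_compose[OF assms \<psi>_maps(2,1)])
  then have "gauge_equiv B.X (wall_cocycle H (\<lambda>x. b (ind x))) (wall_cocycle H (\<lambda>x. b' (ind x)))"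
    by (rule gauge_equiv_cong) (simp add: pull_def \<psi>_maps(3))
  then obtain T E where TE: "\<forall>y\<in>S2 - B.P. T + b (ind y) = b' (ind y) + E"
    using B.wall_gauge by blast
  have "T + b k = b' k + E" if "k \<le> ncomps D" for k
    using TE faces[OF that] by metis
  then show ?thesis by blast
qed

definition bits :: "nat set \<Rightarrow> nat \<Rightarrow> bit" where "bits J k = of_bool (k \<in> J)"

text \<open>The map from subsets of the faces \<open>1, \<dots>, n\<close> to the sets of strands that change the colour is
  injective, hence surjective by counting.\<close>

lemma alternating_sign_exists:
  "\<exists>J. \<forall>f f'. primitive A.U (pull (bits J)) f \<longrightarrow> primitive A.V (pull (bits J)) f' \<longrightarrow>
     (\<forall>i s. i < ncomps D \<longrightarrow> \<not> A.passage i s \<longrightarrow> A.two_sided (A.transition f f') i s)"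
proof -
  let ?n = "ncomps D"
  have "\<forall>J. \<exists>f. primitive A.U (pull (bits J)) f" using A.above_primitive[OF pull_local_cocycle] by blast
  then obtain f where f: "\<And>J. primitive A.U (pull (bits J)) (f J)" by metis
  have "\<forall>J. \<exists>f. primitive A.V (pull (bits J)) f" using A.below_primitive[OF pull_local_cocycle] by blast
  then obtain f' where f': "\<And>J. primitive A.V (pull (bits J)) (f' J)" by metis
  define ts where "ts J i s \<longleftrightarrow> A.two_sided (A.transition (f J) (f' J)) i s" for J i s
  have "\<forall>i. \<exists>s. i < ?n \<longrightarrow> \<not> A.passage i s" using A.nonpassage_between[OF _ zero_less_one] by metis
  then obtain s where s: "\<And>i. i < ?n \<Longrightarrow> \<not> A.passage i (s i)" by metis
  define \<Phi> where "\<Phi> J = {i. i < ?n \<and> ts J i (s i)}" for J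
  have ts_const: "ts J i u \<longleftrightarrow> i \<in> \<Phi> J" if "i < ?n" "\<not> A.passage i u" for J i u
    using A.two_sided_const[OF pull_local_cocycle f f' that(1) that(2) s[OF that(1)]] that(1)
    unfolding ts_def \<Phi>_def by blast
  have inj: "inj_on \<Phi> (Pow {1..?n})"
  proof (rule inj_onI)
    fix J J' assume J: "J \<in> Pow {1..?n}" "J' \<in> Pow {1..?n}" "\<Phi> J = \<Phi> J'"
    have "ts J i u \<longleftrightarrow> ts J' i u" if "i < ?n" "\<not> A.passage i u" for i u
      using ts_const[OF that] J(3) by blast
    then have "gauge_equiv A.X (pull (bits J)) (pull (bits J'))"
      unfolding ts_def by (rule A.sign_gauge[OF pull_local_cocycle pull_local_cocycle f f' f f'])
    then obtain T E where TE: "\<forall>k\<le>?n. T + bits J k = bits J' k + E" using pull_gauge by blast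
    \<comment> \<open>Face 0 is never in \<open>J\<close>. This removes the freedom of adding a
      constant and forces \<open>T = E\<close>.\<close>
    have b0: "bits J 0 = 0" "bits J' 0 = 0" using J(1,2) by (auto simp: bits_def)
    have "T = E" using TE[rule_format, of 0, OF le0] unfolding b0 add_0_left add_0_right .
    then have "bits J k = bits J' k" if "k \<le> ?n" for k
      using TE[rule_format, OF that] by (metis add.commute add_left_imp_eq)
    then have "k \<in> J \<longleftrightarrow> k \<in> J'" if "k \<le> ?n" for k
      using that by (metis bits_def of_bool_eq_iff)
    then show "J = J'" using J(1,2) by auto
  qed
  have "\<Phi> ` Pow {1..?n} = Pow {..<?n}"
  proof (rule card_subset_eq)
    show "\<Phi> ` Pow {1..?n} \<subseteq> Pow {..<?n}" by (auto simp: \<Phi>_def)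
    show "card (\<Phi> ` Pow {1..?n}) = card (Pow {..<?n})" using inj by (simp add: card_image card_Pow)
  qed simp
  then obtain J where J: "{..<?n} = \<Phi> J" by blast
  have "A.two_sided (A.transition g g') i u"
    if "primitive A.U (pull (bits J)) g" "primitive A.V (pull (bits J)) g'" "i < ?n" "\<not> A.passage i u" for g g' i u
    using A.two_sided_primitive_indep[OF that(1,2) f f'] ts_const[OF that(3,4), of J] J that(3)
    unfolding ts_def by blast
  then show ?thesis by blast
qed

lemma not_almost_alternating:
  assumes conn: "connected A.P" and p: "p \<in> crossings D" and alt: "alternating (change_crossing D p)"
    and n: "ncomps D > 2"
  shows False
proof -
  obtain J where J: "\<forall>f f'. primitive A.U (pull (bits J)) f \<longrightarrow> primitive A.V (pull (bits J)) f' \<longrightarrow>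
     (\<forall>i s. i < ncomps D \<longrightarrow> \<not> A.passage i s \<longrightarrow> A.two_sided (A.transition f f') i s)"
    using alternating_sign_exists by (elim exE)
  \<comment> \<open>Together with 0 these are four different face numbers, which is where more than
    two components are needed. Faces 0 and \<open>k1\<close> will have weight 0 and, if both signs
    occur at all, opposite signs.\<close>
  obtain k1 k2 k3 where k: "k1 \<le> ncomps D" "k2 \<le> ncomps D" "k3 \<le> ncomps D" "k2 \<noteq> k3" "k1 \<noteq> k2" "k1 \<noteq> k3"
      "0 < k2" "0 < k3" "bits J k1 = bits J 0 \<longrightarrow> (\<forall>k\<le>ncomps D. bits J k = bits J 0)"
  proof (cases "\<exists>k\<le>ncomps D. bits J k \<noteq> bits J 0")
    case True
    then obtain k1 where k1: "k1 \<le> ncomps D" "bits J k1 \<noteq> bits J 0" by blast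
    define k2 :: nat where "k2 = (if k1 = 1 then 2 else 1)"
    define k3 :: nat where "k3 = (if k1 = 3 then 2 else 3)"
    show thesis by (rule that[of k1 k2 k3]) (use k1 n in \<open>auto simp: k2_def k3_def\<close>)
  next
    case False
    show thesis
    proof (rule that[of 1 2 3])
      show "bits J 1 = bits J 0 \<longrightarrow> (\<forall>k\<le>ncomps D. bits J k = bits J 0)" using False by blast
    qed (use n in simp_all)
  qed
  \<comment> \<open>The weights 1 and \<i> are independent over the reals, so a nonzero real
    functional cannot vanish on both.\<close>
  define w :: "nat \<Rightarrow> complex" where "w k = (if k = k2 then 1 else if k = k3 then \<i> else 0)" for k
  define b where "b k = Isom (bits J k) (w k)" for k
  obtain f where f: "primitive A.U (pull b) f" using A.above_primitive[OF pull_local_cocycle[of b]] by (elim exE)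
  obtain f' where f': "primitive A.V (pull b) f'" using A.below_primitive[OF pull_local_cocycle[of b]] by (elim exE)
  have flip_pull: "(\<lambda>u v. flip (pull b u v)) = pull (bits J)"
    using pull_hom[OF flip_add, of b] by (simp add: b_def fun_eq_iff)
  have ff: "primitive A.U (pull (bits J)) (\<lambda>z. flip (f z))" "primitive A.V (pull (bits J)) (\<lambda>z. flip (f' z))"
    using primitive_hom[OF f flip_add] primitive_hom[OF f' flip_add] unfolding flip_pull by simp_all
  have ts: "A.two_sided (A.transition (\<lambda>z. flip (f z)) (\<lambda>z. flip (f' z))) i s" if "i < ncomps D" "\<not> A.passage i s" for i s
    using J ff that by blast
  have flips: "reflection_pair (vals A.P (A.transition f f') (strand D i s))" if "i < ncomps D" "\<not> A.passage i s" for i s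
    by (rule A.flips_reflection_pair[OF f f' that ts[OF that]])
  obtain W gA gB gC gD where W: "openin (top_of_set S2) W" "p \<in> W"
    and vp: "vals A.P (A.transition f f') p = {gA, gB, gC, gD}"
    and off: "\<forall>y\<in>W - A.P. A.transition f f' y \<in> {gA, gB, gC, gD}"
    and fl: "flip gA = flip gC" "flip gB = flip gD" "flip gA \<noteq> flip gB" "shift gA + shift gB = shift gC + shift gD"
  proof -
    have "\<exists>W gA gB gC gD. openin (top_of_set S2) W \<and> p \<in> W
      \<and> vals A.P (A.transition f f') p = {gA, gB, gC, gD}
      \<and> (\<forall>y\<in>W - A.P. A.transition f f' y \<in> {gA, gB, gC, gD})
      \<and> flip gA = flip gC \<and> flip gB = flip gD \<and> flip gA \<noteq> flip gB \<and> shift gA + shift gB = shift gC + shift gD"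
      by (rule A.crossing_flips[OF pull_local_cocycle f f' _ p]) (rule flips)
    then show thesis using that by (elim exE conjE)
  qed
  define \<delta> where "\<delta> = shift gA - shift gC"
  \<comment> \<open>A nonzero real functional on \<open>\<complex>\<close> that vanishes on \<open>\<delta>\<close>.\<close>
  define \<mu> where "\<mu> = (if \<delta> = 0 then 1 else \<i> * cnj \<delta>)"
  have \<mu>: "\<mu> \<noteq> 0" "Re (\<delta> * \<mu>) = 0"
    by (auto simp: \<mu>_def algebra_simps)
  define l where "l v = Re (v * \<mu>)" for v
  have l_add: "l (v + v') = l v + l v'" for v v' by (simp add: l_def algebra_simps)
  have l_minus: "l (- v) = - l v" for v by (simp add: l_def)
  define \<Lambda> :: "complex isom \<Rightarrow> real isom" where "\<Lambda> g = Isom (flip g) (l (shift g))" for g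
  have hom\<Lambda>: "\<Lambda> (g + g') = \<Lambda> g + \<Lambda> g'" for g g'
    by (simp add: \<Lambda>_def plus_isom_def signed_def l_add l_minus)
  define t where "t u v = \<Lambda> (pull b u v)" for u v
  have t_pull: "t = pull (\<lambda>k. \<Lambda> (b k))" using pull_hom[OF hom\<Lambda>, of b] by (simp add: t_def fun_eq_iff)
  have prim: "primitive A.U t (\<lambda>z. \<Lambda> (f z))" "primitive A.V t (\<lambda>z. \<Lambda> (f' z))"
    using primitive_hom[OF f hom\<Lambda>] primitive_hom[OF f' hom\<Lambda>] unfolding t_def[abs_def] by simp_all
  let ?c = "A.transition f f'" and ?c' = "A.transition (\<lambda>z. \<Lambda> (f z)) (\<lambda>z. \<Lambda> (f' z))"
  have \<Lambda>diff: "\<Lambda> (g - g') = \<Lambda> g - \<Lambda> g'" for g g'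
    using hom\<Lambda>[of "g - g'" g'] by (simp add: eq_diff_eq)
  have c': "?c' y = \<Lambda> (?c y)" for y by (simp add: A.transition_def \<Lambda>diff)

  have lAC: "l (shift gA) = l (shift gC)"
  proof -
    have "l (shift gA) = l (\<delta> + shift gC)" by (simp add: \<delta>_def)
    then show ?thesis unfolding l_add using \<mu>(2) by (simp add: l_def)
  qed
  have lBD: "l (shift gB) = l (shift gD)"
    using arg_cong[OF fl(4), of l] lAC by (simp add: l_add)
  have \<Lambda>eq: "\<Lambda> gC = \<Lambda> gA" "\<Lambda> gD = \<Lambda> gB" using fl(1,2) lAC lBD by (simp_all add: \<Lambda>_def)
  \<comment> \<open>The functional identifies the colours of opposite faces at \<open>p\<close>,
    which gives the hypothesis \<open>at_p\<close>.\<close>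
  have "vals A.P ?c' p = {\<Lambda> gA, \<Lambda> gB}"
  proof
    show "vals A.P ?c' p \<subseteq> {\<Lambda> gA, \<Lambda> gB}"
    proof (rule vals_subset[OF W])
      fix y assume "y \<in> W - A.P"
      then have "?c y \<in> {gA, gB, gC, gD}" using off by blast
      then show "?c' y \<in> {\<Lambda> gA, \<Lambda> gB}" unfolding c' using \<Lambda>eq by auto
    qed
    have "\<Lambda> ` vals A.P ?c p \<subseteq> vals A.P ?c' p" by (rule vals_image_subset) (rule c')
    then show "{\<Lambda> gA, \<Lambda> gB} \<subseteq> vals A.P ?c' p" unfolding vp by simp
  qed
  then have at_p: "reflection_pair (vals A.P ?c' p)" using fl(3) by (simp add: reflection_pair_insert \<Lambda>_def)
  have flips': "reflection_pair (vals A.P ?c' (strand D i s))" if "i < ncomps D" "\<not> A.passage i s" for i s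
  proof (rule A.flips_reflection_pair[OF prim that])
    show "A.two_sided (A.transition (\<lambda>z. flip (\<Lambda> (f z))) (\<lambda>z. flip (\<Lambda> (f' z)))) i s"
      using ts[OF that] by (simp add: \<Lambda>_def)
  qed
  have coc: "local_cocycle A.X t" unfolding t_pull by (rule pull_local_cocycle)
  interpret alternating_colouring D h t "\<lambda>z. \<Lambda> (f z)" "\<lambda>z. \<Lambda> (f' z)" p
    by unfold_locales (rule coc prim p alt flips' at_p; assumption?)+
  have "gauge_equiv A.X t (\<lambda>u v. Isom (flip (t u v)) 0)" by (rule gauge_equiv_sign[OF conn])
  moreover have "(\<lambda>u v. Isom (flip (t u v)) 0) = pull (\<lambda>k. Isom (bits J k) (0::real))"
  proof -
    define \<phi> :: "real isom \<Rightarrow> real isom" where "\<phi> g = Isom (flip g) 0" for g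
    have hom\<phi>: "\<phi> (g + g') = \<phi> g + \<phi> g'" for g g' by (simp add: \<phi>_def plus_isom_def signed_def)
    show ?thesis unfolding t_pull using pull_hom[OF hom\<phi>, of "\<lambda>k. \<Lambda> (b k)"]
      by (simp add: \<phi>_def \<Lambda>_def b_def fun_eq_iff)
  qed
  ultimately have "gauge_equiv A.X (pull (\<lambda>k. \<Lambda> (b k))) (pull (\<lambda>k. Isom (bits J k) (0::real)))"
    by (simp add: t_pull)
  then obtain T E where TE: "\<forall>k\<le>ncomps D. T + \<Lambda> (b k) = Isom (bits J k) 0 + E" using pull_gauge by blast
  have TE': "shift T + signed (flip T) (l (w k)) = signed (bits J k) (shift E)" if "k \<le> ncomps D" for k
    using arg_cong[OF TE[rule_format, OF that], of shift] by (simp add: plus_isom_def \<Lambda>_def b_def)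
  have l0: "l 0 = 0" by (simp add: l_def)
  have s0: "signed s 0 = (0::real)" "signed s r = 0 \<longleftrightarrow> r = 0" for s and r :: real by (simp_all add: signed_def)
  have w0: "w 0 = 0" "w k1 = 0" using k by (auto simp: w_def)
  have e0: "shift T = signed (bits J 0) (shift E)" using TE'[of 0] w0 l0 s0 by simp
  have e1: "shift T = signed (bits J k1) (shift E)" using TE'[of k1] k(1) w0 l0 s0 by simp
  \<comment> \<open>If both signs occur, faces 0 and \<open>k1\<close> force
    \<open>shift E = 0\<close>; otherwise the sign is the same on all numbered faces. In both cases
    the right hand side equals \<open>shift T\<close>, so the weight is 0.\<close>
  have lw: "l (w k) = 0" if kk: "k \<le> ncomps D" for k
  proof -
    have "signed (bits J k) (shift E) = shift T"
    proof (cases "bits J k1 = bits J 0")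
      case True
      have "bits J k = bits J 0" by (rule mp[OF spec[OF mp[OF k(9) True]] kk])
      then show ?thesis unfolding e0 by (rule arg_cong)
    next
      case False
      then have "shift E = 0" using e0 e1 by (auto simp: signed_def bits_def split: if_splits)
      then show ?thesis using e0 s0 by simp
    qed
    then show ?thesis using TE'[OF kk] s0 by simp
  qed
  \<comment> \<open>The functional vanishes on 1 and on \<i>, hence is zero, contrary to its
    choice.\<close>
  have "Re \<mu> = 0" using lw[OF k(2)] by (simp add: w_def l_def)
  moreover have "Im \<mu> = 0" using lw[OF k(3)] k(4) by (simp add: w_def l_def)
  ultimately show False using \<mu>(1) by (simp add: complex_eq_iff)
qed

end

lemma projects_to_lift:
  assumes "projects_to K D" "is_diagram D" "0 < ncomps D"
  obtains h where "diagram_lift D h" "K = height_curves.K (ncomps D) (strand D) h"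
proof -
  obtain h where h: "\<forall>i<ncomps D. continuous_on UNIV (h i) \<and> (\<forall>s. h i (s + 1) = h i s) \<and> (\<forall>s. -1 < h i s \<and> h i s < 1)"
    "\<forall>i s j t. meet D i s j t \<and> over D i s \<longrightarrow> h j t < h i s"
    "K = (\<Union>i<ncomps D. range (\<lambda>s. at_height (strand D i s) (h i s)))"
    using assms(1) unfolding projects_to_def by (elim exE conjE)
  have d: "diagram_lift D h" by unfold_locales (use assms(2,3) h(1,2) in auto)
  then interpret diagram_lift D h .
  show thesis using that[OF d] h(3) by (simp add: K_def)
qed

theorem corollary2p5:
  fixes L :: "((real^3) \<times> real) set"
  assumes "link L"
    and "card (components L) > 2"
    and "\<exists>D. has_diagram L D \<and> connected_diagram D \<and> almost_alternating D"
  shows "\<not> trivial_link L"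
proof
  assume "trivial_link L"
  then obtain D' K' where D': "is_diagram D'" "projects_to K' D'" "ambient_isotopic L K'" "crossings D' = {}"
    unfolding trivial_link_def has_diagram_def by blast
  obtain D K where D: "is_diagram D" "projects_to K D" "ambient_isotopic L K" "connected_diagram D" "almost_alternating D"
    using assms(3) unfolding has_diagram_def by blast
  obtain p where p: "p \<in> crossings D" "alternating (change_crossing D p)"
    using D(5) unfolding almost_alternating_def by blast
  have LS: "L \<subseteq> S3" using assms(1) by (simp add: link_def)
  have iso: "\<exists>f g. homeomorphism S3 S3 f g \<and> f ` L = M" if amb: "ambient_isotopic L M" for M
  proof -
    obtain F :: "real \<Rightarrow> (real^3) \<times> real \<Rightarrow> (real^3) \<times> real" where
      F: "\<forall>t\<in>{0..1}. \<exists>g. homeomorphism S3 S3 (F t) g" "F 1 ` L = M"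
      using amb unfolding ambient_isotopic_def by blast
    from bspec[OF F(1), of 1] obtain g where "homeomorphism S3 S3 (F 1) g" by auto
    then show ?thesis using F(2) by blast
  qed
  obtain f g where f: "homeomorphism S3 S3 f g" "f ` L = K" using iso[OF D(3)] by blast
  obtain f' g' where f': "homeomorphism S3 S3 f' g'" "f' ` L = K'" using iso[OF D'(3)] by blast
  have cards: "card (components L) = card (components M)" if "homeomorphism S3 S3 q r" "q ` L = M" for q r M
    by (rule card_components_homeomorphism[OF homeomorphism_of_subsets[OF that(1) LS]]) (use that in auto)
  have ne: "L \<noteq> {}" using assms(2) by auto
  have pos: "0 < ncomps D" "0 < ncomps D'"
    using D(2) D'(2) f(2) f'(2) ne unfolding projects_to_def by (auto intro: gr0I)
  obtain h where h: "diagram_lift D h" "K = height_curves.K (ncomps D) (strand D) h"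
    by (rule projects_to_lift[OF D(2,1) pos(1)])
  obtain h' where h': "diagram_lift D' h'" "K' = height_curves.K (ncomps D') (strand D') h'"
    by (rule projects_to_lift[OF D'(2,1) pos(2)])
  interpret A: diagram_lift D h by (rule h(1))
  interpret B0: crossingless_lift D' h'
    by (intro crossingless_lift.intro h'(1) crossingless_lift_axioms.intro D'(4))
  obtain H where H: "continuous_on S2 H" "\<forall>x\<in>S2. -1 < H x \<and> H x < 1"
    "\<forall>i s. i < ncomps D' \<longrightarrow> H (strand D' i s) = h' i s"
    by (rule B0.wall_exists)
  interpret B: walled_lift D' h' H by unfold_locales (use H in auto)
  have n: "ncomps D' = ncomps D"
    using cards[OF f] cards[OF f'] A.card_components_K B0.card_components_K h(2) h'(2) by simp
  obtain z ind where zi: "\<forall>k\<le>ncomps D'. z k \<in> S2 - B0.P \<and> ind (z k) = k" "loc_const (S2 - B0.P) ind"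
    using B0.face_index by (elim exE conjE)
  \<comment> \<open>From the crossingless position back to \<open>L\<close>, then on to the almost
    alternating one.\<close>
  have hom: "homeomorphism S3 S3 (f \<circ> g') (f' \<circ> g)"
    by (rule homeomorphism_compose[OF homeomorphism_symD[OF f'(1)] f(1)])
  have "g' (f' x) = x" if "x \<in> L" for x
    using homeomorphism_apply1[OF f'(1)] that LS by blast
  then have "g' ` K' = L" unfolding f'(2)[symmetric] image_image by simp
  then have maps: "(f \<circ> g') ` B0.K = A.K" using f(2) h(2) h'(2) by (simp only: image_comp[symmetric])
  interpret link_comparison D h D' h' H "f \<circ> g'" "f' \<circ> g" z ind
    by unfold_locales (use n hom maps zi in auto)
  have "connected A.P" using D(4) by (simp add: connected_diagram_def projection_def A.P_def)
  moreover have "ncomps D > 2" using cards[OF f] A.card_components_K h(2) assms(2) by simp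
  ultimately show False using not_almost_alternating p by blast
qed

end
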